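(* Let $\delta>0$, let $U\subseteq\mathbb{R}^d$ be open, and let $u,v:\overline U\to\mathbb{R}$ be such that $u$ and $-v$ are upper semicontinuous on $\overline U$. Assume that, in the viscosity sense, $$\delta u-\mathrm{tr}\big(A(x)D^2u\big)+H(Du,x)\le 0\le \delta v-\mathrm{tr}\big(A(x)D^2v\big)+H(Dv,x)\quad\text{in }U,$$ and that $$u\le v\ \text{ on }\partial U,\qquad \limsup_{x\in U,\ |x|\to\infty}\frac{u(x)}{1+|x|}\le 0\le \liminf_{x\in U,\ |x|\to\infty}\frac{v(x)}{1+|x|}$$ (the growth conditions being vacuous if $U$ is bounded). Then $u\le v$ in $U$.
   Context: Notation: $B_R$ is the open ball of radius $R$ centered at $0$ in $\mathbb{R}^d$; $\mathbb{S}^d$ is the set of real symmetric $d\times d$ matrices; $|\cdot|$ is the Euclidean norm (Frobenius norm for matrices). Standing assumptions on the coefficients. Fix $m>1$, $n\in\mathbb{N}$, $\Lambda_1\ge1$, $\Lambda_2\ge0$. The map $A:\mathbb{R}^d\to\mathbb{S}^d$ has the form $A=\frac12\sigma^t\sigma$ with $\sigma:\mathbb{R}^d\to\mathbb{R}^{n\times d}$ satisfying $|\sigma(x)|\le\Lambda_2$ and $|\sigma(x)-\sigma(y)|\le\Lambda_2|x-y|$ for all $x,y\in\mathbb{R}^d$. The Hamiltonian $H:\mathbb{R}^d\times\mathbb{R}^d\to\mathbb{R}$, $(p,x)\mapsto H(p,x)$, satisfies: $p\mapsto H(p,x)$ is convex for every $x\in\mathbb{R}^d$; and for every $R>0$ there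 exist constants $0<a_R\le1$ and $M_R\ge1$ such that for all $p,q\in\mathbb{R}^d$ and $x,y\in B_R$, $$a_R|p|^m-M_R\le H(p,x)\le\Lambda_1(|p|^m+1),$$ $$|H(p,x)-H(p,y)|\le(\Lambda_1|p|^m+M_R)|x-y|,$$ $$|H(p,x)-H(q,x)|\le\Lambda_1(|p|+|q|+1)^{m-1}|p-q|.$$ Viscosity sense: for upper semicontinuous $u$, the inequality $\delta u-\mathrm{tr}(A D^2u)+H(Du,x)\le0$ in $U$ means that whenever $\varphi$ is smooth near $y\in U$ and $u-\varphi$ has a local maximum at $y$, then $\delta u(y)-\mathrm{tr}(A(y)D^2\varphi(y))+H(D\varphi(y),y)\le0$. For lower semicontinuous $v$, the inequality $\ge0$ means that whenever $v-\varphi$ has a local minimum at $y\in U$, then $\delta v(y)-\mathrm{tr}(A(y)D^2\varphi(y))+H(D\varphi(y),y)\ge0$. *)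

theory Defs
  imports "HOL-Analysis.Analysis"
begin

definition grad :: "(real^'d \<Rightarrow> real) \<Rightarrow> real^'d \<Rightarrow> real^'d" where
  "grad f x = (\<chi> i. frechet_derivative f (at x) (axis i 1))"

definition hess :: "(real^'d \<Rightarrow> real) \<Rightarrow> real^'d \<Rightarrow> real^'d^'d" where
  "hess f x = jacobian (grad f) (at x)"

lemma grad_eq_gderiv: "GDERIV f x :> D \<Longrightarrow> grad f x = D"
  by (auto simp: grad_def gderiv_def vec_eq_iff inner_axis' frechet_derivative_at[symmetric])

text \<open>Continuous differentiability of order \<open>k\<close> on an open set \<open>S\<close>.  The derivatives are
  two-sided, so the notion is only meaningful for open \<open>S\<close>.\<close>

primrec Ck_on :: "nat \<Rightarrow> (real^'d) set \<Rightarrow> (real^'d \<Rightarrow> real) \<Rightarrow> bool" where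
  "Ck_on 0 S f \<longleftrightarrow> continuous_on S f"
| "Ck_on (Suc k) S f \<longleftrightarrow>
     (\<forall>x\<in>S. f differentiable (at x)) \<and> (\<forall>i. Ck_on k S (\<lambda>x. grad f x $ i))"

definition smooth_near :: "(real^'d \<Rightarrow> real) \<Rightarrow> real^'d \<Rightarrow> bool" where
  "smooth_near f y \<longleftrightarrow> (\<exists>V. open V \<and> y \<in> V \<and> (\<forall>k. Ck_on k V f))"

text \<open>A function on a set \<open>S\<close> is represented by a total function; only its values on \<open>S\<close>
  matter here.  Lower semicontinuity of \<open>v\<close> is upper semicontinuity of \<open>- v\<close>.\<close>

definition usc_on :: "('a::topological_space) set \<Rightarrow> ('a \<Rightarrow> real) \<Rightarrow> bool" where
  "usc_on S u \<longleftrightarrow> (\<forall>x\<in>S. \<forall>c. u x < c \<longrightarrow> (\<forall>\<^sub>F y in at x within S. u y < c))"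

text \<open>The two inequalities \<open>\<delta> u - tr (A D\<^sup>2u) + H(Du,x) \<le> 0\<close> and \<open>\<ge> 0\<close> in the open set \<open>U\<close>, in
  the viscosity sense.  As \<open>U\<close> is open, a local extremum at \<open>y \<in> U\<close> only involves values on \<open>U\<close>.
  Semicontinuity is not part of these definitions.\<close>

definition visc_subsol ::
  "real \<Rightarrow> (real^'d \<Rightarrow> real^'d^'d) \<Rightarrow> (real^'d \<Rightarrow> real^'d \<Rightarrow> real) \<Rightarrow> (real^'d) set \<Rightarrow> (real^'d \<Rightarrow> real) \<Rightarrow> bool"
  where
  "visc_subsol \<delta> A H U u \<longleftrightarrow>
     (\<forall>y\<in>U. \<forall>\<phi>. smooth_near \<phi> y \<longrightarrow>
        (\<forall>\<^sub>F x in nhds y. u x - \<phi> x \<le> u y - \<phi> y) \<longrightarrow>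
        \<delta> * u y - trace (A y ** hess \<phi> y) + H (grad \<phi> y) y \<le> 0)"

definition visc_supersol ::
  "real \<Rightarrow> (real^'d \<Rightarrow> real^'d^'d) \<Rightarrow> (real^'d \<Rightarrow> real^'d \<Rightarrow> real) \<Rightarrow> (real^'d) set \<Rightarrow> (real^'d \<Rightarrow> real) \<Rightarrow> bool"
  where
  "visc_supersol \<delta> A H U v \<longleftrightarrow>
     (\<forall>y\<in>U. \<forall>\<phi>. smooth_near \<phi> y \<longrightarrow>
        (\<forall>\<^sub>F x in nhds y. v x - \<phi> x \<ge> v y - \<phi> y) \<longrightarrow>
        \<delta> * v y - trace (A y ** hess \<phi> y) + H (grad \<phi> y) y \<ge> 0)"

text \<open>Standing assumptions on the coefficients.  The norm on \<open>real^'d^'n\<close> (the type of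
  \<open>n \<times> d\<close> matrices) is the Frobenius norm.\<close>

definition diffusion_coeff ::
  "real \<Rightarrow> (real^'d \<Rightarrow> real^'d^'n) \<Rightarrow> (real^'d \<Rightarrow> real^'d^'d) \<Rightarrow> bool" where
  "diffusion_coeff \<Lambda>2 \<sigma> A \<longleftrightarrow>
     (\<forall>x. A x = (1/2) *\<^sub>R (transpose (\<sigma> x) ** \<sigma> x)) \<and>
     (\<forall>x. norm (\<sigma> x) \<le> \<Lambda>2) \<and>
     (\<forall>x y. norm (\<sigma> x - \<sigma> y) \<le> \<Lambda>2 * norm (x - y))"

definition hamiltonian :: "real \<Rightarrow> real \<Rightarrow> (real^'d \<Rightarrow> real^'d \<Rightarrow> real) \<Rightarrow> bool" where
  "hamiltonian m \<Lambda>1 H \<longleftrightarrow>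
     (\<forall>x. convex_on UNIV (\<lambda>p. H p x)) \<and>
     (\<forall>R>0. \<exists>a M. 0 < a \<and> a \<le> 1 \<and> 1 \<le> M \<and>
        (\<forall>p q. \<forall>x\<in>ball 0 R. \<forall>y\<in>ball 0 R.
           a * norm p powr m - M \<le> H p x \<and>
           H p x \<le> \<Lambda>1 * (norm p powr m + 1) \<and>
           \<bar>H p x - H p y\<bar> \<le> (\<Lambda>1 * norm p powr m + M) * norm (x - y) \<and>
           \<bar>H p x - H q x\<bar> \<le> \<Lambda>1 * (norm p + norm q + 1) powr (m - 1) * norm (p - q)))"

end

(*
  Doubling of variables with a degenerate second-order term needs a theorem on sums; here it is
  obtained without Alexandrov's theorem.  Applying the Lasry-Lions regularization to u gives a
  C^{1,1} function W lying between the sup-convolution of u and the inf-convolution of v plus an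
  affine function, for all small linear perturbations p of the doubled functional at once.  The
  contact points z p are expansive in p, so they do not form a null set, and by Rademacher's
  theorem W has a second-order expansion at one of them; this one Hessian yields both jets.

  The x-dependence of H, of size |Du|^m |x - y|, is absorbed by convexity: replacing u by
  lam u - (1 - lam) (sqrt (1 + |x|^2) + K) gains a multiple of |Du|^m from the Jensen gap of the
  superlinear H, and also forces decay at infinity, so that the doubling takes place on a compact
  set.  Finally lam tends to 1.
*)

theory Submission
  imports Defs
begin

text \<open>The penalty in the doubling only yields |x - y|^2 / \<epsilon> -> 0, while the slope has
  size |x - y| / \<epsilon>. Since m > 1, the error |Du|^m |x - y| may grow like a negative power of
  \<epsilon>; it cannot be sent to 0 and has to be dominated. The gain c |Q|^m - C from the Jensen
  gap carries a constant C that is not small. But the gap is also nonnegative, so it is at least s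
  (c |Q|^m - C) for every s in [0, 1], and s is taken so small that s C is a fraction of \<delta>
  times the supposed positive maximum. Then |x - y| only has to be small against s c, whatever the
  size of Q. Hence the order of choices: lam fixes the compact set, its radius R fixes a_R and M_R
  and with them c and C, the maximum fixes s, and \<epsilon> goes to 0 last.

  On the second-order side only an inequality between two quadratic forms enters, applied to the
  rows of \<sigma>(x) and \<sigma>(y). The v-form is the Hessian of W up to a small error; the
  u-form is a partial minimum, and this is where |e - f|^2 / \<epsilon> comes from.\<close>

section \<open>Rademacher's theorem\<close>

text \<open>Adding a linear function produces an increasing bi-Lipschitz bijection \<open>h\<close>.
  The measure A -> |h(A)| is absolutely continuous, because Lipschitz maps preserve null sets, so it
  has a Radon-Nikodym density whose indefinite integral is \<open>h\<close>. Lebesgue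
  differentiation finishes the proof.\<close>

lemma lipschitz_real_differentiable_ae:
  fixes g :: "real \<Rightarrow> real"
  assumes L: "\<And>s t. \<bar>g s - g t\<bar> \<le> L * \<bar>s - t\<bar>"
  obtains N where "negligible N" "\<And>t. t \<notin> N \<Longrightarrow> g differentiable (at t)"
proof -
  \<comment> \<open>The slope \<open>L + 1\<close> rather than \<open>L\<close> gives
    \<open>h\<close> increments of at least \<open>t - s\<close>, hence a 1-Lipschitz
    inverse.\<close>
  define h where "h t = g t + (L + 1) * t" for t
  have h_exp: "t - s \<le> h t - h s" if "s \<le> t" for s t
    using L[of t s] that by (auto simp: h_def algebra_simps)
  have h_mono: "s \<le> t \<Longrightarrow> h s \<le> h t" for s t
    using h_exp by fastforce
  have h_strict: "s < t \<longleftrightarrow> h s < h t" for s t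
    using h_exp[of s t] h_mono[of t s] by linarith
  have h_le: "s \<le> t \<longleftrightarrow> h s \<le> h t" for s t
    using h_strict[of t s] by linarith
  have L0: "0 \<le> L" using L[of 0 1] by simp
  have h_lip: "\<bar>h s - h t\<bar> \<le> (2 * L + 1) * \<bar>s - t\<bar>" for s t
  proof -
    have "h s - h t = (g s - g t) + (L + 1) * (s - t)"
      by (simp add: h_def algebra_simps)
    then have "\<bar>h s - h t\<bar> \<le> \<bar>g s - g t\<bar> + \<bar>(L + 1) * (s - t)\<bar>" by linarith
    also have "\<dots> \<le> L * \<bar>s - t\<bar> + (L + 1) * \<bar>s - t\<bar>"
      using L[of s t] L0 by (simp add: abs_mult)
    finally show ?thesis by (simp add: algebra_simps)
  qed
  have "(2 * L + 1)-lipschitz_on UNIV h"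
    using h_lip L0 by (intro lipschitz_onI) (auto simp: dist_real_def)
  then have cont_h: "continuous_on UNIV h" by (rule lipschitz_on_continuous_on)
  have inj: "inj h" by (metis h_le order_antisym injI order_refl)
  have surj: "surj h"
  proof -
    have "\<exists>x. h x = y" for y
    proof -
      define b where "b = \<bar>y - h 0\<bar>"
      have "h (-b) \<le> y" "y \<le> h b"
        using h_exp[of "-b" 0] h_exp[of 0 b] by (auto simp: b_def)
      then show ?thesis
        using IVT'[of h "-b" y b] continuous_on_subset[OF cont_h] by (force simp: b_def)
    qed
    then show ?thesis by (metis surjI)
  qed
  define k where "k = inv h"
  have hk [simp]: "h (k y) = y" and kh [simp]: "k (h x) = x" for x y
    by (simp_all add: k_def surj_f_inv_f[OF surj] inv_f_f[OF inj])
  have "1-lipschitz_on UNIV k"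
  proof (rule lipschitz_onI)
    fix x y :: real
    show "dist (k x) (k y) \<le> 1 * dist x y"
      using h_exp[of "k x" "k y"] h_exp[of "k y" "k x"]
      by (cases "k x \<le> k y") (auto simp: dist_real_def)
  qed auto
  then have "continuous_on UNIV k" by (rule lipschitz_on_continuous_on)
  then have k_meas [measurable]: "k \<in> borel_measurable borel"
    by (rule borel_measurable_continuous_onI)
  define \<mu> where "\<mu> = distr lborel borel k"
  have vim: "k -` A = h ` A" for A
    using hk kh by force
  have "absolutely_continuous lborel \<mu>"
    unfolding absolutely_continuous_def
  proof
    fix A assume A: "A \<in> null_sets (lborel :: real measure)"
    then have "A \<in> null_sets lebesgue"
      by (simp add: null_sets_completionI)
    then have "negligible A" by (simp add: negligible_iff_null_sets)
    then have "negligible (h ` A)"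
    proof (rule negligible_locally_Lipschitz_image[OF order_refl])
      fix x assume "x \<in> A"
      show "\<exists>T B. open T \<and> x \<in> T \<and> (\<forall>y\<in>A \<inter> T. norm (h y - h x) \<le> B * norm (y - x))"
        using h_lip by (intro exI[of _ UNIV] exI[of _ "2*L+1"]) auto
    qed
    then have "h ` A \<in> null_sets lebesgue" by (simp add: negligible_iff_null_sets)
    then have "k -` A \<in> null_sets lebesgue" by (simp add: vim)
    moreover have "k -` A \<in> sets lborel"
      using A measurable_sets_borel[OF k_meas, of A] by (auto dest: null_setsD2)
    ultimately have "emeasure lborel (k -` A) = 0"
      using null_sets_completion_iff[of "k -` A" lborel] by (auto dest: null_setsD1)
    then show "A \<in> null_sets \<mu>"
      using A by (auto simp: \<mu>_def null_sets_def emeasure_distr)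
  qed
  then obtain f where f_meas [measurable]: "f \<in> borel_measurable lborel"
    and dens: "density lborel f = \<mu>"
    using sigma_finite_measure.Radon_Nikodym[OF sigma_finite_lborel, of \<mu>]
    by (auto simp: \<mu>_def)
  have nn: "(\<integral>\<^sup>+x. f x * indicator {a..b} x \<partial>lborel) = ennreal (h b - h a)" if "a \<le> b" for a b
  proof -
    have "(\<integral>\<^sup>+x. f x * indicator {a..b} x \<partial>lborel) = emeasure \<mu> {a..b}"
      unfolding dens[symmetric] by (subst emeasure_density) auto
    also have "\<dots> = emeasure lborel (k -` {a..b})"
      unfolding \<mu>_def by (subst emeasure_distr) auto
    also have "k -` {a..b} = {h a..h b}"
      using h_le hk by (auto simp: vim) (metis atLeastAtMost_iff image_eqI hk)
    finally show ?thesis using h_mono[OF that] by simp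
  qed
  \<comment> \<open>\<open>f\<close> has extended values, but it is finite almost everywhere on each
    interval because its integral there is finite.\<close>
  define F where "F x = enn2real (f x)" for x
  have F_meas [measurable]: "F \<in> borel_measurable lborel"
    unfolding F_def by measurable
  have int: "(F has_integral (h b - h a)) {a..b}" if "a \<le> b" for a b
  proof -
    have fin: "AE x in lborel. f x * indicator {a..b} x \<noteq> \<infinity>"
      by (rule nn_integral_noteq_infinite) (use nn[OF that] in auto)
    have "(\<integral>\<^sup>+x. ennreal (F x * indicator {a..b} x) \<partial>lborel) = (\<integral>\<^sup>+x. f x * indicator {a..b} x \<partial>lborel)"
      by (rule nn_integral_cong_AE, use fin in eventually_elim)
        (auto simp: F_def indicator_def less_top split: if_splits)
    also note nn[OF that]
    finally have "((\<lambda>x. F x * indicator {a..b} x) has_integral (h b - h a)) UNIV"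
      by (intro nn_integral_has_integral) (use h_mono[OF that] in \<open>auto simp: F_def\<close>)
    moreover have "(\<lambda>x. F x * indicator {a..b} x) = (\<lambda>x. if x \<in> {a..b} then F x else 0)"
      by (auto simp: indicator_def)
    ultimately show ?thesis
      by (simp only: has_integral_restrict_UNIV)
  qed
  have io: "F integrable_on cbox a b" for a b
    using int[of a b] by (cases "a \<le> b") (auto simp: integrable_on_def)
  \<comment> \<open>The averages run over cubes with lower corner \<open>x\<close>, which yields
    only the right derivative; the reflected density below yields the left one.\<close>
  obtain N1 where N1: "negligible N1" and d1: "\<And>x e. \<lbrakk>x \<notin> N1; 0 < e\<rbrakk> \<Longrightarrow>
      \<exists>d>0. \<forall>s. 0 < s \<and> s < d \<longrightarrow> norm (integral (cbox x (x + s *\<^sub>R One)) F /\<^sub>R s ^ DIM(real) - F x) < e"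
    using integrable_ccontinuous_explicit[OF io] by blast
  have int2: "((\<lambda>x. F (- x)) has_integral (h (-a) - h (-b))) {a..b}" if "a \<le> b" for a b
    using has_integral_reflect_lemma_real[OF int[of "-b" "-a"]] that by simp
  have io2: "(\<lambda>x. F (- x)) integrable_on cbox a b" for a b
    using int2[of a b] by (cases "a \<le> b") (auto simp: integrable_on_def)
  obtain N2 where N2: "negligible N2" and d2: "\<And>x e. \<lbrakk>x \<notin> N2; 0 < e\<rbrakk> \<Longrightarrow>
      \<exists>d>0. \<forall>s. 0 < s \<and> s < d \<longrightarrow> norm (integral (cbox x (x + s *\<^sub>R One)) (\<lambda>x. F (- x)) /\<^sub>R s ^ DIM(real) - F (- x)) < e"
    using integrable_ccontinuous_explicit[OF io2] by blast
  have "negligible (uminus ` N2)"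
    by (rule negligible_locally_Lipschitz_image[OF order_refl N2])
      (metis open_UNIV UNIV_I mult_1 norm_minus_commute minus_diff_minus order_refl norm_minus_cancel)
  with N1 have "negligible (N1 \<union> uminus ` N2)" by simp
  moreover have "g differentiable (at t)" if t: "t \<notin> N1 \<union> uminus ` N2" for t
  proof -
    have "(h has_real_derivative F t) (at t)"
      unfolding has_field_derivative_def has_derivative_at_alt
    proof (intro conjI allI impI)
      show "bounded_linear ((*) (F t))" by (rule bounded_linear_mult_right)
      fix e :: real assume "e > 0"
      from t have "t \<notin> N1" "- t \<notin> N2" by (auto simp: image_iff)
      obtain da where da: "da > 0" "\<And>s. 0 < s \<and> s < da \<Longrightarrow> norm (integral (cbox t (t + s *\<^sub>R One)) F /\<^sub>R s ^ DIM(real) - F t) < e"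
        using d1[OF \<open>t \<notin> N1\<close> \<open>e > 0\<close>] by blast
      obtain db where db: "db > 0" "\<And>s. 0 < s \<and> s < db \<Longrightarrow> norm (integral (cbox (-t) (-t + s *\<^sub>R One)) (\<lambda>x. F (- x)) /\<^sub>R s ^ DIM(real) - F t) < e"
        using d2[OF \<open>- t \<notin> N2\<close> \<open>e > 0\<close>] by auto
      show "\<exists>d>0. \<forall>y. norm (y - t) < d \<longrightarrow> norm (h y - h t - F t * (y - t)) \<le> e * norm (y - t)"
      proof (intro exI[of _ "min da db"] conjI allI impI)
        fix y assume y: "norm (y - t) < min da db"
        consider "y = t" | "y > t" | "y < t" by linarith
        then show "norm (h y - h t - F t * (y - t)) \<le> e * norm (y - t)"
        proof cases
          case 2
          have "\<bar>(h y - h t) / (y - t) - F t\<bar> < e"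
            using da(2)[of "y - t"] 2 y integral_unique[OF int[of t y]] by (simp add: divide_inverse mult.commute)
          then have "\<bar>(h y - h t) / (y - t) - F t\<bar> * (y - t) \<le> e * (y - t)"
            using 2 by (intro mult_right_mono) auto
          moreover have "\<bar>(h y - h t) / (y - t) - F t\<bar> * (y - t) = \<bar>((h y - h t) / (y - t) - F t) * (y - t)\<bar>"
            using 2 by (simp add: abs_mult)
          moreover have "((h y - h t) / (y - t) - F t) * (y - t) = h y - h t - F t * (y - t)"
            using 2 by (simp add: field_simps)
          ultimately show ?thesis using 2 by simp
        next
          case 3
          have "\<bar>(h t - h y) / (t - y) - F t\<bar> < e"
            using db(2)[of "t - y"] 3 y integral_unique[OF int2[of "-t" "-y"]] by (simp add: divide_inverse mult.commute)
          then have "\<bar>(h t - h y) / (t - y) - F t\<bar> * (t - y) \<le> e * (t - y)"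
            using 3 by (intro mult_right_mono) auto
          moreover have "\<bar>(h t - h y) / (t - y) - F t\<bar> * (t - y) = \<bar>((h t - h y) / (t - y) - F t) * (t - y)\<bar>"
            using 3 by (simp add: abs_mult)
          moreover have "((h t - h y) / (t - y) - F t) * (t - y) = h t - h y - F t * (t - y)"
            using 3 by (simp add: field_simps)
          ultimately have "\<bar>h t - h y - F t * (t - y)\<bar> \<le> e * (t - y)" using 3 by simp
          moreover have "h t - h y - F t * (t - y) = - (h y - h t - F t * (y - t))"
            by (simp add: algebra_simps)
          ultimately show ?thesis using 3 by (simp add: abs_minus_commute)
        qed simp
      qed (use da db in auto)
    qed
    then have "((\<lambda>t. h t - (L + 1) * t) has_real_derivative F t - (L + 1)) (at t)"
      by (auto intro!: derivative_eq_intros)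
    moreover have "(\<lambda>t. h t - (L + 1) * t) = g" by (auto simp: h_def)
    ultimately show ?thesis
      by (metis real_differentiable_def)
  qed
  ultimately show ?thesis by (rule that)
qed

text \<open>A Cauchy criterion: the value of the derivative does not occur and the outer quantifiers
  range over naturals, so the set of points of differentiability will be a countable intersection of
  countable unions of closed sets.\<close>

lemma differentiable_iff_Cauchy_quotient:
  fixes g :: "real \<Rightarrow> real"
  shows "g differentiable (at 0) \<longleftrightarrow>
    (\<forall>n::nat. \<exists>k::nat. \<forall>s t. 0 < \<bar>s\<bar> \<and> \<bar>s\<bar> < 1 / Suc k \<and> 0 < \<bar>t\<bar> \<and> \<bar>t\<bar> < 1 / Suc k \<longrightarrow>
       \<bar>(g s - g 0) / s - (g t - g 0) / t\<bar> \<le> 1 / Suc n)" (is "?L \<longleftrightarrow> ?R")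
proof
  assume ?L
  then obtain d where "(g has_real_derivative d) (at 0)" by (auto simp: real_differentiable_def)
  then have lim: "((\<lambda>h. (g h - g 0) / h) \<longlongrightarrow> d) (at 0)" by (simp add: DERIV_def)
  show ?R
  proof
    fix n :: nat
    obtain e where e: "e > 0" "\<And>s. s \<noteq> 0 \<Longrightarrow> \<bar>s\<bar> < e \<Longrightarrow> \<bar>(g s - g 0) / s - d\<bar> < 1 / (2 * Suc n)"
      using LIM_D[OF lim, of "1 / (2 * Suc n)"] by auto
    obtain k where k: "1 / Suc k < e"
      using reals_Archimedean[OF e(1)] by (auto simp: inverse_eq_divide)
    have "\<bar>(g s - g 0) / s - (g t - g 0) / t\<bar> \<le> 1 / Suc n"
      if "0 < \<bar>s\<bar> \<and> \<bar>s\<bar> < 1 / Suc k \<and> 0 < \<bar>t\<bar> \<and> \<bar>t\<bar> < 1 / Suc k" for s t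
    proof -
      have "\<bar>(g s - g 0) / s - d\<bar> < 1 / (2 * Suc n)" "\<bar>(g t - g 0) / t - d\<bar> < 1 / (2 * Suc n)"
        using e(2)[of s] e(2)[of t] that k by auto
      moreover have "1 / (2 * real (Suc n)) + 1 / (2 * real (Suc n)) = 1 / real (Suc n)"
        by (simp add: field_simps)
      ultimately show ?thesis by simp
    qed
    then show "\<exists>k::nat. \<forall>s t. 0 < \<bar>s\<bar> \<and> \<bar>s\<bar> < 1 / Suc k \<and> 0 < \<bar>t\<bar> \<and> \<bar>t\<bar> < 1 / Suc k \<longrightarrow>
       \<bar>(g s - g 0) / s - (g t - g 0) / t\<bar> \<le> 1 / Suc n" by blast
  qed
next
  assume R: ?R
  define q where "q s = (g s - g 0) / s" for s
  \<comment> \<open>With \<open>j + 2\<close> in the denominator the sample points with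
    \<open>j \<ge> k\<close> are strictly below \<open>1 / Suc k\<close>.\<close>
  define a where "a j = q (1 / (real j + 2))" for j :: nat
  have small: "\<exists>J. \<forall>j\<ge>J. 0 < 1 / (real j + 2) \<and> 1 / (real j + 2) < 1 / Suc k" for k :: nat
    by (rule exI[of _ k]) (auto simp: field_simps)
  have "Cauchy a"
  proof (rule metric_CauchyI)
    fix e :: real assume "e > 0"
    then obtain n where n: "1 / Suc n < e" using reals_Archimedean by (auto simp: inverse_eq_divide)
    obtain k where k: "\<And>s t. 0 < \<bar>s\<bar> \<and> \<bar>s\<bar> < 1 / Suc k \<and> 0 < \<bar>t\<bar> \<and> \<bar>t\<bar> < 1 / Suc k \<Longrightarrow> \<bar>q s - q t\<bar> \<le> 1 / Suc n"
      using R unfolding q_def by blast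
    obtain J where "\<forall>j\<ge>J. 0 < 1 / (real j + 2) \<and> 1 / (real j + 2) < 1 / Suc k" using small by blast
    then have "dist (a i) (a j) < e" if "i \<ge> J" "j \<ge> J" for i j
      using k[of "1 / (real i + 2)" "1 / (real j + 2)"] n that
      by (force simp: a_def dist_real_def)
    then show "\<exists>M. \<forall>m\<ge>M. \<forall>n\<ge>M. dist (a m) (a n) < e" by blast
  qed
  then obtain d where d: "a \<longlonglongrightarrow> d" using real_Cauchy_convergent convergent_def by blast
  have "(q \<longlongrightarrow> d) (at 0)"
  proof (rule LIM_I)
    fix e :: real assume "e > 0"
    then obtain n where n: "1 / Suc n < e" using reals_Archimedean by (auto simp: inverse_eq_divide)
    obtain k where k: "\<And>s t. 0 < \<bar>s\<bar> \<and> \<bar>s\<bar> < 1 / Suc k \<and> 0 < \<bar>t\<bar> \<and> \<bar>t\<bar> < 1 / Suc k \<Longrightarrow> \<bar>q s - q t\<bar> \<le> 1 / Suc n"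
      using R unfolding q_def by blast
    obtain J where J: "\<forall>j\<ge>J. 0 < 1 / (real j + 2) \<and> 1 / (real j + 2) < 1 / Suc k" using small by blast
    have "norm (q s - d) < e" if "s \<noteq> 0 \<and> norm (s - 0) < 1 / Suc k" for s
    proof -
      have "(\<lambda>j. \<bar>q s - a j\<bar>) \<longlonglongrightarrow> \<bar>q s - d\<bar>" by (intro tendsto_intros d)
      moreover have "\<exists>N. \<forall>j\<ge>N. \<bar>q s - a j\<bar> \<le> 1 / Suc n"
        using J k[of s] that by (intro exI[of _ J]) (auto simp: a_def)
      ultimately have "\<bar>q s - d\<bar> \<le> 1 / Suc n" by (rule LIMSEQ_le_const2)
      then show ?thesis using n by simp
    qed
    then show "\<exists>r>0. \<forall>x. x \<noteq> 0 \<and> norm (x - 0) < r \<longrightarrow> norm (q x - d) < e"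
      by (intro exI[of _ "1 / Suc k"]) auto
  qed
  then have "(g has_real_derivative d) (at 0)" by (simp add: DERIV_def q_def[abs_def])
  then show ?L by (auto simp: real_differentiable_def)
qed

section \<open>Directional derivatives of Lipschitz functions\<close>

lemma lipschitz_bound_nonneg:
  fixes f :: "'a::euclidean_space \<Rightarrow> real"
  assumes L: "\<And>x y. \<bar>f x - f y\<bar> \<le> L * norm (x - y)"
  shows "0 \<le> L"
proof -
  obtain b :: 'a where "b \<in> Basis" using nonempty_Basis by blast
  then show ?thesis using L[of b 0] by (simp add: norm_Basis)
qed

lemma lipschitz_bound_continuous_on:
  fixes f :: "'a::euclidean_space \<Rightarrow> real"
  assumes L: "\<And>x y. \<bar>f x - f y\<bar> \<le> L * norm (x - y)"
  shows "continuous_on S f"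
  by (rule lipschitz_on_continuous_on[of L])
    (use L lipschitz_bound_nonneg[OF L] in \<open>auto intro!: lipschitz_onI simp: dist_norm\<close>)

text \<open>By the one-dimensional case, for every \<open>x\<close> almost all \<open>t\<close> put
  \<open>x + t *\<^sub>R v\<close> into the good set \<open>D\<close>. Fubini is used without
  splitting the space along \<open>v\<close>: exchange the two almost-everywhere quantifiers, fix
  one good \<open>t\<close>, and remove it by translation invariance.\<close>

lemma lipschitz_directionally_differentiable_AE:
  fixes f :: "'a::euclidean_space \<Rightarrow> real"
  assumes L: "\<And>x y. \<bar>f x - f y\<bar> \<le> L * norm (x - y)"
  shows "AE x in lborel. (\<lambda>t. f (x + t *\<^sub>R v)) differentiable (at 0)"
proof -
  note L0 = lipschitz_bound_nonneg[OF L] and cont = lipschitz_bound_continuous_on[OF L, of UNIV]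
  have contf: "continuous_on S (\<lambda>x. f (x + c))" for S c
    by (rule continuous_on_compose2[OF cont]) (auto intro: continuous_intros)
  define q where "q x s = (f (x + s *\<^sub>R v) - f x) / s" for x s
  have cq: "continuous_on UNIV (\<lambda>x. q x s)" for s
    unfolding q_def divide_inverse
    by (intro continuous_intros contf contf[of _ 0, simplified])
  \<comment> \<open>Each \<open>C n k\<close> is an intersection of closed sets, so the uncountably
    many \<open>s\<close> and \<open>t\<close> do no harm to measurability.\<close>
  define C where "C n k = (\<Inter>s\<in>{s. 0 < \<bar>s\<bar> \<and> \<bar>s\<bar> < 1 / Suc k}. \<Inter>t\<in>{s. 0 < \<bar>s\<bar> \<and> \<bar>s\<bar> < 1 / Suc k}.
      {x. \<bar>q x s - q x t\<bar> \<le> 1 / Suc n})" for n k :: nat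
  have mem_C: "x \<in> C n k \<longleftrightarrow> (\<forall>s t. 0 < \<bar>s\<bar> \<and> \<bar>s\<bar> < 1 / Suc k \<and> 0 < \<bar>t\<bar> \<and> \<bar>t\<bar> < 1 / Suc k \<longrightarrow>
      \<bar>q x s - q x t\<bar> \<le> 1 / Suc n)" for x n k
    unfolding C_def INT_iff mem_Collect_eq by blast
  have "closed (C n k)" for n k
    unfolding C_def by (intro closed_INT ballI closed_Collect_le continuous_intros cq)
  then have [measurable]: "C n k \<in> sets borel" for n k by auto
  define D where "D = (\<Inter>n. \<Union>k. C n k)"
  have D_meas [measurable]: "D \<in> sets borel" unfolding D_def by measurable
  have D: "D = {x. (\<lambda>t. f (x + t *\<^sub>R v)) differentiable (at 0)}"
    unfolding differentiable_iff_Cauchy_quotient D_def set_eq_iff INT_iff UN_iff mem_C mem_Collect_eq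
    by (simp add: q_def)
  have ae1: "AE t in lborel. x + t *\<^sub>R v \<in> D" for x
  proof -
    have "\<bar>f (x + s *\<^sub>R v) - f (x + t *\<^sub>R v)\<bar> \<le> (L * norm v) * \<bar>s - t\<bar>" for s t
      using L[of "x + s *\<^sub>R v" "x + t *\<^sub>R v"]
      by (simp add: scaleR_left_diff_distrib[symmetric] mult.assoc mult.commute[of "norm v"])
    then obtain N where N: "negligible N" "\<And>t. t \<notin> N \<Longrightarrow> (\<lambda>s. f (x + s *\<^sub>R v)) differentiable (at t)"
      using lipschitz_real_differentiable_ae[of "\<lambda>s. f (x + s *\<^sub>R v)"] by blast
    have "x + t *\<^sub>R v \<in> D" if "t \<notin> N" for t
    proof -
      have "(\<lambda>s. f (x + s *\<^sub>R v)) differentiable (at t)" using N that by blast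
      then obtain d where "((\<lambda>s. f (x + s *\<^sub>R v)) has_real_derivative d) (at t)"
        by (auto simp: real_differentiable_def)
      then have "((\<lambda>s. f (x + (s + t) *\<^sub>R v)) has_real_derivative d) (at 0)"
        using DERIV_shift[of "\<lambda>s. f (x + s *\<^sub>R v)" d 0 t] by simp
      then have "((\<lambda>s. f (x + t *\<^sub>R v + s *\<^sub>R v)) has_real_derivative d) (at 0)"
        by (simp add: scaleR_left_distrib add_ac)
      then show ?thesis by (auto simp: D real_differentiable_def)
    qed
    moreover have "AE t in lebesgue. t \<notin> N"
      using N(1) by (simp add: negligible_iff_null_sets AE_not_in)
    ultimately have "AE t in completion lborel. x + t *\<^sub>R v \<in> D"
      by (auto elim!: eventually_mono)
    then show ?thesis by (subst (asm) AE_completion_iff) auto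
  qed
  have psf: "pair_sigma_finite (lborel :: 'a measure) (lborel :: real measure)" ..
  have "(AE x in lborel. AE t in lborel. x + t *\<^sub>R v \<in> D) \<longleftrightarrow> (AE t in lborel. AE x in lborel. x + t *\<^sub>R v \<in> D)"
    by (rule pair_sigma_finite.AE_commute[OF psf]) measurable
  then have "AE t in (lborel :: real measure). AE x in lborel. x + t *\<^sub>R v \<in> D" using ae1 by simp
  \<comment> \<open>The line is not a null set, so a property that holds for almost every
    \<open>t\<close> has a witness.\<close>
  moreover have "\<not> (AE t in (lborel :: real measure). False)"
    by (simp add: AE_iff_null null_sets_def)
  ultimately obtain t :: real where t: "AE x in lborel. x + t *\<^sub>R v \<in> D"
    by (metis (mono_tags, lifting) eventually_mono)
  have "AE x in distr lborel borel ((+) (t *\<^sub>R v)). x \<in> D"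
    by (subst AE_distr_iff) (use t in \<open>auto simp: add.commute\<close>)
  then have "AE x in lborel. x \<in> D" by (simp only: lborel_distr_plus)
  then show ?thesis by (simp add: D)
qed

text \<open>Only the steps 1 / (k + 1) are used, so that for continuous \<open>f\<close> this is the
  limit of a sequence of continuous functions and therefore Borel. Where the sequence diverges the
  value is arbitrary.\<close>

definition dirderiv :: "('a::real_normed_vector \<Rightarrow> real) \<Rightarrow> 'a \<Rightarrow> 'a \<Rightarrow> real" where
  "dirderiv f v x = lim (\<lambda>k. real (Suc k) * (f (x + (1 / real (Suc k)) *\<^sub>R v) - f x))"

lemma dirderiv_LIMSEQ:
  fixes f :: "'a::real_normed_vector \<Rightarrow> real"
  assumes "((\<lambda>t. f (x + t *\<^sub>R v)) has_real_derivative d) (at 0)"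
  shows "(\<lambda>k. real (Suc k) * (f (x + (1 / real (Suc k)) *\<^sub>R v) - f x)) \<longlonglongrightarrow> d"
proof -
  have "((\<lambda>h. (f (x + h *\<^sub>R v) - f x) / h) \<longlongrightarrow> d) (at 0)" using assms by (simp add: DERIV_def)
  moreover have "filterlim (\<lambda>k. 1 / real (Suc k)) (at 0) sequentially"
    unfolding filterlim_at using LIMSEQ_inverse_real_of_nat
    by (auto simp: inverse_eq_divide)
  ultimately have "(\<lambda>k. (f (x + (1 / real (Suc k)) *\<^sub>R v) - f x) / (1 / Suc k)) \<longlonglongrightarrow> d"
    by (rule filterlim_compose)
  then show ?thesis by (simp add: mult.commute)
qed

lemma dirderiv_eq:
  fixes f :: "'a::real_normed_vector \<Rightarrow> real"
  assumes "((\<lambda>t. f (x + t *\<^sub>R v)) has_real_derivative d) (at 0)"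
  shows "dirderiv f v x = d"
  unfolding dirderiv_def by (rule limI, rule dirderiv_LIMSEQ, rule assms)

lemma has_real_derivative_dirderiv:
  fixes f :: "'a::real_normed_vector \<Rightarrow> real"
  assumes "(\<lambda>t. f (x + t *\<^sub>R v)) differentiable (at 0)"
  shows "((\<lambda>t. f (x + t *\<^sub>R v)) has_real_derivative dirderiv f v x) (at 0)"
  using assms dirderiv_eq by (metis real_differentiable_def)

lemma borel_measurable_dirderiv:
  fixes f :: "'a::euclidean_space \<Rightarrow> real"
  assumes "continuous_on UNIV f"
  shows "dirderiv f v \<in> borel_measurable lborel"
proof -
  have "(\<lambda>x. real (Suc k) * (f (x + (1 / real (Suc k)) *\<^sub>R v) - f x)) \<in> borel_measurable borel" for k
    by (intro borel_measurable_continuous_onI continuous_intros continuous_on_compose2[OF assms]) auto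
  then have "(\<lambda>x. real (Suc k) * (f (x + (1 / real (Suc k)) *\<^sub>R v) - f x)) \<in> borel_measurable lborel" for k
    unfolding measurable_lborel2 .
  then show ?thesis
    unfolding dirderiv_def[abs_def] by (rule borel_measurable_lim_metric)
qed

text \<open>The quotient for \<open>v + w\<close> is the quotient for \<open>v\<close> plus the
  quotient for \<open>w\<close> at a point shifted by v / (k + 1). The shift is not controlled
  pointwise, but after integration over a box it moves onto the indicator of the box and disappears
  in the limit. So the defect \<open>h\<close> integrates to 0 over every box and vanishes almost
  everywhere.\<close>

lemma lipschitz_dirderiv_add_AE:
  fixes f :: "'a::euclidean_space \<Rightarrow> real"
  assumes L: "\<And>x y. \<bar>f x - f y\<bar> \<le> L * norm (x - y)"
  shows "AE x in lborel. dirderiv f (v + w) x = dirderiv f v x + dirderiv f w x"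
proof -
  note L0 = lipschitz_bound_nonneg[OF L] and cont = lipschitz_bound_continuous_on[OF L, of UNIV]
  from cont have [measurable]: "f \<in> borel_measurable borel" by (rule borel_measurable_continuous_onI)
  note [measurable] = borel_measurable_dirderiv[OF cont]
  define q where "q k z x = real (Suc k) * (f (x + (1 / real (Suc k)) *\<^sub>R z) - f x)" for k z x
  have [measurable]: "q k z \<in> borel_measurable borel" for k z
    unfolding q_def[abs_def] by measurable
  have q_bound: "\<bar>q k z x\<bar> \<le> L * norm z" for k z x
  proof -
    have "\<bar>q k z x\<bar> = real (Suc k) * \<bar>f (x + (1 / real (Suc k)) *\<^sub>R z) - f x\<bar>"
      by (simp add: q_def abs_mult)
    also have "\<dots> \<le> real (Suc k) * (L * norm ((1 / real (Suc k)) *\<^sub>R z))"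
      using L[of "x + (1 / real (Suc k)) *\<^sub>R z" x] by (intro mult_left_mono) auto
    also have "\<dots> = L * norm z" by simp
    finally show ?thesis .
  qed
  have q_lim: "AE x in lborel. (\<lambda>k. q k z x) \<longlonglongrightarrow> dirderiv f z x" for z
    using lipschitz_directionally_differentiable_AE[OF L, of z]
    by eventually_elim (unfold q_def, intro dirderiv_LIMSEQ has_real_derivative_dirderiv)
  define h where "h x = dirderiv f (v + w) x - dirderiv f v x - dirderiv f w x" for x
  have h_meas [measurable]: "h \<in> borel_measurable lborel"
    unfolding h_def[abs_def] by measurable
  have ind: "integrable lborel (\<lambda>x::'a. indicator (cball 0 r) x * (c::real))" for r c
    by (intro integrable_mult_left integrable_real_indicator) (use emeasure_bounded_finite[OF bounded_cball[of "0::'a" r]] in auto)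
  have box: "integrable lborel (\<lambda>x. indicator (cbox a b) x * h x) \<and> (\<integral>x. indicator (cbox a b) x * h x \<partial>lborel) = 0" for a b
  proof -
    obtain R where R: "cbox a b \<subseteq> cball 0 R" "R > 0"
      using bounded_cbox[of a b] unfolding bounded_pos by (auto simp: subset_iff)
    let ?i = "indicator (cbox a b) :: 'a \<Rightarrow> real"
    have 1: "integrable lborel (\<lambda>x. ?i x * dirderiv f z x)"
            "(\<lambda>k. \<integral>x. ?i x * q k z x \<partial>lborel) \<longlonglongrightarrow> (\<integral>x. ?i x * dirderiv f z x \<partial>lborel)" for z
    proof -
      have b: "AE x in lborel. norm (?i x * q k z x) \<le> indicator (cball 0 R) x * (L * norm z)" for k
        using q_bound[of k z] R by (intro AE_I2) (auto simp: indicator_def abs_mult L0)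
      have l: "AE x in lborel. (\<lambda>k. ?i x * q k z x) \<longlonglongrightarrow> ?i x * dirderiv f z x"
        using q_lim[of z] by eventually_elim (intro tendsto_intros)
      show "integrable lborel (\<lambda>x. ?i x * dirderiv f z x)"
        by (rule integrable_dominated_convergence[OF _ _ ind l b]) measurable
      show "(\<lambda>k. \<integral>x. ?i x * q k z x \<partial>lborel) \<longlonglongrightarrow> (\<integral>x. ?i x * dirderiv f z x \<partial>lborel)"
        by (rule integral_dominated_convergence[OF _ _ ind l b]) measurable
    qed
    define s where "s k = (1 / real (Suc k)) *\<^sub>R v" for k
    have s0: "s \<longlonglongrightarrow> 0"
      using tendsto_scaleR[OF LIMSEQ_inverse_real_of_nat tendsto_const[of v]]
      by (simp add: s_def[abs_def] inverse_eq_divide)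
    have sn: "norm (s k) \<le> norm v" for k
      by (simp add: s_def field_simps mult_left_le)
    \<comment> \<open>The shifted indicators converge off the frontier of the box, which is null.
      The dominating function lives on a ball enlarged by \<open>norm v\<close>, since
      \<open>s k\<close> is never longer than \<open>v\<close>.\<close>
    have 2: "(\<lambda>k. \<integral>x. ?i (x - s k) * q k w x \<partial>lborel) \<longlonglongrightarrow> (\<integral>x. ?i x * dirderiv f w x \<partial>lborel)"
    proof -
      have "frontier (cbox a b) \<in> null_sets lborel"
        using negligible_convex_frontier[of "cbox a b"]
        by (simp add: negligible_iff_null_sets null_sets_completion_iff)
      then have "AE x in lborel. x \<notin> frontier (cbox a b)" by (rule AE_not_in)
      then have l: "AE x in lborel. (\<lambda>k. ?i (x - s k) * q k w x) \<longlonglongrightarrow> ?i x * dirderiv f w x"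
        using q_lim[of w]
      proof eventually_elim
        case (elim x)
        have xs: "(\<lambda>k. x - s k) \<longlonglongrightarrow> x" using tendsto_diff[OF tendsto_const s0, of x] by simp
        consider "x \<in> interior (cbox a b)" | "x \<in> - cbox a b"
          using elim(1) by (auto simp: frontier_def closure_closed)
        then have "eventually (\<lambda>k. ?i (x - s k) = ?i x) sequentially"
        proof cases
          case 1
          then have "eventually (\<lambda>k. x - s k \<in> interior (cbox a b)) sequentially"
            using topological_tendstoD[OF xs, of "interior (cbox a b)"] by auto
          then show ?thesis by (rule eventually_mono) (use 1 box_subset_cbox[of a b] in \<open>auto simp: indicator_def\<close>)
        next
          case 2
          then have "eventually (\<lambda>k. x - s k \<in> - cbox a b) sequentially"
            using topological_tendstoD[OF xs, of "- cbox a b"] closed_cbox by blast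
          then show ?thesis by (rule eventually_mono) (use 2 in \<open>auto simp: indicator_def\<close>)
        qed
        then have "eventually (\<lambda>k. ?i x * q k w x = ?i (x - s k) * q k w x) sequentially"
          by (rule eventually_mono) simp
        moreover have "(\<lambda>k. ?i x * q k w x) \<longlonglongrightarrow> ?i x * dirderiv f w x"
          by (intro tendsto_intros elim)
        ultimately show ?case by (rule Lim_transform_eventually[rotated])
      qed
      have b: "AE x in lborel. norm (?i (x - s k) * q k w x) \<le> indicator (cball 0 (R + norm v)) x * (L * norm w)" for k
      proof (rule AE_I2)
        fix x
        show "norm (?i (x - s k) * q k w x) \<le> indicator (cball 0 (R + norm v)) x * (L * norm w)"
        proof (cases "x - s k \<in> cbox a b")
          case True
          then have "norm (x - s k) \<le> R" using R by (auto simp: subset_iff)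
          then have "norm x \<le> R + norm v" using sn[of k] norm_triangle_ineq[of "x - s k" "s k"] by simp
          then show ?thesis using q_bound[of k w x] True by (simp add: indicator_def)
        qed (simp add: L0)
      qed
      show ?thesis
        by (rule integral_dominated_convergence[OF _ _ ind l b]) measurable
    qed
    have q_add: "q k w (s k + x) + q k v x = q k (v + w) x" for k x
    proof -
      have "s k + x + (1 / real (Suc k)) *\<^sub>R w = x + (1 / real (Suc k)) *\<^sub>R (v + w)"
        "s k + x = x + (1 / real (Suc k)) *\<^sub>R v"
        by (simp_all add: s_def scaleR_right_distrib)
      then show ?thesis by (simp only: q_def distrib_left[symmetric]) simp
    qed
    have eq: "(\<integral>x. ?i x * q k (v + w) x \<partial>lborel) = (\<integral>x. ?i (x - s k) * q k w x \<partial>lborel) + (\<integral>x. ?i x * q k v x \<partial>lborel)" for k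
    proof -
      have ib: "integrable lborel (\<lambda>x. ?i x * g x)" if [measurable]: "g \<in> borel_measurable borel" and g: "\<And>x. \<bar>g x\<bar> \<le> c" for g c
      proof (rule Bochner_Integration.integrable_bound[OF ind[of R c]])
        show "AE x in lborel. norm (?i x * g x) \<le> norm (indicator (cball 0 R) x * c)"
          using g R by (intro AE_I2) (auto simp: indicator_def abs_mult intro: order_trans[OF _ abs_ge_self])
      qed measurable
      have "(\<integral>x. ?i (x - s k) * q k w x \<partial>lborel) = (\<integral>x. ?i (x - s k) * q k w x \<partial>distr lborel borel ((+) (s k)))"
        by (simp only: lborel_distr_plus)
      also have "\<dots> = (\<integral>x. ?i x * q k w (s k + x) \<partial>lborel)"
        by (subst integral_distr) auto
      also have "\<dots> + (\<integral>x. ?i x * q k v x \<partial>lborel) = (\<integral>x. ?i x * q k w (s k + x) + ?i x * q k v x \<partial>lborel)"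
        by (rule Bochner_Integration.integral_add[symmetric]; rule ib) (use q_bound in \<open>auto\<close>)
      also have "\<dots> = (\<integral>x. ?i x * q k (v + w) x \<partial>lborel)"
        by (simp only: distrib_left[symmetric] q_add)
      finally show ?thesis by simp
    qed
    have "(\<integral>x. ?i x * dirderiv f (v + w) x \<partial>lborel) = (\<integral>x. ?i x * dirderiv f w x \<partial>lborel) + (\<integral>x. ?i x * dirderiv f v x \<partial>lborel)"
      using LIMSEQ_unique[OF 1(2)[of "v + w", unfolded eq] tendsto_add[OF 2 1(2)[of v]]] .
    moreover have "(\<lambda>x. ?i x * h x) = (\<lambda>x. ?i x * dirderiv f (v + w) x - ?i x * dirderiv f v x - ?i x * dirderiv f w x)"
      by (auto simp: h_def algebra_simps)
    ultimately show ?thesis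
      using 1(1) by simp
  qed
  have hi: "(h has_integral 0) (cbox a b)" for a b
  proof -
    have "((\<lambda>x. indicator (cbox a b) x * h x) has_integral 0) UNIV"
      using has_integral_integral_lborel[of "\<lambda>x. indicator (cbox a b) x * h x"] box[of a b] by auto
    moreover have "(\<lambda>x. indicator (cbox a b) x * h x) = (\<lambda>x. if x \<in> cbox a b then h x else 0)"
      by (auto simp: indicator_def)
    ultimately show ?thesis by (simp only: has_integral_restrict_UNIV)
  qed
  then have "h integrable_on cbox a b" for a b by blast
  then obtain N where N: "negligible N" and N': "\<And>x e. \<lbrakk>x \<notin> N; 0 < e\<rbrakk> \<Longrightarrow>
      \<exists>d>0. \<forall>s. 0 < s \<and> s < d \<longrightarrow> norm (integral (cbox x (x + s *\<^sub>R One)) h /\<^sub>R s ^ DIM('a) - h x) < e"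
    using integrable_ccontinuous_explicit by blast
  \<comment> \<open>Lebesgue differentiation: the averages over small cubes are all 0 and converge
    to \<open>h x\<close>.\<close>
  have "h x = 0" if xN: "x \<notin> N" for x
  proof (rule ccontr)
    assume "h x \<noteq> 0"
    then obtain d where "d > 0" "\<forall>s. 0 < s \<and> s < d \<longrightarrow> norm (integral (cbox x (x + s *\<^sub>R One)) h /\<^sub>R s ^ DIM('a) - h x) < \<bar>h x\<bar>"
      using N'[OF xN, of "\<bar>h x\<bar>"] by auto
    then show False
      using integral_unique[OF hi] by (auto dest!: spec[of _ "d/2"])
  qed
  moreover have "AE x in lebesgue. x \<notin> N"
    using N(1) by (simp add: negligible_iff_null_sets AE_not_in)
  ultimately have "AE x in completion lborel. h x = 0"
    by (auto elim!: eventually_mono)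
  then have "AE x in lborel. h x = 0" by (subst (asm) AE_completion_iff) auto
  then show ?thesis by eventually_elim (simp add: h_def)
qed

text \<open>Almost everywhere one vector \<open>g\<close> gives the directional derivatives for a
  whole countable dense set of directions, since countably many null sets may be discarded. The
  Lipschitz bound and compactness of the unit sphere then make the expansion uniform in the
  direction.\<close>

theorem rademacher:
  fixes f :: "'a::euclidean_space \<Rightarrow> real"
  assumes L: "\<And>x y. \<bar>f x - f y\<bar> \<le> L * norm (x - y)"
  shows "negligible {x. \<not> f differentiable (at x)}"
proof -
  note L0 = lipschitz_bound_nonneg[OF L]
  have lin: "AE x in lborel. dirderiv f (\<Sum>b\<in>F. c b *\<^sub>R b) x = (\<Sum>b\<in>F. c b * dirderiv f b x)"
    if "finite F" for F :: "'a set" and c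
    using that
  proof (induction F)
    case empty
    show ?case by (simp add: dirderiv_def lim_def)
  next
    case (insert a F)
    have "AE x in lborel. dirderiv f (c a *\<^sub>R a) x = c a * dirderiv f a x"
      using lipschitz_directionally_differentiable_AE[OF L, of a]
    proof eventually_elim
      case (elim x)
      have "((\<lambda>t. f (x + t *\<^sub>R a)) has_real_derivative dirderiv f a x) (at (0 * c a))"
        using has_real_derivative_dirderiv[OF elim] by simp
      moreover have "((\<lambda>t. t * c a) has_real_derivative c a) (at 0)"
        by (auto intro!: derivative_eq_intros)
      ultimately have "((\<lambda>t. f (x + (t * c a) *\<^sub>R a)) has_real_derivative dirderiv f a x * c a) (at 0)"
        using DERIV_chain2[of "\<lambda>t. f (x + t *\<^sub>R a)" _ "\<lambda>t. t * c a" 0] by blast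
      then show ?case by (intro dirderiv_eq) (simp add: mult.commute)
    qed
    with lipschitz_dirderiv_add_AE[OF L, of "c a *\<^sub>R a" "\<Sum>b\<in>F. c b *\<^sub>R b"] insert.IH
    show ?case by eventually_elim (simp add: insert.hyps)
  qed
  obtain Q :: "'a set" where Q: "countable Q" "\<And>X. open X \<Longrightarrow> X \<noteq> {} \<Longrightarrow> \<exists>d\<in>Q. d \<in> X"
    using countable_dense_exists by blast
  have "AE x in lborel. \<forall>v\<in>Q. (\<lambda>t. f (x + t *\<^sub>R v)) differentiable (at 0) \<and>
      dirderiv f v x = (\<Sum>b\<in>Basis. (v \<bullet> b) * dirderiv f b x)"
    using lipschitz_directionally_differentiable_AE[OF L] lin[OF finite_Basis, of "\<lambda>b. v \<bullet> b" for v]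
    by (auto simp: AE_ball_countable[OF Q(1)] euclidean_representation AE_conj_iff)
  then have "AE x in lborel. f differentiable (at x)"
  proof eventually_elim
    case (elim x)
    define g where "g = (\<Sum>b\<in>Basis. dirderiv f b x *\<^sub>R b)"
    have der: "((\<lambda>t. f (x + t *\<^sub>R v)) has_real_derivative g \<bullet> v) (at 0)" if "v \<in> Q" for v
    proof -
      have e: "(\<lambda>t. f (x + t *\<^sub>R v)) differentiable (at 0)"
        "dirderiv f v x = (\<Sum>b\<in>Basis. (v \<bullet> b) * dirderiv f b x)"
        using elim that by blast+
      have "g \<bullet> v = dirderiv f v x"
        unfolding e(2) by (simp add: g_def inner_sum_left inner_commute[of _ v] mult.commute inner_sum_right)
      with has_real_derivative_dirderiv[OF e(1)] show ?thesis by (simp only:)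
    qed
    have "(f has_derivative (\<lambda>h. g \<bullet> h)) (at x)"
      unfolding has_derivative_at_alt
    proof (intro conjI allI impI bounded_linear_inner_right)
      fix e :: real assume e: "e > 0"
      \<comment> \<open>The mesh of directions: replacing a direction by one at distance
        \<open>e'\<close> costs at most \<open>(L + norm g) * e'\<close>, which is at most half of
        \<open>e\<close>.\<close>
      define e' where "e' = e / (2 * (L + norm g + 1))"
      have pos: "L + norm g + 1 > 0" using L0 norm_ge_zero[of g] by linarith
      then have e': "e' > 0" "(L + norm g) * e' \<le> e / 2"
        using e L0 by (auto simp: e'_def field_simps)
      have "sphere 0 1 \<subseteq> (\<Union>v\<in>Q. ball v e')"
      proof
        fix z :: 'a
        obtain d where "d \<in> Q" "d \<in> ball z e'" using Q(2)[of "ball z e'"] e' by auto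
        then show "z \<in> (\<Union>v\<in>Q. ball v e')" by (auto simp: dist_commute)
      qed
      then obtain T where T: "T \<subseteq> Q" "finite T" "sphere 0 1 \<subseteq> (\<Union>v\<in>T. ball v e')"
        using compactE_image[OF compact_sphere[of "0::'a" 1], of Q "\<lambda>v. ball v e'"] by auto
      have "\<exists>d>0. \<forall>t. \<bar>t\<bar> < d \<longrightarrow> \<bar>f (x + t *\<^sub>R v) - f x - (g \<bullet> v) * t\<bar> \<le> e / 2 * \<bar>t\<bar>" if "v \<in> T" for v
      proof -
        have "v \<in> Q" using that T by blast
        from der[OF this] have "\<forall>e>0. \<exists>d>0. \<forall>y. norm (y - 0) < d \<longrightarrow>
            norm (f (x + y *\<^sub>R v) - f (x + 0 *\<^sub>R v) - (g \<bullet> v) * (y - 0)) \<le> e * norm (y - 0)"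
          unfolding has_field_derivative_def has_derivative_at_alt by (rule conjunct2)
        from this[rule_format, of "e/2"] e show ?thesis by simp
      qed
      then obtain d where d: "\<And>v. v \<in> T \<Longrightarrow> d v > 0"
        "\<And>v t. v \<in> T \<Longrightarrow> \<bar>t\<bar> < d v \<Longrightarrow> \<bar>f (x + t *\<^sub>R v) - f x - (g \<bullet> v) * t\<bar> \<le> e / 2 * \<bar>t\<bar>"
        by metis
      define r where "r = Min (insert 1 (d ` T))"
      have r: "r > 0" "\<And>v. v \<in> T \<Longrightarrow> r \<le> d v"
        using T d by (auto simp: r_def)
      show "\<exists>r>0. \<forall>y. norm (y - x) < r \<longrightarrow> norm (f y - f x - g \<bullet> (y - x)) \<le> e * norm (y - x)"
      proof (intro exI[of _ r] conjI allI impI r)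
        fix y assume y: "norm (y - x) < r"
        show "norm (f y - f x - g \<bullet> (y - x)) \<le> e * norm (y - x)"
        proof (cases "y = x")
          case False
          define t where "t = norm (y - x)"
          define z where "z = (1 / t) *\<^sub>R (y - x)"
          have t: "t > 0" using False by (simp add: t_def)
          have "norm z = 1" using t by (simp add: z_def t_def)
          then obtain v where v: "v \<in> T" "norm (v - z) < e'"
            using T(3) by (auto simp: dist_norm subset_iff)
          have y_eq: "y = x + t *\<^sub>R z" using t by (simp add: z_def)
          have "\<bar>f (x + t *\<^sub>R v) - f x - (g \<bullet> v) * t\<bar> \<le> e / 2 * t"
            using d(2)[OF v(1), of t] r(2)[OF v(1)] y t by (simp add: t_def)
          moreover have "\<bar>f y - f (x + t *\<^sub>R v)\<bar> \<le> L * (t * norm (v - z))"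
            using L[of y "x + t *\<^sub>R v"] t
            by (simp add: y_eq scaleR_diff_right[symmetric] norm_minus_commute)
          moreover have "\<bar>(g \<bullet> v) * t - g \<bullet> (y - x)\<bar> \<le> norm g * (t * norm (v - z))"
          proof -
            have "(g \<bullet> v) * t - g \<bullet> (y - x) = g \<bullet> (t *\<^sub>R (v - z))"
              by (simp add: y_eq inner_diff_right algebra_simps)
            then show ?thesis using Cauchy_Schwarz_ineq2[of g "t *\<^sub>R (v - z)"] t by simp
          qed
          moreover have "L * (t * norm (v - z)) + norm g * (t * norm (v - z)) \<le> e / 2 * t"
          proof -
            have "L * (t * norm (v - z)) + norm g * (t * norm (v - z)) = t * ((L + norm g) * norm (v - z))"
              by (simp add: algebra_simps)
            also have "\<dots> \<le> t * ((L + norm g) * e')"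
              using v t L0 by (intro mult_left_mono) auto
            also have "\<dots> \<le> t * (e / 2)" using e' t by (intro mult_left_mono) auto
            finally show ?thesis by (simp add: mult.commute)
          qed
          moreover have "e / 2 * t + e / 2 * t = e * t" by simp
          ultimately have "\<bar>f y - f x - g \<bullet> (y - x)\<bar> \<le> e * t" by argo
          then show ?thesis by (simp add: t_def)
        qed simp
      qed
    qed
    then show ?case by (auto simp: differentiable_def)
  qed
  then obtain N where "{x. \<not> f differentiable (at x)} \<subseteq> N" "N \<in> null_sets lborel"
    by (auto elim!: AE_E simp: null_sets_def)
  then show ?thesis
    using negligible_subset[of N] by (simp add: negligible_iff_null_sets null_sets_completionI)
qed

section \<open>Upper semicontinuous functions\<close>

lemma usc_on_iff:
  "usc_on S u \<longleftrightarrow> (\<forall>x\<in>S. \<forall>c. u x < c \<longrightarrow> (\<exists>T. open T \<and> x \<in> T \<and> (\<forall>y\<in>T \<inter> S. u y < c)))"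
proof -
  have *: "(\<exists>T. open T \<and> x \<in> T \<and> (\<forall>y\<in>T. y \<noteq> x \<longrightarrow> y \<in> S \<longrightarrow> u y < c)) \<longleftrightarrow>
      (\<exists>T. open T \<and> x \<in> T \<and> (\<forall>y\<in>T \<inter> S. u y < c))" if "u x < c" for x c
    using that by (intro ex_cong1) auto
  show ?thesis unfolding usc_on_def eventually_at_topological
    by (intro ball_cong refl all_cong1 imp_cong *)
qed

lemma usc_onD:
  assumes "usc_on S u" "x \<in> S" "u x < c"
  obtains T where "open T" "x \<in> T" "\<And>y. y \<in> T \<Longrightarrow> y \<in> S \<Longrightarrow> u y < c"
  using assms(1)[unfolded usc_on_iff, rule_format, OF assms(2,3)] that by blast

lemma usc_on_subset:
  assumes "usc_on S u" "T \<subseteq> S"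
  shows "usc_on T u"
  unfolding usc_on_iff
proof (intro ballI allI impI)
  fix x c assume "x \<in> T" "u x < c"
  with assms obtain V where "open V" "x \<in> V" "\<And>y. y \<in> V \<Longrightarrow> y \<in> S \<Longrightarrow> u y < c"
    using usc_onD[of S u x c] by blast
  then show "\<exists>V. open V \<and> x \<in> V \<and> (\<forall>y\<in>V \<inter> T. u y < c)" using assms(2) by blast
qed

lemma continuous_on_imp_usc_on:
  assumes "continuous_on S u"
  shows "usc_on S u"
  unfolding usc_on_iff
proof (intro ballI allI impI)
  fix x c assume "x \<in> S" "u x < c"
  then show "\<exists>T. open T \<and> x \<in> T \<and> (\<forall>y\<in>T \<inter> S. u y < c)"
    using assms[unfolded continuous_on_topological] open_lessThan[of c] by (metis IntE lessThan_iff)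
qed

lemma usc_on_add:
  assumes "usc_on S u" "usc_on S v"
  shows "usc_on S (\<lambda>x. u x + v x)"
  unfolding usc_on_iff
proof (intro ballI allI impI)
  fix x c assume x: "x \<in> S" "u x + v x < c"
  define d where "d = (c - (u x + v x)) / 2"
  have d: "u x < u x + d" "v x < v x + d" "u x + d + (v x + d) = c"
    using x by (auto simp: d_def field_simps)
  obtain T1 where T1: "open T1" "x \<in> T1" "\<And>y. y \<in> T1 \<Longrightarrow> y \<in> S \<Longrightarrow> u y < u x + d"
    using usc_onD[OF assms(1) x(1) d(1)] by blast
  obtain T2 where T2: "open T2" "x \<in> T2" "\<And>y. y \<in> T2 \<Longrightarrow> y \<in> S \<Longrightarrow> v y < v x + d"
    using usc_onD[OF assms(2) x(1) d(2)] by blast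
  show "\<exists>T. open T \<and> x \<in> T \<and> (\<forall>y\<in>T \<inter> S. u y + v y < c)"
    by (rule exI[of _ "T1 \<inter> T2"]) (use T1 T2 d(3) in \<open>force\<close>)
qed

lemma usc_on_min:
  assumes "usc_on S u" "usc_on S v"
  shows "usc_on S (\<lambda>x. min (u x) (v x))"
  unfolding usc_on_iff
proof (intro ballI allI impI)
  fix x c assume x: "x \<in> S" "min (u x) (v x) < c"
  then consider "u x < c" | "v x < c" by (auto simp: min_less_iff_disj)
  then obtain T where "open T" "x \<in> T" "\<And>y. y \<in> T \<Longrightarrow> y \<in> S \<Longrightarrow> u y < c \<or> v y < c"
    using usc_onD[OF assms(1) x(1)] usc_onD[OF assms(2) x(1)] by metis
  then show "\<exists>T. open T \<and> x \<in> T \<and> (\<forall>y\<in>T \<inter> S. min (u y) (v y) < c)"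
    by (intro exI[of _ T]) (auto simp: min_less_iff_disj)
qed

lemma usc_on_cmult:
  assumes "usc_on S u" "0 < a"
  shows "usc_on S (\<lambda>x. a * u x)"
  unfolding usc_on_iff
proof (intro ballI allI impI)
  fix x c assume x: "x \<in> S" "a * u x < c"
  then have "u x < c / a" using assms by (simp add: field_simps)
  then obtain T where "open T" "x \<in> T" "\<And>y. y \<in> T \<Longrightarrow> y \<in> S \<Longrightarrow> u y < c / a"
    using usc_onD[OF assms(1) x(1)] by blast
  then show "\<exists>T. open T \<and> x \<in> T \<and> (\<forall>y\<in>T \<inter> S. a * u y < c)"
    using assms(2) by (intro exI[of _ T]) (auto simp: field_simps)
qed

lemma usc_on_compose:
  assumes "usc_on T u" "continuous_on S f" "f ` S \<subseteq> T"
  shows "usc_on S (\<lambda>x. u (f x))"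
  unfolding usc_on_iff
proof (intro ballI allI impI)
  fix x c assume x: "x \<in> S" "u (f x) < c"
  then obtain V where V: "open V" "f x \<in> V" "\<And>y. y \<in> V \<Longrightarrow> y \<in> T \<Longrightarrow> u y < c"
    using usc_onD[OF assms(1)] assms(3) by (metis image_subset_iff)
  obtain W where "open W" "x \<in> W" "\<forall>y\<in>S. y \<in> W \<longrightarrow> f y \<in> V"
    using assms(2)[unfolded continuous_on_topological] x V by metis
  then show "\<exists>T. open T \<and> x \<in> T \<and> (\<forall>y\<in>T \<inter> S. u (f y) < c)"
    using V assms(3) by (intro exI[of _ W]) auto
qed

text \<open>If every \<open>a\<close> is beaten by some \<open>g a\<close>, the sets where
  \<open>u < u (g a)\<close> cover \<open>S\<close>. In a finite subcover take the largest of the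
  values \<open>u (g a)\<close>: its point \<open>g a\<close> lies in one of the sets, so another of
  the finitely many values is larger still.\<close>

lemma usc_on_attains_sup:
  assumes "compact S" "S \<noteq> {}" "usc_on S u"
  obtains a where "a \<in> S" "\<And>x. x \<in> S \<Longrightarrow> u x \<le> u a"
proof (rule ccontr)
  assume "\<not> thesis"
  then have "\<forall>a\<in>S. \<exists>x\<in>S. u a < u x" using that not_le by metis
  then obtain g where g: "\<And>a. a \<in> S \<Longrightarrow> g a \<in> S" "\<And>a. a \<in> S \<Longrightarrow> u a < u (g a)" by metis
  have "\<forall>a\<in>S. \<exists>T. open T \<and> a \<in> T \<and> (\<forall>y\<in>T \<inter> S. u y < u (g a))"
    using assms(3)[unfolded usc_on_iff, rule_format, OF _ g(2)] by blast
  then obtain T where T: "\<And>a. a \<in> S \<Longrightarrow> open (T a)" "\<And>a. a \<in> S \<Longrightarrow> a \<in> T a"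
    "\<And>a y. a \<in> S \<Longrightarrow> y \<in> T a \<Longrightarrow> y \<in> S \<Longrightarrow> u y < u (g a)" by (metis IntI)
  have "S \<subseteq> (\<Union>a\<in>S. T a)" using T by blast
  then obtain F where F: "F \<subseteq> S" "finite F" "S \<subseteq> (\<Union>a\<in>F. T a)"
    using compactE_image[OF assms(1), of S T] T(1) by metis
  have "F \<noteq> {}" using F assms(2) by auto
  define m where "m = Max ((\<lambda>a. u (g a)) ` F)"
  have "m \<in> (\<lambda>a. u (g a)) ` F" unfolding m_def by (rule Max_in) (use F \<open>F \<noteq> {}\<close> in auto)
  then obtain a where a: "a \<in> F" "m = u (g a)" by auto
  have "g a \<in> S" using a F g by auto
  then obtain b where b: "b \<in> F" "g a \<in> T b" using F by auto
  then have "u (g a) < u (g b)" using T(3)[of b "g a"] F \<open>g a \<in> S\<close> by auto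
  moreover have "u (g b) \<le> m" unfolding m_def by (rule Max_ge) (use F b in auto)
  ultimately show False using a by simp
qed

lemma usc_LIMSEQ:
  assumes "usc_on S u" "x \<longlonglongrightarrow> z" "z \<in> S" "\<And>n. x n \<in> S" "u z < c"
  shows "\<forall>\<^sub>F n in sequentially. u (x n) < c"
proof -
  obtain T where T: "open T" "z \<in> T" "\<And>y. y \<in> T \<Longrightarrow> y \<in> S \<Longrightarrow> u y < c"
    using usc_onD[OF assms(1,3,5)] by blast
  have "\<forall>\<^sub>F n in sequentially. x n \<in> T" using topological_tendstoD[OF assms(2) T(1,2)] .
  then show ?thesis by eventually_elim (use T assms in auto)
qed

section \<open>The theorem on sums\<close>

lemma norm_diff_sq: "(norm (x - y))\<^sup>2 = (norm x)\<^sup>2 - 2 * (x \<bullet> y) + (norm y)\<^sup>2"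
  by (simp add: power2_norm_eq_inner inner_diff_left inner_diff_right inner_commute)

lemma convex_comb_norm_sq:
  fixes x y :: "'a::real_inner"
  shows
  "(norm ((1 - t) *\<^sub>R x + t *\<^sub>R y))\<^sup>2 = (1 - t) * (norm x)\<^sup>2 + t * (norm y)\<^sup>2 - t * (1 - t) * (norm (y - x))\<^sup>2"
  by (simp add: power2_norm_eq_inner inner_diff_left inner_diff_right inner_add_left inner_add_right inner_commute)
    (simp add: algebra_simps)

text \<open>The function \<open>W\<close> below is the sup-convolution of \<open>u\<close> with parameter \<open>2 \<epsilon>\<close> followed by an
  inf-convolution with parameter \<open>\<epsilon>\<close> (Lasry--Lions regularization).\<close>

lemma lasry_lions_envelope:
  fixes u :: "'a::euclidean_space \<Rightarrow> real"
  assumes S: "compact S" "S \<noteq> {}" and u: "usc_on S u" and e: "\<epsilon> > 0"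
  obtains W G L K where
    "\<And>x z. x \<in> S \<Longrightarrow> u x - (norm (x - z))\<^sup>2 / (2 * \<epsilon>) \<le> W z"
    "\<And>z \<zeta> c. (\<And>x. x \<in> S \<Longrightarrow> u x - (norm (x - \<zeta>))\<^sup>2 / (4 * \<epsilon>) \<le> c) \<Longrightarrow> W z \<le> c + (norm (\<zeta> - z))\<^sup>2 / (2 * \<epsilon>)"
    "\<And>z z'. norm (G z - G z') \<le> L * norm (z - z')"
    "\<And>z z'. \<bar>W z' - W z - G z \<bullet> (z' - z)\<bar> \<le> K * (norm (z' - z))\<^sup>2"
proof -
  have "\<exists>a\<in>S. \<forall>x\<in>S. u x - (norm (x - \<zeta>))\<^sup>2 / (4 * \<epsilon>) \<le> u a - (norm (a - \<zeta>))\<^sup>2 / (4 * \<epsilon>)" for \<zeta>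
  proof -
    have "usc_on S (\<lambda>x. u x + - ((norm (x - \<zeta>))\<^sup>2 / (4 * \<epsilon>)))"
      by (intro usc_on_add u continuous_on_imp_usc_on continuous_intros) (use e in auto)
    from usc_on_attains_sup[OF S this] show ?thesis by (metis diff_conv_add_uminus)
  qed
  then obtain m where m: "\<And>\<zeta>. m \<zeta> \<in> S"
    "\<And>\<zeta> x. x \<in> S \<Longrightarrow> u x - (norm (x - \<zeta>))\<^sup>2 / (4 * \<epsilon>) \<le> u (m \<zeta>) - (norm (m \<zeta> - \<zeta>))\<^sup>2 / (4 * \<epsilon>)"
    by metis
  \<comment> \<open>The sup-convolution, expressed through a maximizer. Adding the quadratic in
    \<open>g\<close> turns it into a maximum of affine functions of \<open>\<zeta>\<close>, hence a
    convex function.\<close>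
  define F where "F \<zeta> = u (m \<zeta>) - (norm (m \<zeta> - \<zeta>))\<^sup>2 / (4 * \<epsilon>)" for \<zeta>
  have F_ge: "u x - (norm (x - \<zeta>))\<^sup>2 / (4 * \<epsilon>) \<le> F \<zeta>" if "x \<in> S" for x \<zeta>
    using m(2)[OF that] by (simp add: F_def)
  define g where "g \<zeta> = F \<zeta> + (norm \<zeta>)\<^sup>2 / (4 * \<epsilon>)" for \<zeta>
  have h4: "(norm (x - y))\<^sup>2 / (4 * \<epsilon>) = (norm x)\<^sup>2 / (4 * \<epsilon>) - (x \<bullet> y) / (2 * \<epsilon>) + (norm y)\<^sup>2 / (4 * \<epsilon>)" for x y :: 'a
    by (simp add: norm_diff_sq add_divide_distrib diff_divide_distrib)
  have h2: "(norm (x - y))\<^sup>2 / (2 * \<epsilon>) = (norm x)\<^sup>2 / (4 * \<epsilon>) + (norm x)\<^sup>2 / (4 * \<epsilon>) - (x \<bullet> y) / \<epsilon> + (norm y)\<^sup>2 / (2 * \<epsilon>)" for x y :: 'a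
    using e by (simp add: norm_diff_sq field_simps)
  have g_aff: "g \<zeta> = u (m \<zeta>) - (norm (m \<zeta>))\<^sup>2 / (4 * \<epsilon>) + (m \<zeta> \<bullet> \<zeta>) / (2 * \<epsilon>)" for \<zeta>
    by (simp add: g_def F_def h4)
  have g_ge: "u x - (norm x)\<^sup>2 / (4 * \<epsilon>) + (x \<bullet> \<zeta>) / (2 * \<epsilon>) \<le> g \<zeta>" if "x \<in> S" for x \<zeta>
    using F_ge[OF that, of \<zeta>] by (simp add: g_def h4)
  have conv_alg: "k + ((1 - t) * a + t * b) = (1 - t) * (k + a) + t * (k + b)" for k t a b :: real
    by (simp add: algebra_simps)
  have g_conv: "convex_on UNIV g"
  proof (rule convex_onI)
    fix t :: real and x y :: 'a
    assume t: "0 < t" "t < 1"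
    let ?z = "(1 - t) *\<^sub>R x + t *\<^sub>R y"
    let ?k = "u (m ?z) - (norm (m ?z))\<^sup>2 / (4 * \<epsilon>)"
    have "g ?z = ?k + (m ?z \<bullet> ?z) / (2 * \<epsilon>)" by (rule g_aff)
    also have "(m ?z \<bullet> ?z) / (2 * \<epsilon>) = (1 - t) * ((m ?z \<bullet> x) / (2 * \<epsilon>)) + t * ((m ?z \<bullet> y) / (2 * \<epsilon>))"
      by (simp only: inner_add_right inner_scaleR_right add_divide_distrib times_divide_eq_right)
    also have "?k + \<dots> = (1 - t) * (?k + (m ?z \<bullet> x) / (2 * \<epsilon>)) + t * (?k + (m ?z \<bullet> y) / (2 * \<epsilon>))"
      by (rule conv_alg)
    also have "\<dots> \<le> (1 - t) * g x + t * g y"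
      using t g_ge[OF m(1)[of ?z]] by (intro add_mono mult_left_mono) auto
    finally show "g ?z \<le> (1 - t) * g x + t * g y" .
  qed auto
  have g_cont: "continuous_on UNIV g"
    by (rule convex_on_continuous[OF open_UNIV g_conv])
  \<comment> \<open>The penalty coefficient 1 / (2 \<epsilon>) is twice what is needed to make
    \<open>F\<close> convex, so \<open>\<phi> z\<close> is convex with the quadratic |\<zeta>|^2 /
    (4 \<epsilon>) to spare. This strong convexity makes the minimizer depend on \<open>z\<close> in
    a Lipschitz way.\<close>
  define \<phi> where "\<phi> z \<zeta> = F \<zeta> + (norm (\<zeta> - z))\<^sup>2 / (2 * \<epsilon>)" for z \<zeta>
  have \<phi>_g: "\<phi> z \<zeta> = g \<zeta> + (norm \<zeta>)\<^sup>2 / (4 * \<epsilon>) - (z \<bullet> \<zeta>) / \<epsilon> + (norm z)\<^sup>2 / (2 * \<epsilon>)" for z \<zeta>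
    by (simp add: \<phi>_def g_def h2 inner_commute)
  \<comment> \<open>The parallelogram law for \<open>x - z\<close> and \<open>\<zeta> - z\<close>.
    The extra square makes \<open>\<phi> z\<close> coercive; dropping it gives the lower bound on
    \<open>W\<close> by the sup-convolution with parameter \<epsilon>.\<close>
  have \<phi>_ge: "u x - (norm (x - z))\<^sup>2 / (2 * \<epsilon>) + (norm (x + \<zeta> - 2 *\<^sub>R z))\<^sup>2 / (4 * \<epsilon>) \<le> \<phi> z \<zeta>" if "x \<in> S" for x z \<zeta>
  proof -
    have "(norm (x + \<zeta> - 2 *\<^sub>R z))\<^sup>2 = 2 * (norm (x - z))\<^sup>2 - (norm (x - \<zeta>))\<^sup>2 + 2 * (norm (\<zeta> - z))\<^sup>2"
      by (simp add: power2_norm_eq_inner inner_diff_left inner_diff_right inner_add_left inner_add_right inner_commute)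
    then have "- (norm (x - z))\<^sup>2 / (2 * \<epsilon>) + (norm (x + \<zeta> - 2 *\<^sub>R z))\<^sup>2 / (4 * \<epsilon>)
      = - (norm (x - \<zeta>))\<^sup>2 / (4 * \<epsilon>) + (norm (\<zeta> - z))\<^sup>2 / (2 * \<epsilon>)"
      by (simp add: add_divide_distrib diff_divide_distrib)
    then show ?thesis using F_ge[OF that, of \<zeta>] by (simp add: \<phi>_def)
  qed
  have "\<exists>\<zeta>. \<forall>\<zeta>'. \<phi> z \<zeta> \<le> \<phi> z \<zeta>'" for z
  proof -
    obtain x0 where x0: "x0 \<in> S" using S by blast
    define B where "B = \<phi> z z - (u x0 - (norm (x0 - z))\<^sup>2 / (2 * \<epsilon>))"
    have "0 \<le> (norm (x0 + z - 2 *\<^sub>R z))\<^sup>2 / (4 * \<epsilon>)" using e by simp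
    then have B0: "B \<ge> 0" using \<phi>_ge[OF x0, of z z] unfolding B_def by linarith
    \<comment> \<open>Outside this ball the square is at least \<open>4 * \<epsilon> * B\<close>, so
      \<open>\<phi> z\<close> is at least its value at \<open>z\<close>. As \<open>z\<close> lies in
      the ball, the minimum over the ball is global.\<close>
    define R where "R = norm x0 + 2 * norm z + sqrt (4 * \<epsilon> * B)"
    have z_in: "z \<in> cball 0 R"
    proof -
      have "0 \<le> sqrt (4 * \<epsilon> * B)" using e B0 by simp
      then show ?thesis using norm_ge_zero[of x0] norm_ge_zero[of z] unfolding mem_cball_0 R_def by linarith
    qed
    have "continuous_on (cball 0 R) (\<phi> z)"
      unfolding \<phi>_g[abs_def] by (intro continuous_intros continuous_on_subset[OF g_cont]) (use e in auto)
    then obtain \<zeta> where \<zeta>: "\<zeta> \<in> cball 0 R" "\<And>\<zeta>'. \<zeta>' \<in> cball 0 R \<Longrightarrow> \<phi> z \<zeta> \<le> \<phi> z \<zeta>'"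
      using continuous_attains_inf[of "cball 0 R" "\<phi> z"] z_in by (metis compact_cball empty_iff)
    have "\<phi> z \<zeta> \<le> \<phi> z \<zeta>'" if "\<zeta>' \<notin> cball 0 R" for \<zeta>'
    proof -
      have "norm \<zeta>' \<le> norm (x0 + \<zeta>' - 2 *\<^sub>R z) + norm x0 + 2 * norm z"
        using norm_triangle_ineq4[of "x0 + \<zeta>' - 2 *\<^sub>R z" "x0 - 2 *\<^sub>R z"] norm_triangle_ineq4[of x0 "2 *\<^sub>R z"] by simp
      then have "sqrt (4 * \<epsilon> * B) \<le> norm (x0 + \<zeta>' - 2 *\<^sub>R z)"
        using that by (simp add: R_def)
      then have "4 * \<epsilon> * B \<le> (norm (x0 + \<zeta>' - 2 *\<^sub>R z))\<^sup>2"
        using sqrt_le_D by blast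
      then have "B \<le> (norm (x0 + \<zeta>' - 2 *\<^sub>R z))\<^sup>2 / (4 * \<epsilon>)" using e by (simp add: field_simps)
      then have "\<phi> z z \<le> \<phi> z \<zeta>'" using \<phi>_ge[OF x0, of z \<zeta>'] by (simp add: B_def)
      then show ?thesis using \<zeta>(2)[OF z_in] by simp
    qed
    then show ?thesis using \<zeta> by blast
  qed
  then obtain Z where Z: "\<And>z \<zeta>. \<phi> z (Z z) \<le> \<phi> z \<zeta>" by metis
  have strong_alg: "gy + ((1 - t) * a + t * b - t * (1 - t) * d) - ((1 - t) * a' + t * b') + c
      \<le> (1 - t) * (ga + a - a' + c) + t * (gb + b - b' + c) - t * (1 - t) * d"
    if "gy \<le> (1 - t) * ga + t * gb" for gy t a b d a' b' c ga gb :: real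
    using that by (simp add: algebra_simps)
  have strong_alg2: "t * (a + (1 - t) * d) \<le> t * c"
    if "a \<le> b" "b \<le> (1 - t) * a + t * c - t * (1 - t) * d" for a b c d t :: real
    using that by (simp add: algebra_simps)
  \<comment> \<open>Compare the minimizer with the point at fraction \<open>t\<close> on the way to
    \<open>\<zeta>\<close>, divide by \<open>t\<close>, and let \<open>t\<close> tend to 0.\<close>
  have strong: "\<phi> z (Z z) + (norm (\<zeta> - Z z))\<^sup>2 / (4 * \<epsilon>) \<le> \<phi> z \<zeta>" for z \<zeta>
  proof -
    define d where "d = (norm (\<zeta> - Z z))\<^sup>2 / (4 * \<epsilon>)"
    have "\<phi> z (Z z) + (1 - t) * d \<le> \<phi> z \<zeta>" if t: "0 < t" "t < 1" for t
    proof -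
      let ?y = "(1 - t) *\<^sub>R Z z + t *\<^sub>R \<zeta>"
      have n: "(norm ?y)\<^sup>2 / (4 * \<epsilon>) = (1 - t) * ((norm (Z z))\<^sup>2 / (4 * \<epsilon>)) + t * ((norm \<zeta>)\<^sup>2 / (4 * \<epsilon>)) - t * (1 - t) * d"
        unfolding convex_comb_norm_sq by (simp add: d_def add_divide_distrib diff_divide_distrib)
      have i: "(z \<bullet> ?y) / \<epsilon> = (1 - t) * ((z \<bullet> Z z) / \<epsilon>) + t * ((z \<bullet> \<zeta>) / \<epsilon>)"
        by (simp add: inner_add_right add_divide_distrib)
      have "g ?y \<le> (1 - t) * g (Z z) + t * g \<zeta>"
        using convex_onD[OF g_conv, of t "Z z" \<zeta>] t by simp
      then have "\<phi> z ?y \<le> (1 - t) * \<phi> z (Z z) + t * \<phi> z \<zeta> - t * (1 - t) * d"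
        unfolding \<phi>_g n i by (rule strong_alg)
      then have "t * (\<phi> z (Z z) + (1 - t) * d) \<le> t * \<phi> z \<zeta>"
        by (rule strong_alg2[OF Z])
      then show ?thesis using t by simp
    qed
    then have "\<forall>\<^sub>F t in at_right 0. \<phi> z (Z z) + (1 - t) * d \<le> \<phi> z \<zeta>"
      unfolding eventually_at_right_field by (intro exI[of _ 1]) auto
    moreover have "((\<lambda>t. \<phi> z (Z z) + (1 - t) * d) \<longlongrightarrow> \<phi> z (Z z) + (1 - 0) * d) (at_right 0)"
      by (intro tendsto_intros)
    ultimately have "\<phi> z (Z z) + (1 - 0) * d \<le> \<phi> z \<zeta>"
      by (intro tendsto_upperbound[OF _ _ trivial_limit_at_right_real])
    then show ?thesis by (simp add: d_def)
  qed
  \<comment> \<open>Test each of the two strong minimality statements at the other minimizer and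
    add: only the bilinear term in \<open>z\<close> and \<open>\<zeta>\<close> survives.\<close>
  have Z_lip: "norm (Z z - Z z') \<le> 2 * norm (z - z')" for z z'
  proof -
    define N where "N = (norm (Z z - Z z'))\<^sup>2"
    have "\<phi> z (Z z) + N / (4 * \<epsilon>) \<le> \<phi> z (Z z')" "\<phi> z' (Z z') + N / (4 * \<epsilon>) \<le> \<phi> z' (Z z)"
      using strong[of z "Z z'"] strong[of z' "Z z"] by (simp_all add: N_def norm_minus_commute)
    then have "N / (4 * \<epsilon>) + N / (4 * \<epsilon>) \<le> ((z \<bullet> Z z) - (z \<bullet> Z z') + (z' \<bullet> Z z') - (z' \<bullet> Z z)) / \<epsilon>"
      unfolding \<phi>_g by (simp add: add_divide_distrib diff_divide_distrib)
    moreover have "(z \<bullet> Z z) - (z \<bullet> Z z') + (z' \<bullet> Z z') - (z' \<bullet> Z z) = (Z z - Z z') \<bullet> (z - z')"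
      by (simp add: inner_diff_left inner_diff_right inner_commute)
    moreover have "N / (4 * \<epsilon>) + N / (4 * \<epsilon>) = (N / 2) / \<epsilon>" by simp
    ultimately have "(N / 2) / \<epsilon> \<le> ((Z z - Z z') \<bullet> (z - z')) / \<epsilon>" by simp
    then have "N / 2 \<le> (Z z - Z z') \<bullet> (z - z')"
      using e unfolding divide_le_cancel by blast
    then have "(norm (Z z - Z z'))\<^sup>2 \<le> 2 * ((Z z - Z z') \<bullet> (z - z'))"
      by (simp add: N_def)
    also have "\<dots> \<le> 2 * (norm (Z z - Z z') * norm (z - z'))"
      using norm_cauchy_schwarz by (intro mult_left_mono) auto
    finally have "norm (Z z - Z z') * norm (Z z - Z z') \<le> norm (Z z - Z z') * (2 * norm (z - z'))"
      by (simp add: power2_eq_square algebra_simps)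
    note le = this
    show ?thesis
    proof (cases "Z z = Z z'")
      case False
      then have "0 < norm (Z z - Z z')" by simp
      with le show ?thesis by (simp only: mult_le_cancel_left_pos)
    qed simp
  qed
  \<comment> \<open>The gradient of \<open>W\<close> by the envelope principle: differentiate
    \<open>\<phi> z \<zeta>\<close> in \<open>z\<close> with \<open>\<zeta> = Z z\<close>
    frozen.\<close>
  define G where "G z = (1 / \<epsilon>) *\<^sub>R (z - Z z)" for z
  define W where "W z = \<phi> z (Z z)" for z
  have G_lip: "norm (G z - G z') \<le> 3 / \<epsilon> * norm (z - z')" for z z'
  proof -
    have "G z - G z' = (1 / \<epsilon>) *\<^sub>R ((z - z') - (Z z - Z z'))"
      by (simp add: G_def algebra_simps)
    then have "norm (G z - G z') = 1 / \<epsilon> * norm ((z - z') - (Z z - Z z'))" using e by simp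
    also have "\<dots> \<le> 1 / \<epsilon> * (norm (z - z') + 2 * norm (z - z'))"
      using norm_triangle_ineq4[of "z - z'" "Z z - Z z'"] Z_lip[of z z'] e by (intro mult_left_mono) auto
    finally show ?thesis by simp
  qed
  have W_up: "W z' \<le> W z + G z \<bullet> (z' - z) + (norm (z' - z))\<^sup>2 / (2 * \<epsilon>)" for z z'
  proof -
    have "W z' \<le> \<phi> z' (Z z)" by (simp add: W_def Z)
    also have "\<dots> = W z + G z \<bullet> (z' - z) + (norm (z' - z))\<^sup>2 / (2 * \<epsilon>)"
    proof -
      have "(norm (Z z - z'))\<^sup>2 = (norm (Z z - z))\<^sup>2 + 2 * ((z - Z z) \<bullet> (z' - z)) + (norm (z' - z))\<^sup>2"
        by (simp add: power2_norm_eq_inner inner_diff_left inner_diff_right inner_commute)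
      then have "(norm (Z z - z'))\<^sup>2 / (2 * \<epsilon>) = (norm (Z z - z))\<^sup>2 / (2 * \<epsilon>) + ((z - Z z) \<bullet> (z' - z)) / \<epsilon> + (norm (z' - z))\<^sup>2 / (2 * \<epsilon>)"
        by (simp add: add_divide_distrib)
      then show ?thesis by (simp add: W_def \<phi>_def G_def)
    qed
    finally show ?thesis .
  qed
  \<comment> \<open>The upper bound is \<open>W_up\<close>. The lower bound is \<open>W_up\<close>
    with \<open>z\<close> and \<open>z'\<close> exchanged; replacing \<open>G z'\<close> by
    \<open>G z\<close> costs 3 / \<epsilon>, the quadratic term at most 1 / \<epsilon>.\<close>
  have W_two: "\<bar>W z' - W z - G z \<bullet> (z' - z)\<bar> \<le> 4 / \<epsilon> * (norm (z' - z))\<^sup>2" for z z'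
  proof -
    have nn: "(norm (z' - z))\<^sup>2 / (2 * \<epsilon>) \<le> 1 / \<epsilon> * (norm (z' - z))\<^sup>2"
      using e by (simp add: field_simps)
    have "(G z - G z') \<bullet> (z' - z) \<le> norm (G z - G z') * norm (z' - z)" by (rule norm_cauchy_schwarz)
    also have "\<dots> \<le> 3 / \<epsilon> * norm (z - z') * norm (z' - z)" by (intro mult_right_mono G_lip) auto
    finally have "(G z - G z') \<bullet> (z' - z) \<le> 3 / \<epsilon> * (norm (z' - z))\<^sup>2"
      by (simp add: power2_eq_square norm_minus_commute)
    moreover have "W z \<le> W z' + G z' \<bullet> (z - z') + (norm (z' - z))\<^sup>2 / (2 * \<epsilon>)"
      using W_up[of z z'] by (simp add: norm_minus_commute)
    moreover have "G z' \<bullet> (z - z') = - (G z \<bullet> (z' - z)) + (G z - G z') \<bullet> (z' - z)"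
      by (simp add: inner_diff_left inner_diff_right)
    moreover have "4 / \<epsilon> * (norm (z' - z))\<^sup>2 = 3 / \<epsilon> * (norm (z' - z))\<^sup>2 + 1 / \<epsilon> * (norm (z' - z))\<^sup>2"
      by (simp add: add_divide_distrib[symmetric] distrib_right[symmetric])
    moreover have "0 \<le> 3 / \<epsilon> * (norm (z' - z))\<^sup>2" using e by simp
    ultimately show ?thesis using W_up[of z' z] nn by linarith
  qed
  show thesis
  proof (rule that[OF _ _ G_lip W_two])
    show "u x - (norm (x - z))\<^sup>2 / (2 * \<epsilon>) \<le> W z" if "x \<in> S" for x z
    proof -
      have "0 \<le> (norm (x + Z z - 2 *\<^sub>R z))\<^sup>2 / (4 * \<epsilon>)" using e by simp
      then show ?thesis using \<phi>_ge[OF that, of z "Z z"] unfolding W_def by linarith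
    qed
    show "W z \<le> c + (norm (\<zeta> - z))\<^sup>2 / (2 * \<epsilon>)"
      if "\<And>x. x \<in> S \<Longrightarrow> u x - (norm (x - \<zeta>))\<^sup>2 / (4 * \<epsilon>) \<le> c" for z \<zeta> c
    proof -
      have "F \<zeta> \<le> c" unfolding F_def by (rule that[OF m(1)])
      then show ?thesis using Z[of z \<zeta>] by (simp add: W_def \<phi>_def)
    qed
  qed
qed

text \<open>Differentiability of the gradient at the single point \<open>z\<close> is enough: along
  the segment from \<open>z\<close> to \<open>z + h\<close> the difference between \<open>W\<close>
  and its quadratic model has derivative at most \<open>\<eta> * (norm h)\<^sup>2\<close>, and the
  mean value theorem applies. Only the quadratic form of \<open>D\<close> appears, so no symmetry is
  claimed.\<close>

lemma second_order_expansion: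
  fixes W :: "'a::euclidean_space \<Rightarrow> real" and G D :: "'a \<Rightarrow> 'a"
  assumes W: "\<And>z z'. \<bar>W z' - W z - G z \<bullet> (z' - z)\<bar> \<le> K * (norm (z' - z))\<^sup>2"
    and D: "(G has_derivative D) (at z)" and \<eta>: "\<eta> > 0"
  obtains r where "r > 0"
    "\<And>h. norm h < r \<Longrightarrow> \<bar>W (z + h) - W z - G z \<bullet> h - (h \<bullet> D h) / 2\<bar> \<le> \<eta> * (norm h)\<^sup>2"
proof -
  have dW: "(W has_derivative (\<lambda>h. G z \<bullet> h)) (at z)" for z
    unfolding has_derivative_at_alt
  proof (intro conjI allI impI bounded_linear_inner_right)
    fix e :: real assume e: "e > 0"
    show "\<exists>d>0. \<forall>y. norm (y - z) < d \<longrightarrow> norm (W y - W z - G z \<bullet> (y - z)) \<le> e * norm (y - z)"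
    proof (intro exI[of _ "e / (\<bar>K\<bar> + 1)"] conjI allI impI)
      fix y assume "norm (y - z) < e / (\<bar>K\<bar> + 1)"
      then have "(\<bar>K\<bar> + 1) * norm (y - z) \<le> e" by (simp add: field_simps)
      then have "((\<bar>K\<bar> + 1) * norm (y - z)) * norm (y - z) \<le> e * norm (y - z)"
        by (rule mult_right_mono) simp
      moreover have "K * (norm (y - z))\<^sup>2 \<le> (\<bar>K\<bar> + 1) * (norm (y - z))\<^sup>2"
        by (rule mult_right_mono) auto
      ultimately show "norm (W y - W z - G z \<bullet> (y - z)) \<le> e * norm (y - z)"
        using W[of y z] by (simp add: power2_eq_square mult.assoc)
    qed (use e in auto)
  qed
  from D have bl: "bounded_linear D" and "\<forall>e>0. \<exists>d>0. \<forall>y. norm (y - z) < d \<longrightarrow> norm (G y - G z - D (y - z)) \<le> e * norm (y - z)"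
    unfolding has_derivative_at_alt by auto
  then obtain r where r: "r > 0" "\<And>y. norm (y - z) < r \<Longrightarrow> norm (G y - G z - D (y - z)) \<le> \<eta> * norm (y - z)"
    using \<eta> by blast
  interpret D: bounded_linear D by (rule bl)
  show thesis
  proof (rule that[OF r(1)])
    fix h :: 'a assume h: "norm h < r"
    define \<psi> where "\<psi> s = W (z + s *\<^sub>R h) - s * (G z \<bullet> h) - s\<^sup>2 * (h \<bullet> D h) / 2" for s
    have d: "(\<psi> has_real_derivative (G (z + s *\<^sub>R h) - G z - D (s *\<^sub>R h)) \<bullet> h) (at s)" for s
    proof -
      have "((\<lambda>s. W (z + s *\<^sub>R h)) has_derivative (\<lambda>t. G (z + s *\<^sub>R h) \<bullet> (t *\<^sub>R h))) (at s)"
        by (rule has_derivative_compose[OF _ dW]) (auto intro!: derivative_eq_intros)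
      then have "((\<lambda>s. W (z + s *\<^sub>R h)) has_real_derivative (G (z + s *\<^sub>R h) \<bullet> h)) (at s)"
        by (simp add: has_field_derivative_def mult.commute[of _ "G _ \<bullet> h"])
      then show ?thesis unfolding \<psi>_def
        by (auto intro!: derivative_eq_intros simp: D.scaleR inner_diff_left inner_diff_right inner_commute)
    qed
    obtain s where s: "0 < s" "s < 1" "\<psi> 1 - \<psi> 0 = (1 - 0) * ((G (z + s *\<^sub>R h) - G z - D (s *\<^sub>R h)) \<bullet> h)"
      using MVT2[of 0 1 \<psi> "\<lambda>s. (G (z + s *\<^sub>R h) - G z - D (s *\<^sub>R h)) \<bullet> h"] d by auto
    have "norm (s *\<^sub>R h) \<le> norm h" using s by (simp add: mult_left_le_one_le)
    then have "norm (G (z + s *\<^sub>R h) - G z - D (s *\<^sub>R h)) \<le> \<eta> * norm h"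
      using r(2)[of "z + s *\<^sub>R h"] h \<eta> by (auto intro: order_trans)
    then have "norm (G (z + s *\<^sub>R h) - G z - D (s *\<^sub>R h)) * norm h \<le> \<eta> * norm h * norm h"
      by (rule mult_right_mono) simp
    then have "\<bar>\<psi> 1 - \<psi> 0\<bar> \<le> \<eta> * norm h * norm h"
      using Cauchy_Schwarz_ineq2[of "G (z + s *\<^sub>R h) - G z - D (s *\<^sub>R h)" h] s(3) by simp
    then show "\<bar>W (z + h) - W z - G z \<bullet> h - (h \<bullet> D h) / 2\<bar> \<le> \<eta> * (norm h)\<^sup>2"
      by (simp add: \<psi>_def power2_eq_square algebra_simps)
  qed
qed

section \<open>From the envelope to the jets of both functions\<close>

text \<open>Here \<open>Y\<close> is the partial minimum over \<open>f\<close> of the form in the last claim, and \<open>T e\<close> the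
  minimizer.  For the Hessian \<open>X\<close> of a sup-convolution at \<open>z\<close> this recovers the jet of the
  original function at the point realizing the supremum.\<close>

lemma quadratic_partial_minimum:
  fixes X :: "'a::euclidean_space \<Rightarrow> 'a"
  assumes X: "linear X" "\<And>a b. X a \<bullet> b = a \<bullet> X b" and low: "\<And>f. - (norm f)\<^sup>2 / \<epsilon> \<le> f \<bullet> X f"
    and e: "\<epsilon> > 0" and \<eta>: "\<eta> > 0"
  obtains Y T where "linear Y" "linear T" "\<And>a b. Y a \<bullet> b = a \<bullet> Y b"
    "\<And>e. e \<bullet> Y e = T e \<bullet> X (T e) + \<eta> * (norm (T e))\<^sup>2 + (norm (e - T e))\<^sup>2 / \<epsilon>"
    "\<And>e f. e \<bullet> Y e \<le> f \<bullet> X f + \<eta> * (norm f)\<^sup>2 + (norm (e - f))\<^sup>2 / \<epsilon>"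
proof -
  interpret X: linear X by (rule X)
  \<comment> \<open>Half the Hessian in \<open>f\<close> of the form to be minimized. The term
    \<open>\<eta>\<close> makes it positive definite even where \<open>X\<close> reaches the lower
    bound -1 / \<epsilon>.\<close>
  define M where "M h = X h + (\<eta> + 1 / \<epsilon>) *\<^sub>R h" for h
  have M: "linear M"
    unfolding M_def by (intro linear_compose_add X linear_compose_scale_right linear_id[unfolded id_def])
  interpret M: linear M by (rule M)
  have Msym: "M a \<bullet> b = a \<bullet> M b" for a b
    using X(2)[of a b] by (simp add: M_def inner_add_left inner_add_right)
  have Mpos: "\<eta> * (norm h)\<^sup>2 \<le> h \<bullet> M h" for h
  proof -
    have "h \<bullet> M h = h \<bullet> X h + \<eta> * (norm h)\<^sup>2 + (norm h)\<^sup>2 / \<epsilon>"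
      by (simp add: M_def inner_add_right power2_norm_eq_inner distrib_right)
    then show ?thesis using low[of h] by simp
  qed
  have "inj M"
  proof (rule injI)
    fix a b assume "M a = M b"
    then have "M (a - b) = 0" by (simp add: M.diff)
    then have "\<eta> * (norm (a - b))\<^sup>2 \<le> 0" using Mpos[of "a - b"] by simp
    then show "a = b" using \<eta> by (simp add: mult_le_0_iff)
  qed
  then obtain M' where M': "linear M'" "\<And>x. M' (M x) = x" "\<And>x. M (M' x) = x"
    using linear_injective_isomorphism[OF M] by blast
  interpret M': linear M' by (rule M')
  have M'sym: "M' a \<bullet> b = a \<bullet> M' b" for a b
    using Msym[of "M' a" "M' b"] by (simp add: M')
  define T where "T h = (1 / \<epsilon>) *\<^sub>R M' h" for h
  define Y where "Y h = (1 / \<epsilon>) *\<^sub>R (h - T h)" for h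
  have T: "linear T" unfolding T_def by (intro linear_compose_scale_right M')
  have Y: "linear Y" unfolding Y_def by (intro linear_compose_scale_right linear_compose_sub T linear_id[unfolded id_def])
  have MT: "M (T h) = (1 / \<epsilon>) *\<^sub>R h" for h by (simp add: T_def M.scale M')
  \<comment> \<open>Completing the square around the minimizer \<open>T e\<close>.\<close>
  have key: "f \<bullet> X f + \<eta> * (norm f)\<^sup>2 + (norm (e - f))\<^sup>2 / \<epsilon> = e \<bullet> Y e + (f - T e) \<bullet> M (f - T e)" for e f
  proof -
    have "(f - T e) \<bullet> M (f - T e) = f \<bullet> M f - f \<bullet> M (T e) - M (T e) \<bullet> f + T e \<bullet> M (T e)"
      by (simp add: M.diff inner_diff_left inner_diff_right Msym)
    also have "\<dots> = f \<bullet> X f + \<eta> * (norm f)\<^sup>2 + (norm f)\<^sup>2 / \<epsilon> - 2 * (e \<bullet> f) / \<epsilon> + (e \<bullet> T e) / \<epsilon>"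
      unfolding MT by (simp add: M_def inner_add_right power2_norm_eq_inner distrib_right inner_commute)
    finally show ?thesis
      by (simp add: Y_def norm_diff_sq inner_diff_right add_divide_distrib diff_divide_distrib power2_norm_eq_inner[of e])
  qed
  show thesis
  proof (rule that[OF Y T])
    show "Y a \<bullet> b = a \<bullet> Y b" for a b
      using M'sym[of a b] by (simp add: Y_def T_def inner_diff_left inner_diff_right)
    show "e \<bullet> Y e = T e \<bullet> X (T e) + \<eta> * (norm (T e))\<^sup>2 + (norm (e - T e))\<^sup>2 / \<epsilon>" for e
      using key[of "T e" e] by (simp add: M.zero)
    show "e \<bullet> Y e \<le> f \<bullet> X f + \<eta> * (norm f)\<^sup>2 + (norm (e - f))\<^sup>2 / \<epsilon>" for e f
    proof -
      have "0 \<le> \<eta> * (norm (f - T e))\<^sup>2" using \<eta> by simp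
      then show ?thesis using key[of f e] Mpos[of "f - T e"] by linarith
    qed
  qed
qed

text \<open>The map \<open>p \<mapsto> z p\<close> in the proof is expansive, so its image of a ball is not negligible and
  hits a differentiability point of the Lipschitz gradient of the envelope \<open>W\<close>.\<close>

theorem theorem_on_sums:
  fixes u v :: "'a::euclidean_space \<Rightarrow> real"
  assumes S: "compact S" "S \<noteq> {}" and u: "usc_on S u" and v: "usc_on S (\<lambda>x. - v x)"
    and e: "\<epsilon> > 0" and r: "r > 0"
  obtains p x y where "norm p < r" "x \<in> S" "y \<in> S"
    "\<And>x' y'. x' \<in> S \<Longrightarrow> y' \<in> S \<Longrightarrow>
        u x' - v y' - (norm (x' - y'))\<^sup>2 / (4 * \<epsilon>) - (p \<bullet> (x' + y')) / 2
      \<le> u x - v y - (norm (x - y))\<^sup>2 / (4 * \<epsilon>) - (p \<bullet> (x + y)) / 2"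
    "\<And>\<eta>. \<eta> > 0 \<Longrightarrow> \<exists>X Y. linear X \<and> linear Y \<and> (\<forall>a b. X a \<bullet> b = a \<bullet> X b) \<and> (\<forall>a b. Y a \<bullet> b = a \<bullet> Y b) \<and>
      (\<forall>e f. e \<bullet> X e - f \<bullet> Y f \<le> (norm (e - f))\<^sup>2 / \<epsilon> + \<eta> * (norm f)\<^sup>2) \<and>
      (\<forall>\<^sub>F x' in nhds x. x' \<in> S \<longrightarrow> u x' \<le> u x + ((1 / (2 * \<epsilon>)) *\<^sub>R (x - y) + (1/2) *\<^sub>R p) \<bullet> (x' - x) + ((x' - x) \<bullet> X (x' - x)) / 2) \<and>
      (\<forall>\<^sub>F y' in nhds y. y' \<in> S \<longrightarrow> v y' \<ge> v y + ((1 / (2 * \<epsilon>)) *\<^sub>R (x - y) - (1/2) *\<^sub>R p) \<bullet> (y' - y) + ((y' - y) \<bullet> Y (y' - y)) / 2)"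
proof -
  obtain W G L K where
    W1: "\<And>x z. x \<in> S \<Longrightarrow> u x - (norm (x - z))\<^sup>2 / (2 * \<epsilon>) \<le> W z" and
    W2: "\<And>z \<zeta> c. (\<And>x. x \<in> S \<Longrightarrow> u x - (norm (x - \<zeta>))\<^sup>2 / (4 * \<epsilon>) \<le> c) \<Longrightarrow> W z \<le> c + (norm (\<zeta> - z))\<^sup>2 / (2 * \<epsilon>)" and
    W3: "\<And>z z'. norm (G z - G z') \<le> L * norm (z - z')" and
    W4: "\<And>z z'. \<bar>W z' - W z - G z \<bullet> (z' - z)\<bar> \<le> K * (norm (z' - z))\<^sup>2"
    using lasry_lions_envelope[OF S u e] by blast
  define \<Phi> where "\<Phi> p x y = u x - v y - (norm (x - y))\<^sup>2 / (4 * \<epsilon>) - (p \<bullet> (x + y)) / 2" for p x y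
  have "\<exists>x y. x \<in> S \<and> y \<in> S \<and> (\<forall>x'\<in>S. \<forall>y'\<in>S. \<Phi> p x' y' \<le> \<Phi> p x y)" for p
  proof -
    have "usc_on (S \<times> S) (\<lambda>z. (u (fst z) + - v (snd z)) + - ((norm (fst z - snd z))\<^sup>2 / (4 * \<epsilon>) + (p \<bullet> (fst z + snd z)) / 2))"
      by (intro usc_on_add usc_on_compose[OF u] usc_on_compose[OF v] continuous_on_imp_usc_on continuous_intros) (use e in auto)
    also have "(\<lambda>z. (u (fst z) + - v (snd z)) + - ((norm (fst z - snd z))\<^sup>2 / (4 * \<epsilon>) + (p \<bullet> (fst z + snd z)) / 2))
        = (\<lambda>z. \<Phi> p (fst z) (snd z))" by (simp add: \<Phi>_def algebra_simps)
    finally have usc: "usc_on (S \<times> S) (\<lambda>z. \<Phi> p (fst z) (snd z))" .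
    from usc_on_attains_sup[OF compact_Times[OF S(1) S(1)] _ usc] S(2)
    obtain z where "z \<in> S \<times> S" "\<And>z'. z' \<in> S \<times> S \<Longrightarrow> \<Phi> p (fst z') (snd z') \<le> \<Phi> p (fst z) (snd z)"
      by auto
    then show ?thesis by force
  qed
  then obtain xs ys where xy: "\<And>p. xs p \<in> S" "\<And>p. ys p \<in> S"
    and max: "\<And>p x' y'. x' \<in> S \<Longrightarrow> y' \<in> S \<Longrightarrow> \<Phi> p x' y' \<le> \<Phi> p (xs p) (ys p)" by metis
  \<comment> \<open>The contact point of the two convolutions; for \<open>p = 0\<close> it is the
    midpoint. The shift makes the map expansive: maximality at \<open>p\<close> and at
    \<open>p'\<close> gives a nonpositive product of \<open>p - p'\<close> with the difference of
    the sums \<open>xs + ys\<close>, and the shift adds a further negative multiple of |p -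
    p'|^2.\<close>
  define z where "z p = (1/2) *\<^sub>R (xs p + ys p) - (\<epsilon> / 2) *\<^sub>R p" for p
  have expand: "norm (p - p') \<le> 2 / \<epsilon> * norm (z p - z p')" for p p'
  proof -
    have "\<Phi> p (xs p') (ys p') \<le> \<Phi> p (xs p) (ys p)" "\<Phi> p' (xs p) (ys p) \<le> \<Phi> p' (xs p') (ys p')"
      using max xy by auto
    then have "(p - p') \<bullet> ((xs p + ys p) - (xs p' + ys p')) \<le> 0"
      unfolding \<Phi>_def inner_diff_left inner_diff_right by argo
    moreover have "(p - p') \<bullet> (z p - z p') = ((p - p') \<bullet> ((xs p + ys p) - (xs p' + ys p'))) / 2 - \<epsilon> / 2 * (norm (p - p'))\<^sup>2"
    proof -
      have "z p - z p' = (1/2) *\<^sub>R ((xs p + ys p) - (xs p' + ys p')) - (\<epsilon> / 2) *\<^sub>R (p - p')"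
        by (simp add: z_def algebra_simps)
      then show ?thesis by (simp only: inner_diff_right inner_scaleR_right power2_norm_eq_inner)
    qed
    moreover have "\<bar>(p - p') \<bullet> (z p - z p')\<bar> \<le> norm (p - p') * norm (z p - z p')"
      by (rule Cauchy_Schwarz_ineq2)
    ultimately have "\<epsilon> / 2 * (norm (p - p'))\<^sup>2 \<le> norm (p - p') * norm (z p - z p')" by linarith
    then have le: "norm (p - p') * (\<epsilon> / 2 * norm (p - p')) \<le> norm (p - p') * norm (z p - z p')"
      by (simp add: power2_eq_square mult_ac)
    show ?thesis
    proof (cases "p = p'")
      case False
      then have "0 < norm (p - p')" by simp
      with le have "\<epsilon> / 2 * norm (p - p') \<le> norm (z p - z p')" by (simp only: mult_le_cancel_left_pos)
      then show ?thesis using e by (simp add: field_simps)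
    qed simp
  qed
  have "\<exists>p. norm p < r \<and> G differentiable (at (z p))"
  proof (rule ccontr)
    assume nd: "\<not> ?thesis"
    have "negligible {z. \<not> (\<lambda>x. G x \<bullet> b) differentiable (at z)}" if "b \<in> Basis" for b
    proof (rule rademacher)
      show "\<bar>G x \<bullet> b - G y \<bullet> b\<bar> \<le> L * norm (x - y)" for x y
        using Basis_le_norm[OF that, of "G x - G y"] W3[of x y] by (simp add: inner_diff_left)
    qed
    then have "negligible (\<Union>b\<in>Basis. {z. \<not> (\<lambda>x. G x \<bullet> b) differentiable (at z)})" by (intro negligible_Union) auto
    moreover have "z ` ball 0 r \<subseteq> (\<Union>b\<in>Basis. {z. \<not> (\<lambda>x. G x \<bullet> b) differentiable (at z)})"
    proof clarify
      fix p :: 'a assume "p \<in> ball 0 r"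
      then have "\<not> G differentiable (at (z p))" using nd by auto
      then obtain b where "b \<in> Basis" "\<not> (\<lambda>x. G x \<bullet> b) differentiable (at (z p))"
        using differentiable_componentwise_within[of G "z p" UNIV] by auto
      then show "z p \<in> (\<Union>b\<in>Basis. {z. \<not> (\<lambda>x. G x \<bullet> b) differentiable (at z)})" by auto
    qed
    ultimately have nz: "negligible (z ` ball 0 r)" by (rule negligible_subset)
    have inj: "inj z"
      using expand by (intro injI) (metis eq_iff_diff_eq_0 mult_zero_right norm_eq_zero norm_le_zero_iff)
    \<comment> \<open>The inverse of \<open>z\<close> is Lipschitz on the image by
      \<open>expand\<close>, so the ball itself would be negligible.\<close>
    have "negligible (inv z ` z ` ball 0 r)"
    proof (rule negligible_locally_Lipschitz_image[OF order_refl nz])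
      fix x assume "x \<in> z ` ball 0 r"
      then show "\<exists>T B. open T \<and> x \<in> T \<and> (\<forall>y\<in>z ` ball 0 r \<inter> T. norm (inv z y - inv z x) \<le> B * norm (y - x))"
        using expand by (intro exI[of _ UNIV] exI[of _ "2 / \<epsilon>"]) (auto simp: inv_f_f[OF inj])
    qed
    then have "negligible (ball (0::'a) r)" by (simp add: image_comp inj)
    then show False using r open_not_negligible[of "ball (0::'a) r"] by auto
  qed
  then obtain p D where p: "norm p < r" and D: "(G has_derivative D) (at (z p))"
    by (auto simp: differentiable_def)
  define x y Z where "x = xs p" and "y = ys p" and "Z = z p"
  note D = D[folded Z_def]
  have xS: "x \<in> S" "y \<in> S" by (auto simp: x_def y_def xy)
  define c where "c = \<Phi> p x y"
  have c: "u x' \<le> c + v y' + (norm (x' - y'))\<^sup>2 / (4 * \<epsilon>) + (p \<bullet> (x' + y')) / 2" if "x' \<in> S" "y' \<in> S" for x' y'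
    using max[OF that, of p] by (simp add: c_def x_def y_def \<Phi>_def[of p x'])
  \<comment> \<open>The second envelope bound at
    \<open>\<zeta> = y' - \<epsilon> *\<^sub>R p\<close>: completing the square turns the maximality
    of \<open>(x, y)\<close> into a bound on the sup-convolution of \<open>u\<close> at that point.
    Together with \<open>W1\<close> this traps \<open>W\<close> from both sides.\<close>
  have W5: "W z' \<le> v y' + (norm (y' - z'))\<^sup>2 / (2 * \<epsilon>) + (c + \<epsilon> / 4 * (p \<bullet> p)) + p \<bullet> z'"
    if "y' \<in> S" for y' z'
  proof -
    have "W z' \<le> (c + v y' + p \<bullet> y' - \<epsilon> / 4 * (norm p)\<^sup>2) + (norm (y' - \<epsilon> *\<^sub>R p - z'))\<^sup>2 / (2 * \<epsilon>)"
    proof (rule W2)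
      fix x' assume x': "x' \<in> S"
      have "(norm (x' - (y' - \<epsilon> *\<^sub>R p)))\<^sup>2 = (norm (x' - y'))\<^sup>2 + 2 * \<epsilon> * (p \<bullet> (x' - y')) + \<epsilon>\<^sup>2 * (norm p)\<^sup>2"
        using norm_diff_sq[of "x' - y'" "- \<epsilon> *\<^sub>R p"] by (simp add: power_mult_distrib inner_commute[of p] algebra_simps)
      then have "(norm (x' - (y' - \<epsilon> *\<^sub>R p)))\<^sup>2 / (4 * \<epsilon>) = (norm (x' - y'))\<^sup>2 / (4 * \<epsilon>) + (p \<bullet> (x' - y')) / 2 + \<epsilon> / 4 * (norm p)\<^sup>2"
        using e by (simp add: field_simps power2_eq_square)
      then show "u x' - (norm (x' - (y' - \<epsilon> *\<^sub>R p)))\<^sup>2 / (4 * \<epsilon>) \<le> c + v y' + p \<bullet> y' - \<epsilon> / 4 * (norm p)\<^sup>2"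
        using c[OF x' that] by (simp add: inner_add_right inner_diff_right field_simps)
    qed
    also have "(norm (y' - \<epsilon> *\<^sub>R p - z'))\<^sup>2 = (norm (y' - z'))\<^sup>2 - 2 * \<epsilon> * (p \<bullet> (y' - z')) + \<epsilon>\<^sup>2 * (norm p)\<^sup>2"
      using norm_diff_sq[of "y' - z'" "\<epsilon> *\<^sub>R p"] by (simp add: power_mult_distrib inner_commute[of p] algebra_simps)
    also have "\<dots> / (2 * \<epsilon>) = (norm (y' - z'))\<^sup>2 / (2 * \<epsilon>) - p \<bullet> (y' - z') + \<epsilon> / 2 * (norm p)\<^sup>2"
      using e by (simp add: field_simps power2_eq_square)
    finally show ?thesis by (simp add: inner_diff_right power2_norm_eq_inner[of p])
  qed
  define q where "q = (1 / (2 * \<epsilon>)) *\<^sub>R (x - y) + (1/2) *\<^sub>R p"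
  have xZ: "x - Z = \<epsilon> *\<^sub>R q" and yZ: "y - Z = \<epsilon> *\<^sub>R (p - q)"
    using e by (simp_all add: Z_def z_def x_def[symmetric] y_def[symmetric] q_def algebra_simps)
      (simp_all add: scaleR_add_left[symmetric] flip: scaleR_half_double)
  have nx: "(norm (x - Z))\<^sup>2 / (2 * \<epsilon>) = \<epsilon> / 2 * (q \<bullet> q)" and ny: "(norm (y - Z))\<^sup>2 / (2 * \<epsilon>) = \<epsilon> / 2 * ((p - q) \<bullet> (p - q))"
    unfolding xZ yZ power2_norm_eq_inner inner_scaleR_left inner_scaleR_right using e by simp_all
  \<comment> \<open>At \<open>Z\<close> the lower bound from \<open>x\<close> and the upper bound
    from \<open>y\<close> coincide, because \<open>(x, y)\<close> attains the maximum
    \<open>c\<close>.\<close>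
  have WZ: "W Z = u x - (norm (x - Z))\<^sup>2 / (2 * \<epsilon>)" "W Z = v y + (norm (y - Z))\<^sup>2 / (2 * \<epsilon>) + (c + \<epsilon> / 4 * (p \<bullet> p)) + p \<bullet> Z"
  proof -
    have xmy: "x - y = \<epsilon> *\<^sub>R (2 *\<^sub>R q - p)" using xZ yZ by (simp add: algebra_simps scaleR_2)
    have xpy: "x + y = 2 *\<^sub>R Z + \<epsilon> *\<^sub>R p" using xZ yZ by (simp add: algebra_simps scaleR_2)
    have "(norm (x - y))\<^sup>2 / (4 * \<epsilon>) = \<epsilon> / 4 * ((2 *\<^sub>R q - p) \<bullet> (2 *\<^sub>R q - p))"
      unfolding xmy power2_norm_eq_inner inner_scaleR_left inner_scaleR_right using e by simp
    moreover have "(p \<bullet> (x + y)) / 2 = p \<bullet> Z + \<epsilon> / 2 * (p \<bullet> p)"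
      unfolding xpy by (simp add: inner_add_right)
    ultimately have "c = u x - v y - \<epsilon> / 4 * ((2 *\<^sub>R q - p) \<bullet> (2 *\<^sub>R q - p)) - (p \<bullet> Z + \<epsilon> / 2 * (p \<bullet> p))"
      unfolding c_def \<Phi>_def by linarith
    moreover have "\<epsilon> / 4 * ((2 *\<^sub>R q - p) \<bullet> (2 *\<^sub>R q - p)) + \<epsilon> / 2 * (p \<bullet> p) = \<epsilon> / 2 * (q \<bullet> q) + \<epsilon> / 2 * ((p - q) \<bullet> (p - q)) + \<epsilon> / 4 * (p \<bullet> p)"
      by (simp add: inner_diff_left inner_diff_right inner_commute algebra_simps)
    ultimately show "W Z = u x - (norm (x - Z))\<^sup>2 / (2 * \<epsilon>)" "W Z = v y + (norm (y - Z))\<^sup>2 / (2 * \<epsilon>) + (c + \<epsilon> / 4 * (p \<bullet> p)) + p \<bullet> Z"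
      using W1[OF xS(1), of Z] W5[OF xS(2), of Z] unfolding nx ny by linarith+
  qed
  interpret D: bounded_linear D by (rule has_derivative_bounded_linear[OF D])
  have Dlin: "linear D" by (rule D.linear)
  \<comment> \<open>Symmetry of \<open>D\<close> is not established; its symmetric part has the same
    quadratic form.\<close>
  define X where "X h = (1/2) *\<^sub>R (D h + adjoint D h)" for h
  have X: "linear X"
    unfolding X_def by (intro linear_compose_scale_right linear_compose_add Dlin adjoint_linear[OF Dlin])
  interpret X: linear X by (rule X)
  have Xsym: "X a \<bullet> b = a \<bullet> X b" for a b
    using adjoint_works[OF Dlin, of a b] adjoint_works[OF Dlin, of b a]
    by (simp add: X_def inner_add_left inner_add_right inner_commute)
  have XD: "h \<bullet> X h = h \<bullet> D h" for h
    using adjoint_works[OF Dlin, of h h] by (simp add: X_def inner_add_right inner_commute)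
  have exp: "\<exists>d>0. \<forall>h. norm h < d \<longrightarrow> \<bar>W (Z + h) - W Z - G Z \<bullet> h - (h \<bullet> X h) / 2\<bar> \<le> \<eta> * (norm h)\<^sup>2" if "\<eta> > 0" for \<eta>
    using second_order_expansion[OF W4 D that] unfolding XD by metis
  \<comment> \<open>A paraboloid with gradient \<open>q\<close> and curvature -1 / \<epsilon>
    touches \<open>W\<close> from below at \<open>Z\<close>. It identifies the gradient there and
    bounds the Hessian from below.\<close>
  have touch: "W Z + q \<bullet> h - (norm h)\<^sup>2 / (2 * \<epsilon>) \<le> W (Z + h)" for h
  proof -
    have "(norm (x - (Z + h)))\<^sup>2 = (norm ((x - Z) - h))\<^sup>2" by (simp add: algebra_simps)
    also have "\<dots> = (norm (x - Z))\<^sup>2 - 2 * \<epsilon> * (q \<bullet> h) + (norm h)\<^sup>2" by (simp add: norm_diff_sq xZ)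
    finally have "(norm (x - (Z + h)))\<^sup>2 / (2 * \<epsilon>) = (norm (x - Z))\<^sup>2 / (2 * \<epsilon>) - q \<bullet> h + (norm h)\<^sup>2 / (2 * \<epsilon>)"
      using e by (simp add: field_simps)
    then show ?thesis using W1[OF xS(1), of "Z + h"] WZ(1) by simp
  qed
  have Gq: "G Z = q"
  proof (rule ccontr)
    assume "G Z \<noteq> q"
    define g where "g = q - G Z"
    have g: "0 < norm g" using \<open>G Z \<noteq> q\<close> by (simp add: g_def)
    have "t * (norm g)\<^sup>2 \<le> t * (t * ((\<bar>K\<bar> + 1 / (2 * \<epsilon>)) * (norm g)\<^sup>2))" for t
    proof -
      have "W (Z + t *\<^sub>R g) \<le> W Z + G Z \<bullet> (t *\<^sub>R g) + \<bar>K\<bar> * (norm (t *\<^sub>R g))\<^sup>2"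
        using W4[of "Z + t *\<^sub>R g" Z] mult_right_mono[OF abs_ge_self[of K], of "(norm (t *\<^sub>R g))\<^sup>2"] by simp
      then have "(q - G Z) \<bullet> (t *\<^sub>R g) \<le> (\<bar>K\<bar> + 1 / (2 * \<epsilon>)) * (norm (t *\<^sub>R g))\<^sup>2"
        using touch[of "t *\<^sub>R g"] by (simp add: inner_diff_left distrib_right right_diff_distrib)
      moreover have "(q - G Z) \<bullet> (t *\<^sub>R g) = t * (norm g)\<^sup>2" "(norm (t *\<^sub>R g))\<^sup>2 = t * (t * (norm g)\<^sup>2)"
        unfolding power2_norm_eq_inner g_def by simp_all
      ultimately have "t * (norm g)\<^sup>2 \<le> (\<bar>K\<bar> + 1 / (2 * \<epsilon>)) * (t * (t * (norm g)\<^sup>2))" by (simp only:)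
      then show ?thesis by (simp only: mult_ac)
    qed
    \<comment> \<open>For a step this short the first-order excess outweighs the quadratic
      error.\<close>
    from this[of "1 / (2 * (\<bar>K\<bar> + 1 / (2 * \<epsilon>)))"] show False
    proof -
      define B where "B = \<bar>K\<bar> + 1 / (2 * \<epsilon>)"
      assume "1 / (2 * (\<bar>K\<bar> + 1 / (2 * \<epsilon>))) * (norm g)\<^sup>2 \<le> 1 / (2 * (\<bar>K\<bar> + 1 / (2 * \<epsilon>))) * (1 / (2 * (\<bar>K\<bar> + 1 / (2 * \<epsilon>))) * ((\<bar>K\<bar> + 1 / (2 * \<epsilon>)) * (norm g)\<^sup>2))"
      then have *: "1 / (2 * B) * (norm g)\<^sup>2 \<le> 1 / (2 * B) * (1 / (2 * B) * (B * (norm g)\<^sup>2))" by (simp only: B_def)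
      have "B > 0" using e by (auto simp: B_def intro: add_nonneg_pos)
      then have "(norm g)\<^sup>2 \<le> (norm g)\<^sup>2 / 2" using * by (simp add: field_simps)
      then show False using g by simp
    qed
  qed
  have Xlow: "- (norm f)\<^sup>2 / \<epsilon> \<le> f \<bullet> X f" for f
  proof (rule ccontr)
    assume "\<not> ?thesis"
    then have lt: "f \<bullet> X f + (norm f)\<^sup>2 / \<epsilon> < 0" by simp
    then have f0: "f \<noteq> 0" by (auto simp: X.zero)
    \<comment> \<open>With this \<open>\<eta>\<close> the expansion permits an error of a quarter of
      the violation, while the touching paraboloid demands half of it.\<close>
    define \<eta> where "\<eta> = - (f \<bullet> X f + (norm f)\<^sup>2 / \<epsilon>) / (4 * (norm f)\<^sup>2)"
    have "\<eta> > 0" using lt f0 by (simp add: \<eta>_def divide_neg_pos)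
    then obtain d where d: "d > 0" "\<And>h. norm h < d \<Longrightarrow> \<bar>W (Z + h) - W Z - G Z \<bullet> h - (h \<bullet> X h) / 2\<bar> \<le> \<eta> * (norm h)\<^sup>2"
      using exp by blast
    define t where "t = d / (2 * norm f)"
    have t: "t > 0" "norm (t *\<^sub>R f) < d" using d f0 by (auto simp: t_def)
    have "- (norm (t *\<^sub>R f))\<^sup>2 / (2 * \<epsilon>) - (t *\<^sub>R f \<bullet> X (t *\<^sub>R f)) / 2 \<le> \<eta> * (norm (t *\<^sub>R f))\<^sup>2"
      using d(2)[OF t(2)] touch[of "t *\<^sub>R f"] unfolding Gq by simp
    then have "t\<^sup>2 * (- (norm f)\<^sup>2 / (2 * \<epsilon>) - (f \<bullet> X f) / 2) \<le> t\<^sup>2 * (\<eta> * (norm f)\<^sup>2)"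
      by (simp add: X.scale power_mult_distrib power2_eq_square[of t] algebra_simps)
    then have "- (norm f)\<^sup>2 / (2 * \<epsilon>) - (f \<bullet> X f) / 2 \<le> \<eta> * (norm f)\<^sup>2"
      using t(1) by (simp only: mult_le_cancel_left_pos zero_less_power)
    also have "\<dots> = - (f \<bullet> X f + (norm f)\<^sup>2 / \<epsilon>) / 4" using f0 by (simp add: \<eta>_def)
    finally show False using lt by simp
  qed
  show thesis
  proof (rule that[OF p xS])
    show "u x' - v y' - (norm (x' - y'))\<^sup>2 / (4 * \<epsilon>) - (p \<bullet> (x' + y')) / 2
      \<le> u x - v y - (norm (x - y))\<^sup>2 / (4 * \<epsilon>) - (p \<bullet> (x + y)) / 2" if "x' \<in> S" "y' \<in> S" for x' y'
      using max[OF that, of p] by (simp add: \<Phi>_def x_def y_def)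
    fix \<eta> :: real assume "\<eta> > 0"
    \<comment> \<open>An expansion error \<open>\<kappa> * (norm h)\<^sup>2\<close> costs
      \<open>2 * \<kappa>\<close> in a Hessian, which enters with the factor 1/2. It is paid once
      for \<open>u\<close> and once for \<open>v\<close>.\<close>
    define \<kappa> where "\<kappa> = \<eta> / 4"
    have \<kappa>: "\<kappa> > 0" "2 * \<kappa> > 0" "\<eta> = 2 * \<kappa> + 2 * \<kappa>" using \<open>\<eta> > 0\<close> by (auto simp: \<kappa>_def)
    obtain X1 T where X1: "linear X1" "linear T" "\<And>a b. X1 a \<bullet> b = a \<bullet> X1 b"
      "\<And>e. e \<bullet> X1 e = T e \<bullet> X (T e) + (2 * \<kappa>) * (norm (T e))\<^sup>2 + (norm (e - T e))\<^sup>2 / \<epsilon>"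
      "\<And>e f. e \<bullet> X1 e \<le> f \<bullet> X f + (2 * \<kappa>) * (norm f)\<^sup>2 + (norm (e - f))\<^sup>2 / \<epsilon>"
      using quadratic_partial_minimum[OF X Xsym Xlow e \<kappa>(2)] by blast
    \<comment> \<open>For \<open>v\<close> the point where \<open>W\<close> is evaluated moves
      rigidly with \<open>y'\<close>, so the Hessian of \<open>W\<close> is inherited up to the
      error. For \<open>u\<close> it moves by the optimal \<open>T h\<close> instead.\<close>
    define Y1 where "Y1 h = X h - (2 * \<kappa>) *\<^sub>R h" for h
    have Y1: "linear Y1" unfolding Y1_def by (intro linear_compose_sub X linear_compose_scale_right linear_id[unfolded id_def])
    have Y1q: "h \<bullet> Y1 h = h \<bullet> X h - (2 * \<kappa>) * (norm h)\<^sup>2" for h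
      by (simp add: Y1_def inner_diff_right power2_norm_eq_inner)
    obtain d where d: "d > 0" "\<And>h. norm h < d \<Longrightarrow> \<bar>W (Z + h) - W Z - q \<bullet> h - (h \<bullet> X h) / 2\<bar> \<le> \<kappa> * (norm h)\<^sup>2"
      using exp[OF \<kappa>(1)] unfolding Gq by blast
    have "\<forall>\<^sub>F x' in nhds x. norm (T (x' - x)) < d"
    proof -
      have "continuous (at x) (\<lambda>x'. norm (T (x' - x)))"
        using linear_continuous_at[OF linear_conv_bounded_linear[THEN iffD1, OF X1(2)]]
        by (intro continuous_intros continuous_at_compose[unfolded o_def, of x "\<lambda>x'. x' - x" T]) auto
      then have "((\<lambda>x'. norm (T (x' - x))) \<longlongrightarrow> norm (T (x - x))) (nhds x)"
        unfolding continuous_at using tendsto_at_iff_tendsto_nhds[of "\<lambda>x'. norm (T (x' - x))" x] by blast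
      then show ?thesis using d(1) by (auto simp: linear_0[OF X1(2)] dest: order_tendstoD(2)[of _ _ _ d])
    qed
    then have u_test: "\<forall>\<^sub>F x' in nhds x. x' \<in> S \<longrightarrow> u x' \<le> u x + q \<bullet> (x' - x) + ((x' - x) \<bullet> X1 (x' - x)) / 2"
    proof eventually_elim
      case (elim x')
      show ?case
      proof
        assume x': "x' \<in> S"
        define h where "h = x' - x"
        have eq1: "x' - (Z + T h) = (x - Z) - (T h - h)" by (simp add: h_def)
        have ip: "(x - Z) \<bullet> (T h - h) = - (\<epsilon> * (q \<bullet> (h - T h)))"
          by (simp add: xZ inner_diff_right algebra_simps)
        have "(norm (x' - (Z + T h)))\<^sup>2 = (norm (x - Z))\<^sup>2 + 2 * \<epsilon> * (q \<bullet> (h - T h)) + (norm (h - T h))\<^sup>2"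
          unfolding eq1 norm_diff_sq[of "x - Z" "T h - h"] ip by (simp add: norm_minus_commute[of "T h"])
        then have "(norm (x' - (Z + T h)))\<^sup>2 / (2 * \<epsilon>) = (norm (x - Z))\<^sup>2 / (2 * \<epsilon>) + q \<bullet> (h - T h) + (norm (h - T h))\<^sup>2 / (2 * \<epsilon>)"
          using e by (simp add: field_simps)
        then have "u x' \<le> W (Z + T h) + (norm (x - Z))\<^sup>2 / (2 * \<epsilon>) + q \<bullet> (h - T h) + ((norm (h - T h))\<^sup>2 / \<epsilon>) / 2"
          using W1[OF x', of "Z + T h"] by simp
        moreover have "W (Z + T h) \<le> W Z + q \<bullet> T h + (T h \<bullet> X (T h)) / 2 + \<kappa> * (norm (T h))\<^sup>2"
          using d(2)[of "T h"] elim by (simp add: h_def)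
        ultimately have "u x' \<le> u x + q \<bullet> h + (h \<bullet> X1 h) / 2"
          unfolding X1(4) using WZ(1) by (simp add: inner_diff_right add_divide_distrib)
        then show "u x' \<le> u x + q \<bullet> (x' - x) + ((x' - x) \<bullet> X1 (x' - x)) / 2" by (simp add: h_def)
      qed
    qed
    have "\<forall>\<^sub>F y' in nhds y. dist y' y < d" using d(1) by (auto simp: eventually_nhds_metric)
    then have v_test: "\<forall>\<^sub>F y' in nhds y. y' \<in> S \<longrightarrow> v y' \<ge> v y + (q - p) \<bullet> (y' - y) + ((y' - y) \<bullet> Y1 (y' - y)) / 2"
    proof eventually_elim
      case (elim y')
      show ?case
      proof
        assume y': "y' \<in> S"
        define h where "h = y' - y"
        have eq: "y' - (Z + h) = y - Z" by (simp add: h_def)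
        have "W (Z + h) \<le> v y' + (norm (y - Z))\<^sup>2 / (2 * \<epsilon>) + (c + \<epsilon> / 4 * (p \<bullet> p)) + p \<bullet> (Z + h)"
          using W5[OF y', of "Z + h"] unfolding eq .
        moreover have "W (Z + h) \<ge> W Z + q \<bullet> h + (h \<bullet> X h) / 2 - \<kappa> * (norm h)\<^sup>2"
          using d(2)[of h] elim by (simp add: h_def dist_norm)
        ultimately have "v y' \<ge> v y + (q - p) \<bullet> h + (h \<bullet> Y1 h) / 2"
          unfolding Y1q using WZ(2) by (simp add: inner_diff_left inner_add_right diff_divide_distrib)
        then show "v y' \<ge> v y + (q - p) \<bullet> (y' - y) + ((y' - y) \<bullet> Y1 (y' - y)) / 2" by (simp add: h_def)
      qed
    qed
    have qp: "q - p = (1 / (2 * \<epsilon>)) *\<^sub>R (x - y) - (1/2) *\<^sub>R p"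
    proof -
      have "(1/2) *\<^sub>R p + (1/2) *\<^sub>R p = p" by (simp add: scaleR_left_distrib[symmetric])
      then show ?thesis by (simp add: q_def algebra_simps)
    qed
    have ineq: "e \<bullet> X1 e - f \<bullet> Y1 f \<le> (norm (e - f))\<^sup>2 / \<epsilon> + \<eta> * (norm f)\<^sup>2" for e f
      using X1(5)[of e f] unfolding Y1q \<kappa>(3) distrib_right by linarith
    have Y1sym: "Y1 a \<bullet> b = a \<bullet> Y1 b" for a b
      using Xsym[of a b] by (simp add: Y1_def inner_diff_left inner_diff_right)
    show "\<exists>X Y. linear X \<and> linear Y \<and> (\<forall>a b. X a \<bullet> b = a \<bullet> X b) \<and> (\<forall>a b. Y a \<bullet> b = a \<bullet> Y b) \<and>
      (\<forall>e f. e \<bullet> X e - f \<bullet> Y f \<le> (norm (e - f))\<^sup>2 / \<epsilon> + \<eta> * (norm f)\<^sup>2) \<and>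
      (\<forall>\<^sub>F x' in nhds x. x' \<in> S \<longrightarrow> u x' \<le> u x + ((1 / (2 * \<epsilon>)) *\<^sub>R (x - y) + (1/2) *\<^sub>R p) \<bullet> (x' - x) + ((x' - x) \<bullet> X (x' - x)) / 2) \<and>
      (\<forall>\<^sub>F y' in nhds y. y' \<in> S \<longrightarrow> v y' \<ge> v y + ((1 / (2 * \<epsilon>)) *\<^sub>R (x - y) - (1/2) *\<^sub>R p) \<bullet> (y' - y) + ((y' - y) \<bullet> Y (y' - y)) / 2)"
      using X1(1,3) Y1 Y1sym ineq u_test v_test unfolding q_def[symmetric] qp[symmetric] by blast
  qed
qed

section \<open>Quadratic test functions\<close>

lemma Ck_on_const:
  fixes S :: "(real^'d) set"
  shows "Ck_on k S (\<lambda>x. c)"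
proof (induction k arbitrary: c)
  case (Suc k)
  have "grad (\<lambda>x. c) = (\<lambda>x::real^'d. 0)" by (rule ext, rule grad_eq_gderiv, rule GDERIV_const)
  then show ?case using Suc by simp
qed simp

lemma has_derivative_quadratic:
  fixes X :: "'a::euclidean_space \<Rightarrow> 'a"
  assumes "linear X" "\<And>a b. X a \<bullet> b = a \<bullet> X b"
  shows "((\<lambda>x. c + b \<bullet> (x - y) + ((x - y) \<bullet> X (x - y)) / 2) has_derivative (\<lambda>h. h \<bullet> (b + X (x - y)))) (at x)"
proof -
  have X: "bounded_linear X" using assms(1) by (rule linear_conv_bounded_linear[THEN iffD1])
  have "((\<lambda>x. X (x - y)) has_derivative X) (at x)"
    by (rule bounded_linear.has_derivative[OF X]) (auto intro!: derivative_eq_intros)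
  then have "((\<lambda>x. c + b \<bullet> (x - y) + ((x - y) \<bullet> X (x - y)) / 2) has_derivative
      (\<lambda>h. b \<bullet> h + ((x - y) \<bullet> X h + h \<bullet> X (x - y)) / 2)) (at x)"
    by (auto intro!: derivative_eq_intros)
  moreover have "b \<bullet> h + ((x - y) \<bullet> X h + h \<bullet> X (x - y)) / 2 = h \<bullet> (b + X (x - y))" for h
    using assms(2)[of "x - y" h] by (simp add: inner_commute inner_add_right)
  ultimately show ?thesis by simp
qed

lemma grad_quadratic:
  fixes X :: "real^'d \<Rightarrow> real^'d"
  assumes "linear X" "\<And>a b. X a \<bullet> b = a \<bullet> X b"
  shows "grad (\<lambda>x. c + b \<bullet> (x - y) + ((x - y) \<bullet> X (x - y)) / 2) = (\<lambda>x. b + X (x - y))"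
  by (rule ext, rule grad_eq_gderiv) (use has_derivative_quadratic[OF assms] in \<open>simp add: gderiv_def\<close>)

lemma Ck_on_affine:
  fixes b :: "real^'d"
  shows "Ck_on k UNIV (\<lambda>x. c + b \<bullet> (x - y))"
proof (cases k)
  case 0
  then show ?thesis by (auto intro!: continuous_intros)
next
  case (Suc k)
  \<comment> \<open>An affine function is treated as a quadratic with zero Hessian.\<close>
  have lin: "linear (\<lambda>x::real^'d. 0 :: real^'d)" by (rule module_hom_zero)
  have "grad (\<lambda>x. c + b \<bullet> (x - y)) = (\<lambda>x. b)"
    using grad_quadratic[OF lin, of c b y] by simp
  moreover have "(\<lambda>x. c + b \<bullet> (x - y)) differentiable (at x)" for x
    using has_derivative_quadratic[OF lin, of c b y x] by (auto simp: differentiable_def)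
  ultimately show ?thesis using Suc by (simp add: Ck_on_const)
qed

lemma smooth_near_quadratic:
  fixes X :: "real^'d \<Rightarrow> real^'d"
  assumes "linear X" "\<And>a b. X a \<bullet> b = a \<bullet> X b"
  shows "smooth_near (\<lambda>x. c + b \<bullet> (x - y) + ((x - y) \<bullet> X (x - y)) / 2) z"
proof -
  let ?f = "\<lambda>x. c + b \<bullet> (x - y) + ((x - y) \<bullet> X (x - y)) / 2"
  have diff: "?f differentiable (at x)" for x
    using has_derivative_quadratic[OF assms, of c b y x] unfolding differentiable_def by blast
  \<comment> \<open>Symmetry of \<open>X\<close> puts each partial derivative into the affine form
    of \<open>Ck_on_affine\<close>.\<close>
  have comp: "(b + X (x - y)) $ i = b $ i + X (axis i 1) \<bullet> (x - y)" for x i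
    by (simp add: assms(2) inner_axis' )
  have "Ck_on k UNIV ?f" for k
  proof (cases k)
    case 0
    have "continuous_on UNIV ?f"
      by (rule differentiable_imp_continuous_on) (simp add: diff differentiable_on_def)
    then show ?thesis using 0 by simp
  next
    case (Suc k)
    show ?thesis
      unfolding Suc Ck_on.simps grad_quadratic[OF assms] comp using diff Ck_on_affine by blast
  qed
  then show ?thesis unfolding smooth_near_def by blast
qed

lemma hess_quadratic:
  fixes X :: "real^'d \<Rightarrow> real^'d"
  assumes "linear X" "\<And>a b. X a \<bullet> b = a \<bullet> X b"
  shows "hess (\<lambda>x. c + b \<bullet> (x - y) + ((x - y) \<bullet> X (x - y)) / 2) z = matrix X"
proof -
  have "bounded_linear X" using assms(1) by (rule linear_conv_bounded_linear[THEN iffD1])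
  then have "((\<lambda>x. X (x - y)) has_derivative X) (at z)"
    by (rule bounded_linear.has_derivative) (auto intro!: derivative_eq_intros)
  then have "((\<lambda>x. b + X (x - y)) has_derivative X) (at z)"
    by (auto intro!: derivative_eq_intros)
  then have "frechet_derivative (\<lambda>x. b + X (x - y)) (at z) = X"
    by (rule frechet_derivative_at[symmetric])
  then show ?thesis by (simp add: hess_def grad_quadratic[OF assms] jacobian_def)
qed

text \<open>Splits the second-order term over the rows of \<sigma>, so that the inequality between
  the two jets can be applied row by row.\<close>

lemma trace_gram_mult_matrix:
  fixes X :: "real^'d \<Rightarrow> real^'d" and s :: "real^'d^'n"
  assumes "linear X"
  shows "trace ((c *\<^sub>R (transpose s ** s)) ** matrix X) = c * (\<Sum>k\<in>UNIV. (s $ k) \<bullet> X (s $ k))"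
proof -
  interpret linear X by (rule assms)
  have "trace ((c *\<^sub>R (transpose s ** s)) ** matrix X)
      = (\<Sum>i\<in>UNIV. \<Sum>j\<in>UNIV. \<Sum>k\<in>UNIV. c * (s $ k $ i * (s $ k $ j * X (axis i 1) $ j)))"
    by (simp add: trace_def matrix_matrix_mult_def transpose_def matrix_def sum_distrib_left sum_distrib_right mult.assoc)
  also have "\<dots> = (\<Sum>i\<in>UNIV. \<Sum>k\<in>UNIV. \<Sum>j\<in>UNIV. c * (s $ k $ i * (s $ k $ j * X (axis i 1) $ j)))"
    by (intro sum.cong refl sum.swap)
  also have "\<dots> = (\<Sum>k\<in>UNIV. \<Sum>i\<in>UNIV. \<Sum>j\<in>UNIV. c * (s $ k $ i * (s $ k $ j * X (axis i 1) $ j)))"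
    by (rule sum.swap)
  also have "\<dots> = (\<Sum>k\<in>UNIV. c * (\<Sum>i\<in>UNIV. s $ k $ i * (s $ k \<bullet> X (axis i 1))))"
    by (simp add: inner_vec_def sum_distrib_left)
  also have "\<dots> = (\<Sum>k\<in>UNIV. c * (s $ k \<bullet> X (\<Sum>i\<in>UNIV. (s $ k $ i) *\<^sub>R axis i 1)))"
    by (simp add: sum scale inner_sum_right)
  also have "\<dots> = (\<Sum>k\<in>UNIV. c * (s $ k \<bullet> X (s $ k)))"
    using basis_expansion[of "s $ k" for k] by (simp add: scalar_mult_eq_scaleR)
  finally show ?thesis by (simp add: sum_distrib_left)
qed

lemma visc_subsol_quadratic:
  assumes sub: "visc_subsol \<delta> A H U u" and A: "diffusion_coeff \<Lambda> \<sigma> A" and y: "y \<in> U"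
    and X: "linear X" "\<And>a b. X a \<bullet> b = a \<bullet> X b"
    and touch: "\<forall>\<^sub>F x in nhds y. u x \<le> u y + b \<bullet> (x - y) + ((x - y) \<bullet> X (x - y)) / 2"
  shows "\<delta> * u y - (\<Sum>k\<in>UNIV. (\<sigma> y $ k) \<bullet> X (\<sigma> y $ k)) / 2 + H b y \<le> 0"
proof -
  interpret X: linear X by (rule X)
  \<comment> \<open>The summand \<open>0\<close> matches the shape of the lemmas on
    quadratics.\<close>
  let ?\<phi> = "\<lambda>x. 0 + b \<bullet> (x - y) + ((x - y) \<bullet> X (x - y)) / 2"
  have "\<forall>\<^sub>F x in nhds y. u x - ?\<phi> x \<le> u y - ?\<phi> y"
    using touch by eventually_elim simp
  then have "\<delta> * u y - trace (A y ** hess ?\<phi> y) + H (grad ?\<phi> y) y \<le> 0"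
    using sub y smooth_near_quadratic[OF X, of 0 b y y] unfolding visc_subsol_def by blast
  moreover have "trace (A y ** hess ?\<phi> y) = (\<Sum>k\<in>UNIV. (\<sigma> y $ k) \<bullet> X (\<sigma> y $ k)) / 2"
    using A trace_gram_mult_matrix[OF X(1), of "1/2" "\<sigma> y"] hess_quadratic[OF X, of 0 b y y]
    by (simp add: diffusion_coeff_def)
  moreover have "grad ?\<phi> y = b" unfolding grad_quadratic[OF X] by (simp add: X.zero)
  ultimately show ?thesis by simp
qed

lemma visc_supersol_quadratic:
  assumes super: "visc_supersol \<delta> A H U v" and A: "diffusion_coeff \<Lambda> \<sigma> A" and y: "y \<in> U"
    and X: "linear X" "\<And>a b. X a \<bullet> b = a \<bullet> X b"
    and touch: "\<forall>\<^sub>F x in nhds y. v x \<ge> v y + b \<bullet> (x - y) + ((x - y) \<bullet> X (x - y)) / 2"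
  shows "\<delta> * v y - (\<Sum>k\<in>UNIV. (\<sigma> y $ k) \<bullet> X (\<sigma> y $ k)) / 2 + H b y \<ge> 0"
proof -
  interpret X: linear X by (rule X)
  let ?\<phi> = "\<lambda>x. 0 + b \<bullet> (x - y) + ((x - y) \<bullet> X (x - y)) / 2"
  have "\<forall>\<^sub>F x in nhds y. v x - ?\<phi> x \<ge> v y - ?\<phi> y"
    using touch by eventually_elim simp
  then have "\<delta> * v y - trace (A y ** hess ?\<phi> y) + H (grad ?\<phi> y) y \<ge> 0"
    using super y smooth_near_quadratic[OF X, of 0 b y y] unfolding visc_supersol_def by blast
  moreover have "trace (A y ** hess ?\<phi> y) = (\<Sum>k\<in>UNIV. (\<sigma> y $ k) \<bullet> X (\<sigma> y $ k)) / 2"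
    using A trace_gram_mult_matrix[OF X(1), of "1/2" "\<sigma> y"] hess_quadratic[OF X, of 0 b y y]
    by (simp add: diffusion_coeff_def)
  moreover have "grad ?\<phi> y = b" unfolding grad_quadratic[OF X] by (simp add: X.zero)
  ultimately show ?thesis by simp
qed

lemma norm_matrix_sq: "(norm (s :: real^'d^'n))\<^sup>2 = (\<Sum>k\<in>UNIV. (norm (s $ k))\<^sup>2)"
  by (simp add: norm_vec_def L2_set_def sum_nonneg)

section \<open>Comparison\<close>

definition japanese_bracket :: "'a::real_normed_vector \<Rightarrow> real" where
  "japanese_bracket x = sqrt (1 + (norm x)\<^sup>2)"

lemma japanese_bracket_sq: "(japanese_bracket x)\<^sup>2 = 1 + (norm x)\<^sup>2"
  by (simp add: japanese_bracket_def)

lemma japanese_bracket_ge: "1 \<le> japanese_bracket x" "norm x \<le> japanese_bracket x"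
  unfolding japanese_bracket_def by (simp, rule real_le_rsqrt, simp)

lemma continuous_on_japanese_bracket: "continuous_on S japanese_bracket"
  unfolding japanese_bracket_def[abs_def] by (intro continuous_intros)

text \<open>The inequality 2ab \<le> a^2 + b^2 for the two brackets, divided by
  \<open>2 * japanese_bracket x\<close>: a global touching paraboloid without computing second
  derivatives.\<close>

lemma japanese_bracket_quadratic_bound:
  fixes x y :: "'a::real_inner"
  shows "japanese_bracket y \<le> japanese_bracket x + ((1 / japanese_bracket x) *\<^sub>R x) \<bullet> (y - x) + (norm (y - x))\<^sup>2 / (2 * japanese_bracket x)"
proof -
  have pos: "japanese_bracket x > 0" using japanese_bracket_ge(1)[of x] by linarith
  have "2 * (japanese_bracket x * japanese_bracket y) \<le> (japanese_bracket x)\<^sup>2 + (japanese_bracket y)\<^sup>2"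
    using sum_squares_bound[of "japanese_bracket x" "japanese_bracket y"] by (simp add: mult.assoc)
  also have "\<dots> = 2 * (japanese_bracket x)\<^sup>2 + 2 * (x \<bullet> (y - x)) + (norm (y - x))\<^sup>2"
    by (simp add: japanese_bracket_sq power2_norm_eq_inner inner_diff_left inner_diff_right inner_commute)
  finally have "2 * (japanese_bracket x * japanese_bracket y) \<le> 2 * (japanese_bracket x)\<^sup>2 + 2 * (x \<bullet> (y - x)) + (norm (y - x))\<^sup>2" .
  then have "japanese_bracket y \<le> (2 * (japanese_bracket x)\<^sup>2 + 2 * (x \<bullet> (y - x)) + (norm (y - x))\<^sup>2) / (2 * japanese_bracket x)"
    using pos by (simp add: pos_le_divide_eq mult_ac)
  also have "\<dots> = japanese_bracket x + (x \<bullet> (y - x)) / japanese_bracket x + (norm (y - x))\<^sup>2 / (2 * japanese_bracket x)"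
    using pos by (simp add: add_divide_distrib power2_eq_square)
  finally show ?thesis by simp
qed

lemma powr_add_one_le: "(s + 1) powr m \<le> 2 powr m * (s powr m + 1)" if "0 \<le> s" "0 \<le> m" for s m :: real
proof -
  have "(s + 1) powr m \<le> (2 * max s 1) powr m"
    using that by (intro powr_mono2) auto
  also have "\<dots> = 2 powr m * (max s 1) powr m" using that by (simp add: powr_mult)
  also have "(max s 1) powr m \<le> s powr m + 1" by (auto simp: max_def)
  finally show ?thesis by simp
qed

text \<open>The Jensen gap of a convex function of growth \<open>m > 1\<close> is coercive: compare the chord from
  \<open>b\<close> to \<open>Q\<close> with the value at \<open>\<tau> Q + (1 - \<tau>) b\<close> for a small \<open>\<tau>\<close>, where superlinearity makes
  \<open>\<tau> h Q\<close> dominate.\<close>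

lemma jensen_gap_coercive:
  assumes m: "m > 1" and "\<Lambda> \<ge> 1" and a: "0 < a" and M: "1 \<le> M" and lam: "0 < lam" "lam < 1"
  obtains c C where "c > 0" "C \<ge> 0"
    "\<And>(h :: 'a::real_normed_vector \<Rightarrow> real) Q b. convex_on UNIV h \<Longrightarrow> (\<And>p. a * norm p powr m - M \<le> h p) \<Longrightarrow>
       (\<And>p. h p \<le> \<Lambda> * (norm p powr m + 1)) \<Longrightarrow> norm b \<le> 1 \<Longrightarrow>
       c * norm Q powr m - C \<le> lam * h Q + (1 - lam) * h b - h (lam *\<^sub>R Q + (1 - lam) *\<^sub>R b)"
proof -
  define g where "g = a / (2 * \<Lambda> * 2 powr m)"
  have g: "g > 0" using assms by (simp add: g_def)
  \<comment> \<open>Since m > 1, a small \<open>\<tau>\<close> satisfies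
    \<open>\<Lambda> * 2 powr m * \<tau> powr m \<le> \<tau> * a / 2\<close>, so the upper growth of
    \<open>h r\<close> eats at most half of the coercive term. The bound \<open>lam / 2\<close>
    keeps \<open>\<tau>\<close> below \<open>lam\<close>.\<close>
  define \<tau> where "\<tau> = min (lam / 2) (g powr (1 / (m - 1)))"
  have \<tau>: "0 < \<tau>" "\<tau> < lam" "\<tau> < 1" using lam g by (auto simp: \<tau>_def)
  have "\<tau> powr (m - 1) \<le> (g powr (1 / (m - 1))) powr (m - 1)"
    using \<tau> m by (intro powr_mono2) (auto simp: \<tau>_def)
  also have "\<dots> = g" using m g by (simp add: powr_powr)
  finally have "\<Lambda> * 2 powr m * \<tau> powr (m - 1) \<le> \<Lambda> * 2 powr m * g"
    using assms by (intro mult_left_mono) auto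
  also have "\<dots> = a / 2" using assms by (simp add: g_def)
  finally have "(\<Lambda> * 2 powr m * \<tau> powr (m - 1)) * \<tau> \<le> a / 2 * \<tau>"
    using \<tau> by (intro mult_right_mono) auto
  moreover have "\<tau> powr (m - 1) * \<tau> = \<tau> powr m" using \<tau> by (simp add: powr_mult_base mult.commute)
  ultimately have "\<Lambda> * 2 powr m * \<tau> powr m \<le> a / 2 * \<tau>" by (simp only: mult.assoc)
  then have tau_m: "\<Lambda> * 2 powr m * \<tau> powr m \<le> \<tau> * a / 2" by (simp add: mult.commute)
  \<comment> \<open>The point with weight \<open>lam\<close> on \<open>Q\<close> lies between
    \<open>Q\<close> and the point \<open>r\<close> with weight \<open>\<tau>\<close>, with weight
    \<open>\<theta>\<close> on \<open>r\<close>. Hence the gap at \<open>lam\<close> is at least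
    \<open>\<theta>\<close> times the gap at \<open>\<tau>\<close>.\<close>
  define \<theta> where "\<theta> = (1 - lam) / (1 - \<tau>)"
  have \<theta>: "0 < \<theta>" "\<theta> < 1" using \<tau> lam by (auto simp: \<theta>_def)
  have \<theta>_eq: "\<theta> * (1 - \<tau>) = 1 - lam" using \<tau> by (simp add: \<theta>_def)
  \<comment> \<open>All constants are fixed before \<open>h\<close>, because they must serve every
    function \<open>\<lambda>p. H p x\<close> with \<open>x\<close> in the ball.\<close>
  define C where "C = M + \<Lambda> * 2 powr m + \<Lambda>"
  show thesis
  proof (rule that)
    show "\<theta> * (\<tau> * a / 2) > 0" "\<theta> * C \<ge> 0" using \<theta> \<tau> assms by (auto simp: C_def)
    fix h :: "'a \<Rightarrow> real" and Q b :: 'a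
    assume conv: "convex_on UNIV h" and low: "\<And>p. a * norm p powr m - M \<le> h p"
      and up: "\<And>p. h p \<le> \<Lambda> * (norm p powr m + 1)" and b: "norm b \<le> 1"
    define r where "r = \<tau> *\<^sub>R Q + (1 - \<tau>) *\<^sub>R b"
    have q_eq: "lam *\<^sub>R Q + (1 - lam) *\<^sub>R b = (1 - \<theta>) *\<^sub>R Q + \<theta> *\<^sub>R r"
    proof -
      have "(1 - \<theta>) + \<theta> * \<tau> = lam" using \<theta>_eq by (simp add: algebra_simps)
      then have "(1 - \<theta>) *\<^sub>R Q + \<theta> *\<^sub>R r = lam *\<^sub>R Q + (\<theta> * (1 - \<tau>)) *\<^sub>R b"
        by (simp add: r_def scaleR_add_right) (metis add.assoc scaleR_left_distrib)
      then show ?thesis by (simp add: \<theta>_eq)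
    qed
    have "h (lam *\<^sub>R Q + (1 - lam) *\<^sub>R b) \<le> (1 - \<theta>) * h Q + \<theta> * h r"
      unfolding q_eq using convex_onD[OF conv, of \<theta> Q r] \<theta> by simp
    moreover have "lam * h Q + (1 - lam) * h b - ((1 - \<theta>) * h Q + \<theta> * h r) = \<theta> * (\<tau> * h Q + (1 - \<tau>) * h b - h r)"
    proof -
      have lam_eq: "lam = (1 - \<theta>) + \<theta> * \<tau>" using \<theta>_eq by (simp add: algebra_simps)
      show ?thesis unfolding lam_eq by (simp add: algebra_simps)
    qed
    moreover have "\<theta> * (\<tau> * a / 2 * norm Q powr m - C) \<le> \<theta> * (\<tau> * h Q + (1 - \<tau>) * h b - h r)"
    proof (rule mult_left_mono)
      have "norm r \<le> \<tau> * norm Q + 1"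
      proof -
        have "norm r \<le> \<tau> * norm Q + (1 - \<tau>) * norm b"
          unfolding r_def using norm_triangle_ineq[of "\<tau> *\<^sub>R Q" "(1 - \<tau>) *\<^sub>R b"] \<tau> by simp
        also have "(1 - \<tau>) * norm b \<le> 1" using b \<tau> by (intro mult_le_one) auto
        finally show ?thesis by simp
      qed
      then have "norm r powr m \<le> (\<tau> * norm Q + 1) powr m" using m by (intro powr_mono2) auto
      also have "\<dots> \<le> 2 powr m * ((\<tau> * norm Q) powr m + 1)"
        using \<tau> m by (intro powr_add_one_le) auto
      also have "\<dots> = 2 powr m * \<tau> powr m * norm Q powr m + 2 powr m"
        using \<tau> by (simp add: powr_mult algebra_simps)
      finally have "\<Lambda> * (norm r powr m + 1) \<le> \<Lambda> * (2 powr m * \<tau> powr m * norm Q powr m + 2 powr m + 1)"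
        using assms(2) by (intro mult_left_mono) auto
      also have "\<dots> = (\<Lambda> * 2 powr m * \<tau> powr m) * norm Q powr m + \<Lambda> * 2 powr m + \<Lambda>"
        by (simp add: algebra_simps)
      also have "\<dots> \<le> (\<tau> * a / 2) * norm Q powr m + \<Lambda> * 2 powr m + \<Lambda>"
        using tau_m by (intro add_mono mult_right_mono) auto
      finally have "h r \<le> (\<tau> * a / 2) * norm Q powr m + \<Lambda> * 2 powr m + \<Lambda>" using up[of r] by linarith
      moreover have "\<tau> * (a * norm Q powr m - M) \<le> \<tau> * h Q" using low \<tau> by (intro mult_left_mono) auto
      moreover have "(1 - \<tau>) * (- M) \<le> (1 - \<tau>) * h b"
      proof -
        have "0 \<le> a * norm b powr m" using a by simp
        then have "- M \<le> h b" using low[of b] by linarith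
        then show ?thesis using \<tau> by (intro mult_left_mono) auto
      qed
      ultimately show "\<tau> * a / 2 * norm Q powr m - C \<le> \<tau> * h Q + (1 - \<tau>) * h b - h r"
        by (simp add: C_def algebra_simps)
    qed (use \<theta> in auto)
    ultimately show "\<theta> * (\<tau> * a / 2) * norm Q powr m - \<theta> * C \<le> lam * h Q + (1 - lam) * h b - h (lam *\<^sub>R Q + (1 - lam) *\<^sub>R b)"
      by (simp add: right_diff_distrib mult.assoc)
  qed
qed

section \<open>The perturbed subsolution\<close>

lemma hamiltonian_upper:
  assumes "hamiltonian m \<Lambda> H"
  shows "H p x \<le> \<Lambda> * (norm p powr m + 1)"
proof -
  have "norm x + 1 > 0" by (smt (verit) norm_ge_zero)
  moreover have "x \<in> ball 0 (norm x + 1)" by simp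
  ultimately show ?thesis using assms unfolding hamiltonian_def by blast
qed

text \<open>Adding the weight back turns a jet of the perturbed function into a jet of
  \<open>u\<close>. Then \<open>lam\<close> times the inequality for \<open>u\<close> is added to
  \<open>1 - lam\<close> times the one for \<open>- (japanese_bracket x + K)\<close>, a subsolution
  by the choice of \<open>K\<close>. The combination of \<open>H Q x\<close> and
  \<open>H b x\<close> is kept as it stands: bounding it by convexity here would throw the Jensen
  gap away.\<close>

lemma perturbed_subsol:
  fixes H :: "real^'d \<Rightarrow> real^'d \<Rightarrow> real" and \<sigma> :: "real^'d \<Rightarrow> real^'d^'n"
  assumes sub: "visc_subsol \<delta> A H U u" and A: "diffusion_coeff \<Lambda>2 \<sigma> A" and H: "hamiltonian m \<Lambda>1 H"
    and m: "m > 1" and \<Lambda>1: "\<Lambda>1 \<ge> 1" and \<delta>: "\<delta> > 0" and lam: "0 < lam" "lam < 1"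
    and K: "\<Lambda>2\<^sup>2 / 2 + 2 * \<Lambda>1 \<le> \<delta> * K" and x: "x \<in> U"
    and X: "linear X" "\<And>a b. X a \<bullet> b = a \<bullet> X b"
    and touch: "\<forall>\<^sub>F z in nhds x. lam * u z - (1 - lam) * (japanese_bracket z + K)
        \<le> lam * u x - (1 - lam) * (japanese_bracket x + K) + q \<bullet> (z - x) + ((z - x) \<bullet> X (z - x)) / 2"
  obtains Q b where "norm b \<le> 1" "q = lam *\<^sub>R Q + (1 - lam) *\<^sub>R b"
    "\<delta> * (lam * u x - (1 - lam) * (japanese_bracket x + K)) - (\<Sum>k\<in>UNIV. (\<sigma> x $ k) \<bullet> X (\<sigma> x $ k)) / 2
      + lam * H Q x + (1 - lam) * H b x \<le> 0"
proof -
  define j where "j = japanese_bracket x"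
  have j: "j \<ge> 1" "norm x \<le> j" using japanese_bracket_ge[of x] by (simp_all add: j_def)
  \<comment> \<open>The gradient of minus the weight. Its norm is at most 1, which bounds
    \<open>H b x\<close> by \<open>2 * \<Lambda>1\<close>.\<close>
  define b where "b = - (1 / j) *\<^sub>R x"
  define Q where "Q = (1 / lam) *\<^sub>R (q - (1 - lam) *\<^sub>R b)"
  define Y where "Y h = (1 / lam) *\<^sub>R (X h + ((1 - lam) / j) *\<^sub>R h)" for h
  have b: "norm b \<le> 1" using j by (simp add: b_def field_simps)
  have q: "q = lam *\<^sub>R Q + (1 - lam) *\<^sub>R b" using lam by (simp add: Q_def)
  have Y: "linear Y"
    unfolding Y_def by (intro linear_compose_scale_right linear_compose_add X linear_id[unfolded id_def])
  have Ysym: "Y a \<bullet> c = a \<bullet> Y c" for a c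
    using X(2)[of a c] by (simp add: Y_def inner_add_left inner_add_right)
  have Yq: "lam * (h \<bullet> Y h) = h \<bullet> X h + (1 - lam) / j * (norm h)\<^sup>2" for h
    using lam by (simp add: Y_def inner_add_right power2_norm_eq_inner)
  have "\<forall>\<^sub>F z in nhds x. u z \<le> u x + Q \<bullet> (z - x) + ((z - x) \<bullet> Y (z - x)) / 2"
    using touch
  proof eventually_elim
    case (elim z)
    have "japanese_bracket z \<le> j + - (b \<bullet> (z - x)) + (norm (z - x))\<^sup>2 / (2 * j)"
      using japanese_bracket_quadratic_bound[of z x] by (simp add: j_def b_def)
    then have "(1 - lam) * japanese_bracket z \<le> (1 - lam) * (j + - (b \<bullet> (z - x)) + (norm (z - x))\<^sup>2 / (2 * j))"
      using lam by (intro mult_left_mono) auto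
    moreover have "q \<bullet> (z - x) = lam * (Q \<bullet> (z - x)) + (1 - lam) * (b \<bullet> (z - x))"
      by (simp add: q inner_add_left)
    ultimately have "lam * u z \<le> lam * u x + lam * (Q \<bullet> (z - x)) + (lam * ((z - x) \<bullet> Y (z - x))) / 2"
      using elim unfolding Yq by (simp add: j_def[symmetric] algebra_simps add_divide_distrib diff_divide_distrib)
    then have "lam * u z \<le> lam * (u x + Q \<bullet> (z - x) + ((z - x) \<bullet> Y (z - x)) / 2)"
      by (simp add: algebra_simps)
    then show ?case using lam by simp
  qed
  then have "\<delta> * u x - (\<Sum>k\<in>UNIV. (\<sigma> x $ k) \<bullet> Y (\<sigma> x $ k)) / 2 + H Q x \<le> 0"
    by (rule visc_subsol_quadratic[OF sub A x Y Ysym])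
  then have "lam * (\<delta> * u x - (\<Sum>k\<in>UNIV. (\<sigma> x $ k) \<bullet> Y (\<sigma> x $ k)) / 2 + H Q x) \<le> 0"
    using lam by (simp add: mult_le_0_iff)
  moreover have "lam * (\<Sum>k\<in>UNIV. (\<sigma> x $ k) \<bullet> Y (\<sigma> x $ k)) = (\<Sum>k\<in>UNIV. (\<sigma> x $ k) \<bullet> X (\<sigma> x $ k)) + (1 - lam) / j * (norm (\<sigma> x))\<^sup>2"
    by (simp add: sum_distrib_left Yq norm_matrix_sq sum.distrib)
  moreover have "1 / j * (norm (\<sigma> x))\<^sup>2 \<le> \<Lambda>2\<^sup>2"
  proof -
    have "norm (\<sigma> x) \<le> \<Lambda>2" using A by (simp add: diffusion_coeff_def)
    then have "(norm (\<sigma> x))\<^sup>2 \<le> \<Lambda>2\<^sup>2" by (intro power_mono) auto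
    moreover have "1 / j * (norm (\<sigma> x))\<^sup>2 \<le> 1 * (norm (\<sigma> x))\<^sup>2"
      using j by (intro mult_right_mono) auto
    ultimately show ?thesis by linarith
  qed
  moreover have "H b x \<le> 2 * \<Lambda>1"
  proof -
    have "norm b powr m \<le> 1 powr m" using b m by (intro powr_mono2) auto
    then have "\<Lambda>1 * (norm b powr m + 1) \<le> \<Lambda>1 * 2" using \<Lambda>1 by (intro mult_left_mono) auto
    then show ?thesis using hamiltonian_upper[OF H, of b x] by linarith
  qed
  moreover have "0 \<le> \<delta> * j" using \<delta> j by simp
  ultimately have E: "lam * \<delta> * u x - ((\<Sum>k\<in>UNIV. (\<sigma> x $ k) \<bullet> X (\<sigma> x $ k)) + (1 - lam) * (1 / j * (norm (\<sigma> x))\<^sup>2)) / 2 + lam * H Q x \<le> 0"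
    and "(1 / j * (norm (\<sigma> x))\<^sup>2) / 2 + H b x - \<delta> * j - \<delta> * K \<le> 0"
    using K by (simp_all add: algebra_simps)
  then have "(1 - lam) * ((1 / j * (norm (\<sigma> x))\<^sup>2) / 2 + H b x - \<delta> * j - \<delta> * K) \<le> 0"
    using lam by (simp add: mult_le_0_iff)
  with E have "\<delta> * (lam * u x - (1 - lam) * (j + K)) - (\<Sum>k\<in>UNIV. (\<sigma> x $ k) \<bullet> X (\<sigma> x $ k)) / 2
      + lam * H Q x + (1 - lam) * H b x \<le> 0"
    by (simp add: algebra_simps add_divide_distrib diff_divide_distrib)
  then show thesis by (intro that[OF b q]) (simp add: j_def)
qed

text \<open>Upper bounds for \<open>u\<close> and \<open>- v\<close> on \<open>S\<close> keep the
  penalty bounded, so the two points merge. Upper semicontinuity then forces the limit point to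
  attain \<open>M\<close>, and no room is left for the penalty.\<close>

lemma doubling_limit:
  fixes u v :: "'a::euclidean_space \<Rightarrow> real"
  assumes S: "compact S" and u: "usc_on S u" and v: "usc_on S (\<lambda>x. - v x)"
    and xy: "\<And>n. x n \<in> S" "\<And>n. y n \<in> S"
    and M: "\<And>z. z \<in> S \<Longrightarrow> u z - v z \<le> M"
    and le: "\<And>n. M - \<beta> n \<le> u (x n) - v (y n) - a n * (norm (x n - y n))\<^sup>2"
    and \<beta>: "\<beta> \<longlonglongrightarrow> 0" and a: "filterlim a at_top sequentially"
  obtains r z where "strict_mono r" "z \<in> S" "(x \<circ> r) \<longlonglongrightarrow> z" "(y \<circ> r) \<longlonglongrightarrow> z" "u z - v z = M"
    "(\<lambda>n. a (r n) * (norm (x (r n) - y (r n)))\<^sup>2) \<longlonglongrightarrow> 0"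
proof -
  have ne: "S \<noteq> {}" using xy by auto
  obtain z1 where z1: "\<And>z. z \<in> S \<Longrightarrow> u z \<le> u z1" using usc_on_attains_sup[OF S ne u] by blast
  obtain z2 where z2: "\<And>z. z \<in> S \<Longrightarrow> - v z \<le> - v z2" using usc_on_attains_sup[OF S ne v] by blast
  obtain r z where rz: "z \<in> S" "strict_mono r" "(x \<circ> r) \<longlonglongrightarrow> z"
    using S xy(1) unfolding compact_def by blast
  have sub: "filterlim r at_top sequentially" by (rule filterlim_subseq[OF rz(2)])
  have \<beta>r: "(\<lambda>n. \<beta> (r n)) \<longlonglongrightarrow> 0" by (rule filterlim_compose[OF \<beta> sub])
  have ar: "filterlim (\<lambda>n. a (r n)) at_top sequentially" by (rule filterlim_compose[OF a sub])
  define B where "B = u z1 - v z2 - M"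
  have B: "a n * (norm (x n - y n))\<^sup>2 \<le> B + \<beta> n" for n
    using le[of n] z1[OF xy(1)[of n]] z2[OF xy(2)[of n]] by (simp add: B_def)
  have "(\<lambda>n. (norm (x (r n) - y (r n)))\<^sup>2) \<longlonglongrightarrow> 0"
  proof (rule real_tendsto_sandwich)
    show "\<forall>\<^sub>F n in sequentially. 0 \<le> (norm (x (r n) - y (r n)))\<^sup>2" by simp
    have "\<forall>\<^sub>F n in sequentially. 0 < a (r n)" using ar by (simp add: filterlim_at_top_dense)
    then show "\<forall>\<^sub>F n in sequentially. (norm (x (r n) - y (r n)))\<^sup>2 \<le> (B + \<beta> (r n)) * inverse (a (r n))"
    proof eventually_elim
      case (elim n)
      then show ?case using B[of "r n"] by (simp add: field_simps)
    qed
    have "(\<lambda>n. (B + \<beta> (r n)) * inverse (a (r n))) \<longlonglongrightarrow> (B + 0) * 0"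
      by (intro tendsto_intros \<beta>r tendsto_inverse_0_at_top ar)
    then show "(\<lambda>n. (B + \<beta> (r n)) * inverse (a (r n))) \<longlonglongrightarrow> 0" by simp
  qed simp
  then have "(\<lambda>n. sqrt ((norm (x (r n) - y (r n)))\<^sup>2)) \<longlonglongrightarrow> sqrt 0" by (intro tendsto_intros)
  then have xmy: "(\<lambda>n. x (r n) - y (r n)) \<longlonglongrightarrow> 0" by (simp add: tendsto_norm_zero_iff)
  have xr: "(\<lambda>n. x (r n)) \<longlonglongrightarrow> z" using rz(3) by (simp add: o_def)
  have yr: "(\<lambda>n. y (r n)) \<longlonglongrightarrow> z" using tendsto_diff[OF xr xmy] by simp
  have ev: "\<forall>\<^sub>F n in sequentially. u (x (r n)) - v (y (r n)) < u z - v z + e" if "e > 0" for e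
  proof -
    have "\<forall>\<^sub>F n in sequentially. u (x (r n)) < u z + e / 2"
      by (rule usc_LIMSEQ[OF u xr rz(1) xy(1)]) (use that in auto)
    moreover have "\<forall>\<^sub>F n in sequentially. - v (y (r n)) < - v z + e / 2"
      by (rule usc_LIMSEQ[OF v yr rz(1) xy(2)]) (use that in auto)
    ultimately show ?thesis by eventually_elim linarith
  qed
  have ar0: "\<forall>\<^sub>F n in sequentially. 0 < a (r n)" using ar by (simp add: filterlim_at_top_dense)
  have "M \<le> u z - v z"
  proof (rule field_le_epsilon)
    fix e :: real assume "e > 0"
    have \<beta>e: "\<forall>\<^sub>F n in sequentially. \<beta> (r n) < e / 2"
      using order_tendstoD(2)[OF \<beta>r, of "e / 2"] \<open>e > 0\<close> by simp
    have e2: "e / 2 > 0" using \<open>e > 0\<close> by simp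
    from \<beta>e ev[OF e2] ar0 have "\<forall>\<^sub>F n in sequentially. M \<le> u z - v z + e"
    proof (eventually_elim)
      case (elim n)
      have "0 \<le> a (r n) * (norm (x (r n) - y (r n)))\<^sup>2" using elim by simp
      then show ?case using elim le[of "r n"] by linarith
    qed
    then show "M \<le> u z - v z + e" by simp
  qed
  with M[OF rz(1)] have eq: "u z - v z = M" by simp
  have "(\<lambda>n. a (r n) * (norm (x (r n) - y (r n)))\<^sup>2) \<longlonglongrightarrow> 0"
  proof (rule order_tendstoI)
    fix e :: real assume "e < 0"
    show "\<forall>\<^sub>F n in sequentially. e < a (r n) * (norm (x (r n) - y (r n)))\<^sup>2"
      using ar0
    proof eventually_elim
      case (elim n)
      then have "0 \<le> a (r n) * (norm (x (r n) - y (r n)))\<^sup>2" by simp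
      then show ?case using \<open>e < 0\<close> by linarith
    qed
  next
    fix e :: real assume "0 < e"
    have \<beta>e: "\<forall>\<^sub>F n in sequentially. \<beta> (r n) < e / 2"
      using order_tendstoD(2)[OF \<beta>r, of "e / 2"] \<open>e > 0\<close> by simp
    have e2: "e / 2 > 0" using \<open>e > 0\<close> by simp
    from \<beta>e ev[OF e2] show "\<forall>\<^sub>F n in sequentially. a (r n) * (norm (x (r n) - y (r n)))\<^sup>2 < e"
    proof (eventually_elim)
      case (elim n)
      then show ?case using le[of "r n"] eq by linarith
    qed
  qed
  then show thesis using that[OF rz(2,1) rz(3) _ eq] yr by (simp add: o_def)
qed

text \<open>The growth condition handles the outside of a ball and compactness the inside. The
  halved slope makes up for \<open>1 + norm x \<le> 2 * japanese_bracket x\<close>.\<close>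

lemma growth_bound:
  fixes u :: "real^'d \<Rightarrow> real"
  assumes usc: "usc_on (closure U) u" and \<eta>: "\<eta> > 0"
    and ev: "\<forall>\<^sub>F x in inf at_infinity (principal U). u x / (1 + norm x) < \<eta> / 2"
  obtains K where "K \<ge> 0" "\<And>x. x \<in> U \<Longrightarrow> u x \<le> \<eta> * japanese_bracket x + K"
proof -
  obtain B where B: "\<And>x. x \<in> U \<Longrightarrow> B \<le> norm x \<Longrightarrow> u x / (1 + norm x) < \<eta> / 2"
    using ev unfolding eventually_inf_principal eventually_at_infinity by blast
  define T where "T = closure U \<inter> cball 0 B"
  have "\<exists>K\<ge>0. \<forall>x\<in>T. u x \<le> K"
  proof (cases "T = {}")
    case False
    have "compact T" unfolding T_def by (intro closed_Int_compact) auto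
    moreover have "usc_on T u" using usc by (rule usc_on_subset) (auto simp: T_def)
    ultimately obtain a where "\<And>x. x \<in> T \<Longrightarrow> u x \<le> u a"
      using usc_on_attains_sup[OF _ False] by blast
    then show ?thesis by (intro exI[of _ "max 0 (u a)"]) (auto simp: le_max_iff_disj)
  qed auto
  then obtain K where K: "K \<ge> 0" "\<And>x. x \<in> T \<Longrightarrow> u x \<le> K" by blast
  show thesis
  proof (rule that[OF K(1)])
    fix x assume x: "x \<in> U"
    have j: "1 + norm x \<le> 2 * japanese_bracket x" using japanese_bracket_ge[of x] by linarith
    have j0: "0 \<le> \<eta> * japanese_bracket x" using \<eta> japanese_bracket_ge(1)[of x] by simp
    show "u x \<le> \<eta> * japanese_bracket x + K"
    proof (cases "norm x \<le> B")
      case True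
      then have "x \<in> T" using x closure_subset by (auto simp: T_def)
      then show ?thesis using K(2)[of x] j0 by linarith
    next
      case False
      have "1 + norm x > 0" using norm_ge_zero[of x] by linarith
      then have "u x < \<eta> / 2 * (1 + norm x)" using B[OF x] False by (simp add: pos_divide_less_eq)
      also have "\<dots> \<le> \<eta> / 2 * (2 * japanese_bracket x)" using j \<eta> by (intro mult_left_mono) auto
      finally show ?thesis using K(1) by simp
    qed
  qed
qed

text \<open>Here \<open>lam\<close> is fixed. The bounds with \<open>K1\<close> serve only to
  localize and may depend on \<open>lam\<close>. \<open>K\<close> occurs in the conclusion and will
  be chosen independently of \<open>lam\<close>, since \<open>lam\<close> tends to 1 in the
  end.\<close>

lemma perturbed_comparison:
  fixes H :: "real^'d \<Rightarrow> real^'d \<Rightarrow> real" and \<sigma> :: "real^'d \<Rightarrow> real^'d^'n" and u v :: "real^'d \<Rightarrow> real"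
  assumes m: "m > 1" and \<Lambda>1: "\<Lambda>1 \<ge> 1" and \<Lambda>2: "\<Lambda>2 \<ge> 0"
    and A: "diffusion_coeff \<Lambda>2 \<sigma> A" and H: "hamiltonian m \<Lambda>1 H"
    and \<delta>: "\<delta> > 0" and U: "open U"
    and u: "usc_on (closure U) u" and v: "usc_on (closure U) (\<lambda>x. - v x)"
    and sub: "visc_subsol \<delta> A H U u" and super: "visc_supersol \<delta> A H U v"
    and fr: "\<And>x. x \<in> frontier U \<Longrightarrow> u x \<le> v x"
    and lam: "0 < lam" "lam < 1"
    and K: "\<Lambda>2\<^sup>2 / 2 + 2 * \<Lambda>1 \<le> \<delta> * K" and vK: "\<And>x. x \<in> U \<Longrightarrow> - (japanese_bracket x + K) \<le> v x"
    and K1: "K1 \<ge> 0" "\<And>x. x \<in> U \<Longrightarrow> u x \<le> (1 - lam) / 4 * japanese_bracket x + K1"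
      "\<And>x. x \<in> U \<Longrightarrow> - ((1 - lam) / 4 * japanese_bracket x + K1) \<le> v x"
    and x0: "x0 \<in> U"
  shows "lam * u x0 - (1 - lam) * (japanese_bracket x0 + K) \<le> v x0"
proof (rule ccontr)
  assume neg: "\<not> ?thesis"
  have K0: "K \<ge> 0"
  proof -
    have "0 \<le> \<delta> * K" using K \<Lambda>1 by (smt (verit) zero_le_power2 divide_nonneg_pos)
    then show ?thesis using \<delta> by (simp add: zero_le_mult_iff)
  qed
  define g where "g x = (1 - lam) / 4 * japanese_bracket x + K1" for x :: "real^'d"
  \<comment> \<open>The growth bounds hold in \<open>U\<close> only; at the frontier
    \<open>u\<close> may jump up and \<open>v\<close> may jump down. Truncation leaves the values in
    \<open>U\<close> alone, keeps semicontinuity, and extends the bounds to the frontier.\<close>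
  define ub where "ub x = lam * min (u x) (g x) + - ((1 - lam) * (japanese_bracket x + K))" for x
  define vb where "vb x = max (v x) (max (- g x) (- (japanese_bracket x + K)))" for x
  have uU: "ub x = lam * u x - (1 - lam) * (japanese_bracket x + K)" if "x \<in> U" for x
    using K1(2)[OF that] by (simp add: ub_def g_def)
  have vU: "vb x = v x" if "x \<in> U" for x
    using K1(3)[OF that] vK[OF that] by (simp add: vb_def g_def)
  have cg: "continuous_on T g" for T
    unfolding g_def[abs_def] by (intro continuous_intros continuous_on_japanese_bracket)
  have usc_u: "usc_on (closure U) ub"
    unfolding ub_def[abs_def]
    by (intro usc_on_add usc_on_cmult usc_on_min u lam continuous_on_imp_usc_on cg continuous_intros continuous_on_japanese_bracket)
  have usc_v: "usc_on (closure U) (\<lambda>x. - vb x)"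
  proof -
    have "usc_on (closure U) (\<lambda>x. min (- v x) (min (g x) (japanese_bracket x + K)))"
      by (intro usc_on_min v continuous_on_imp_usc_on cg continuous_intros continuous_on_japanese_bracket)
    moreover have "(\<lambda>x. min (- v x) (min (g x) (japanese_bracket x + K))) = (\<lambda>x. - vb x)"
      by (simp add: vb_def fun_eq_iff min_def max_def)
    ultimately show ?thesis by simp
  qed
  have fr_le: "ub x - vb x \<le> 0" if "x \<in> frontier U" for x
  proof -
    have "lam * min (u x) (g x) \<le> lam * vb x"
      using fr[OF that] lam by (intro mult_left_mono) (auto simp: vb_def)
    moreover have "(1 - lam) * (- vb x) \<le> (1 - lam) * (japanese_bracket x + K)"
      using lam by (intro mult_left_mono) (auto simp: vb_def)
    ultimately show ?thesis by (simp add: ub_def algebra_simps)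
  qed
  \<comment> \<open>On the sphere of radius \<open>R\<close> the weight times \<open>1 - lam\<close>
    is at least \<open>2 * g\<close>, so the difference is nonpositive there. The second entry puts
    \<open>x0\<close> inside the ball.\<close>
  define R where "R = max (4 * K1 / (1 - lam)) (norm x0 + 1)"
  have R: "R > 0" "norm x0 < R" "4 * K1 / (1 - lam) \<le> R"
    using norm_ge_zero[of x0] by (auto simp: R_def simp del: norm_ge_zero)
  have sphere_le: "ub x - vb x \<le> 0" if "norm x = R" for x
  proof -
    have "4 * K1 \<le> (1 - lam) * R" using R(3) lam by (simp add: field_simps)
    also have "\<dots> \<le> (1 - lam) * japanese_bracket x" using japanese_bracket_ge(2)[of x] that lam by (intro mult_left_mono) auto
    finally have 1: "4 * K1 \<le> (1 - lam) * japanese_bracket x" .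
    have "g x \<ge> 0" using K1(1) japanese_bracket_ge(1)[of x] lam by (simp add: g_def)
    then have "lam * min (u x) (g x) \<le> 1 * g x"
      using lam by (intro order_trans[OF mult_left_mono[of "min (u x) (g x)" "g x" lam]] mult_right_mono) auto
    moreover have "- g x \<le> vb x" by (simp add: vb_def)
    moreover have "0 \<le> (1 - lam) * K" using K0 lam by simp
    moreover have "2 * g x = (1 - lam) / 2 * japanese_bracket x + 2 * K1" by (simp add: g_def)
    ultimately show ?thesis using 1 by (simp add: ub_def distrib_left)
  qed
  define S where "S = closure U \<inter> cball 0 R"
  have S: "compact S" unfolding S_def by (intro closed_Int_compact) auto
  have x0S: "x0 \<in> S" using x0 R closure_subset[of U] by (auto simp: S_def)
  then have Sne: "S \<noteq> {}" by auto
  have SR: "norm x \<le> R" if "x \<in> S" for x using that by (simp add: S_def)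
  have u_S: "usc_on S ub" and v_S: "usc_on S (\<lambda>x. - vb x)"
    using usc_on_subset[OF usc_u] usc_on_subset[OF usc_v] by (auto simp: S_def)
  obtain zm where zm: "zm \<in> S" "\<And>z. z \<in> S \<Longrightarrow> ub z - vb z \<le> ub zm - vb zm"
    using usc_on_attains_sup[OF S Sne usc_on_add[OF u_S v_S]] by auto
  define \<mu> where "\<mu> = ub zm - vb zm"
  have \<mu>: "\<mu> > 0"
    using zm(2)[OF x0S] neg uU[OF x0] vU[OF x0] by (simp add: \<mu>_def)
  obtain a M where aM: "0 < a" "1 \<le> M" and HR: "\<And>p q x y. x \<in> ball 0 R \<Longrightarrow> y \<in> ball 0 R \<Longrightarrow>
           a * norm p powr m - M \<le> H p x \<and>
           H p x \<le> \<Lambda>1 * (norm p powr m + 1) \<and>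
           \<bar>H p x - H p y\<bar> \<le> (\<Lambda>1 * norm p powr m + M) * norm (x - y) \<and>
           \<bar>H p x - H q x\<bar> \<le> \<Lambda>1 * (norm p + norm q + 1) powr (m - 1) * norm (p - q)"
    using H R(1) unfolding hamiltonian_def by metis
  have conv: "convex_on UNIV (\<lambda>p. H p x)" for x using H by (simp add: hamiltonian_def)
  obtain c C where cC: "c > 0" "C \<ge> 0"
    and gap: "\<And>(h :: real^'d \<Rightarrow> real) Q b. convex_on UNIV h \<Longrightarrow> (\<And>p. a * norm p powr m - M \<le> h p) \<Longrightarrow>
       (\<And>p. h p \<le> \<Lambda>1 * (norm p powr m + 1)) \<Longrightarrow> norm b \<le> 1 \<Longrightarrow>
       c * norm Q powr m - C \<le> lam * h Q + (1 - lam) * h b - h (lam *\<^sub>R Q + (1 - lam) *\<^sub>R b)"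
    using jensen_gap_coercive[OF m \<Lambda>1 aM lam] by metis
  define E where "E n = 1 / (real n + 1)" for n
  have E: "E n > 0" "E n \<le> 1" for n by (simp_all add: E_def)
  \<comment> \<open>So small that changing the slope by \<open>p\<close> changes \<open>H\<close> by
    at most \<open>E n\<close>, although the slopes themselves may be of order
    \<open>R / E n\<close>.\<close>
  define r where "r n = min (E n) (E n / (\<Lambda>1 * (2 * R / E n + 2) powr (m - 1)))" for n
  have base: "2 * R / E n + 2 > 0" for n using R(1) E(1)[of n] by (simp add: add_pos_pos)
  have r: "r n > 0" for n using E(1)[of n] base[of n] \<Lambda>1 by (simp add: r_def)
  have r_le: "\<Lambda>1 * (2 * R / E n + 2) powr (m - 1) * t \<le> E n" if "t \<le> r n" for n t
  proof -
    have pos: "\<Lambda>1 * (2 * R / E n + 2) powr (m - 1) > 0" using base[of n] \<Lambda>1 by simp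
    have "t \<le> E n / (\<Lambda>1 * (2 * R / E n + 2) powr (m - 1))" using that by (simp add: r_def)
    then show ?thesis using pos by (simp add: pos_le_divide_eq mult.commute)
  qed
  \<comment> \<open>\<open>E n\<close> has two parts here: it is the doubling parameter and also the
    slack \<open>\<eta>\<close> of the theorem on sums.\<close>
  define jet where "jet n p x y \<longleftrightarrow>
    (\<exists>X Y. linear X \<and> linear Y \<and> (\<forall>a b. X a \<bullet> b = a \<bullet> X b) \<and> (\<forall>a b. Y a \<bullet> b = a \<bullet> Y b) \<and>
      (\<forall>e f. e \<bullet> X e - f \<bullet> Y f \<le> (norm (e - f))\<^sup>2 / E n + E n * (norm f)\<^sup>2) \<and>
      (\<forall>\<^sub>F x' in nhds x. x' \<in> S \<longrightarrow> ub x' \<le> ub x + ((1 / (2 * E n)) *\<^sub>R (x - y) + (1/2) *\<^sub>R p) \<bullet> (x' - x) + ((x' - x) \<bullet> X (x' - x)) / 2) \<and>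
      (\<forall>\<^sub>F y' in nhds y. y' \<in> S \<longrightarrow> vb y' \<ge> vb y + ((1 / (2 * E n)) *\<^sub>R (x - y) - (1/2) *\<^sub>R p) \<bullet> (y' - y) + ((y' - y) \<bullet> Y (y' - y)) / 2))" for n p x y
  define maxi where "maxi n p x y \<longleftrightarrow>
    (\<forall>x'\<in>S. \<forall>y'\<in>S. ub x' - vb y' - (norm (x' - y'))\<^sup>2 / (4 * E n) - (p \<bullet> (x' + y')) / 2
      \<le> ub x - vb y - (norm (x - y))\<^sup>2 / (4 * E n) - (p \<bullet> (x + y)) / 2)" for n p x y
  have "\<exists>p x y. norm p < r n \<and> x \<in> S \<and> y \<in> S \<and> maxi n p x y \<and> jet n p x y" for n
  proof -
    obtain p x y where *: "norm p < r n" "x \<in> S" "y \<in> S" and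
      **: "\<And>x' y'. x' \<in> S \<Longrightarrow> y' \<in> S \<Longrightarrow> ub x' - vb y' - (norm (x' - y'))\<^sup>2 / (4 * E n) - (p \<bullet> (x' + y')) / 2
      \<le> ub x - vb y - (norm (x - y))\<^sup>2 / (4 * E n) - (p \<bullet> (x + y)) / 2" and
      ***: "\<And>\<eta>. \<eta> > 0 \<Longrightarrow> \<exists>X Y. linear X \<and> linear Y \<and> (\<forall>a b. X a \<bullet> b = a \<bullet> X b) \<and> (\<forall>a b. Y a \<bullet> b = a \<bullet> Y b) \<and>
      (\<forall>e f. e \<bullet> X e - f \<bullet> Y f \<le> (norm (e - f))\<^sup>2 / E n + \<eta> * (norm f)\<^sup>2) \<and>
      (\<forall>\<^sub>F x' in nhds x. x' \<in> S \<longrightarrow> ub x' \<le> ub x + ((1 / (2 * E n)) *\<^sub>R (x - y) + (1/2) *\<^sub>R p) \<bullet> (x' - x) + ((x' - x) \<bullet> X (x' - x)) / 2) \<and>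
      (\<forall>\<^sub>F y' in nhds y. y' \<in> S \<longrightarrow> vb y' \<ge> vb y + ((1 / (2 * E n)) *\<^sub>R (x - y) - (1/2) *\<^sub>R p) \<bullet> (y' - y) + ((y' - y) \<bullet> Y (y' - y)) / 2)"
      using theorem_on_sums[OF S Sne u_S v_S E(1) r] by blast
    show ?thesis
      by (rule exI[of _ p], rule exI[of _ x], rule exI[of _ y], unfold maxi_def jet_def) (intro conjI ballI * ** ***[OF E(1)])
  qed
  then obtain p x y where pr: "\<And>n. norm (p n) < r n" and xS: "\<And>n. x n \<in> S" and yS: "\<And>n. y n \<in> S"
    and maxi: "\<And>n. maxi n (p n) (x n) (y n)" and jets: "\<And>n. jet n (p n) (x n) (y n)" by metis
  have max: "ub x' - vb y' - (norm (x' - y'))\<^sup>2 / (4 * E n) - (p n \<bullet> (x' + y')) / 2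
      \<le> ub (x n) - vb (y n) - (norm (x n - y n))\<^sup>2 / (4 * E n) - (p n \<bullet> (x n + y n)) / 2"
    if "x' \<in> S" "y' \<in> S" for n x' y'
    using maxi[of n] that unfolding maxi_def by blast
  have pE: "norm (p n) \<le> E n" for n using pr[of n] by (simp add: r_def)
  \<comment> \<open>Comparison with the diagonal pair \<open>(zm, zm)\<close>; the linear
    perturbation costs at most \<open>2 * R * E n\<close>.\<close>
  have val: "\<mu> - 2 * R * E n \<le> ub (x n) - vb (y n) - 1 / (4 * E n) * (norm (x n - y n))\<^sup>2" for n
  proof -
    have ip: "\<bar>p n \<bullet> z\<bar> \<le> E n * R" if "norm z \<le> R" for z
    proof -
      have "\<bar>p n \<bullet> z\<bar> \<le> norm (p n) * norm z" by (rule Cauchy_Schwarz_ineq2)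
      also have "\<dots> \<le> E n * R" using pE[of n] that E(1)[of n] by (intro mult_mono) auto
      finally show ?thesis .
    qed
    have "\<bar>p n \<bullet> zm\<bar> \<le> E n * R" "\<bar>p n \<bullet> x n\<bar> \<le> E n * R" "\<bar>p n \<bullet> y n\<bar> \<le> E n * R"
      using ip[OF SR[OF zm(1)]] ip[OF SR[OF xS[of n]]] ip[OF SR[OF yS[of n]]] .
    moreover have "\<mu> - (p n \<bullet> zm + p n \<bullet> zm) / 2
        \<le> ub (x n) - vb (y n) - (norm (x n - y n))\<^sup>2 / (4 * E n) - (p n \<bullet> x n + p n \<bullet> y n) / 2"
      using max[OF zm(1) zm(1), of n] unfolding \<mu>_def inner_add_right by simp
    moreover have "2 * R * E n = E n * R + E n * R"
      "1 / (4 * E n) * (norm (x n - y n))\<^sup>2 = (norm (x n - y n))\<^sup>2 / (4 * E n)" by simp_all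
    ultimately show ?thesis by argo
  qed
  have E0: "E \<longlonglongrightarrow> 0"
    using LIMSEQ_inverse_real_of_nat by (simp add: E_def[abs_def] inverse_eq_divide add.commute)
  have \<beta>0: "(\<lambda>n. 2 * R * E n) \<longlonglongrightarrow> 0" using tendsto_mult_left[OF E0, of "2 * R"] by simp
  have a_top: "filterlim (\<lambda>n. 1 / (4 * E n)) at_top sequentially"
  proof -
    have "Z \<le> 1 / (4 * E n)" if "n \<ge> nat \<lceil>4 * Z\<rceil>" for Z n
    proof -
      have "4 * Z \<le> real n" using that by linarith
      then show ?thesis by (simp add: E_def)
    qed
    then show ?thesis unfolding filterlim_at_top eventually_sequentially by blast
  qed
  obtain \<rho> z where \<rho>: "strict_mono \<rho>" and z: "z \<in> S" and xz: "(x \<circ> \<rho>) \<longlonglongrightarrow> z" and yz: "(y \<circ> \<rho>) \<longlonglongrightarrow> z"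
    and zmax: "ub z - vb z = \<mu>"
    and pen: "(\<lambda>n. 1 / (4 * E (\<rho> n)) * (norm (x (\<rho> n) - y (\<rho> n)))\<^sup>2) \<longlonglongrightarrow> 0"
    by (rule doubling_limit[OF S u_S v_S xS yS zm(2)[folded \<mu>_def] val \<beta>0 a_top])
  define V where "V = U \<inter> ball 0 R"
  have V: "open V" "V \<subseteq> S" "V \<subseteq> U" using U closure_subset[of U] by (auto simp: V_def S_def)
  \<comment> \<open>The difference is nonpositive on the sphere and on the frontier, but equals
    \<open>\<mu> > 0\<close> at \<open>z\<close>.\<close>
  have "z \<in> V"
  proof -
    have "norm z \<noteq> R" using sphere_le[of z] zmax \<mu> by auto
    moreover have "z \<notin> frontier U" using fr_le[of z] zmax \<mu> by auto
    ultimately show ?thesis using z U by (auto simp: V_def S_def frontier_def interior_open)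
  qed
  then have evV: "\<forall>\<^sub>F n in sequentially. x (\<rho> n) \<in> V \<and> y (\<rho> n) \<in> V"
    using topological_tendstoD[OF xz V(1)] topological_tendstoD[OF yz V(1)] by (simp add: eventually_conj_iff)
  \<comment> \<open>The share of the Jensen gap that is used: its additive constant then costs at
    most a quarter of \<open>\<delta> * \<mu>\<close>.\<close>
  define s where "s = min 1 (\<delta> * \<mu> / (4 * (C + 1)))"
  have s: "s > 0" "s \<le> 1" using \<delta> \<mu> cC by (auto simp: s_def)
  have sC: "s * C \<le> \<delta> * \<mu> / 4"
  proof -
    have "s * C \<le> s * (C + 1)" using s by simp
    also have "\<dots> \<le> (\<delta> * \<mu> / (4 * (C + 1))) * (C + 1)"
      using cC by (intro mult_right_mono) (auto simp: s_def)
    also have "\<dots> = \<delta> * \<mu> / 4" using cC by (simp add: field_simps)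
    finally show ?thesis .
  qed
  have key: "\<exists>G\<ge>0. \<delta> * (ub (x n) - vb (y n)) \<le> (\<Lambda>2\<^sup>2 * (norm (x n - y n))\<^sup>2 / E n + E n * \<Lambda>2\<^sup>2) / 2 + E n
      + (\<Lambda>1 * 2 powr m + M) * norm (x n - y n) + (\<Lambda>1 * 2 powr m * norm (x n - y n) - s * c) * G + s * C"
    if "x n \<in> V" "y n \<in> V" for n
  proof -
    obtain X Y where X: "linear X" "\<And>a b. X a \<bullet> b = a \<bullet> X b" and Y: "linear Y" "\<And>a b. Y a \<bullet> b = a \<bullet> Y b"
      and XY: "\<And>e f. e \<bullet> X e - f \<bullet> Y f \<le> (norm (e - f))\<^sup>2 / E n + E n * (norm f)\<^sup>2"
      and ut: "\<forall>\<^sub>F x' in nhds (x n). x' \<in> S \<longrightarrow> ub x' \<le> ub (x n) + ((1 / (2 * E n)) *\<^sub>R (x n - y n) + (1/2) *\<^sub>R p n) \<bullet> (x' - x n) + ((x' - x n) \<bullet> X (x' - x n)) / 2"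
      and vt: "\<forall>\<^sub>F y' in nhds (y n). y' \<in> S \<longrightarrow> vb y' \<ge> vb (y n) + ((1 / (2 * E n)) *\<^sub>R (x n - y n) - (1/2) *\<^sub>R p n) \<bullet> (y' - y n) + ((y' - y n) \<bullet> Y (y' - y n)) / 2"
      using jets[of n] unfolding jet_def by blast
    define q where "q = (1 / (2 * E n)) *\<^sub>R (x n - y n) + (1/2) *\<^sub>R p n"
    define q' where "q' = (1 / (2 * E n)) *\<^sub>R (x n - y n) - (1/2) *\<^sub>R p n"
    have U': "x n \<in> U" "y n \<in> U" and B: "x n \<in> ball 0 R" "y n \<in> ball 0 R" using that by (auto simp: V_def)
    have near: "\<forall>\<^sub>F x' in nhds (x n). x' \<in> V" "\<forall>\<^sub>F x' in nhds (y n). x' \<in> V"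
      using that V(1) by (auto intro: eventually_nhds_in_open)
    have touch: "\<forall>\<^sub>F x' in nhds (x n). lam * u x' - (1 - lam) * (japanese_bracket x' + K)
        \<le> lam * u (x n) - (1 - lam) * (japanese_bracket (x n) + K) + q \<bullet> (x' - x n) + ((x' - x n) \<bullet> X (x' - x n)) / 2"
      using ut near(1)
    proof eventually_elim
      case (elim x')
      then have "x' \<in> S" "x' \<in> U" using V by auto
      then show ?case using elim(1) by (simp add: uU U' q_def)
    qed
    obtain Q b where Qb: "norm b \<le> 1" "q = lam *\<^sub>R Q + (1 - lam) *\<^sub>R b"
      and Eu: "\<delta> * (lam * u (x n) - (1 - lam) * (japanese_bracket (x n) + K)) - (\<Sum>k\<in>UNIV. (\<sigma> (x n) $ k) \<bullet> X (\<sigma> (x n) $ k)) / 2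
      + lam * H Q (x n) + (1 - lam) * H b (x n) \<le> 0"
      by (rule perturbed_subsol[OF sub A H m \<Lambda>1 \<delta> lam K U'(1) X touch])
    from Eu have E1: "\<delta> * ub (x n) - (\<Sum>k\<in>UNIV. (\<sigma> (x n) $ k) \<bullet> X (\<sigma> (x n) $ k)) / 2
      + lam * H Q (x n) + (1 - lam) * H b (x n) \<le> 0" by (simp add: uU U')
    have "\<forall>\<^sub>F y' in nhds (y n). v y' \<ge> v (y n) + q' \<bullet> (y' - y n) + ((y' - y n) \<bullet> Y (y' - y n)) / 2"
      using vt near(2)
    proof eventually_elim
      case (elim y')
      then have "y' \<in> S" "y' \<in> U" using V by auto
      then show ?case using elim(1) by (simp add: vU U' q'_def)
    qed
    then have E2: "\<delta> * vb (y n) - (\<Sum>k\<in>UNIV. (\<sigma> (y n) $ k) \<bullet> Y (\<sigma> (y n) $ k)) / 2 + H q' (y n) \<ge> 0"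
      using visc_supersol_quadratic[OF super A U'(2) Y] by (simp add: vU U')
    have E3: "(\<Sum>k\<in>UNIV. (\<sigma> (x n) $ k) \<bullet> X (\<sigma> (x n) $ k)) - (\<Sum>k\<in>UNIV. (\<sigma> (y n) $ k) \<bullet> Y (\<sigma> (y n) $ k))
        \<le> \<Lambda>2\<^sup>2 * (norm (x n - y n))\<^sup>2 / E n + E n * \<Lambda>2\<^sup>2"
    proof -
      have "(\<Sum>k\<in>UNIV. (\<sigma> (x n) $ k) \<bullet> X (\<sigma> (x n) $ k)) - (\<Sum>k\<in>UNIV. (\<sigma> (y n) $ k) \<bullet> Y (\<sigma> (y n) $ k))
        \<le> (\<Sum>k\<in>UNIV. (norm (\<sigma> (x n) $ k - \<sigma> (y n) $ k))\<^sup>2 / E n + E n * (norm (\<sigma> (y n) $ k))\<^sup>2)"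
        unfolding sum_subtractf[symmetric] by (intro sum_mono XY)
      also have "\<dots> = (norm (\<sigma> (x n) - \<sigma> (y n)))\<^sup>2 / E n + E n * (norm (\<sigma> (y n)))\<^sup>2"
        by (simp add: norm_matrix_sq sum.distrib sum_divide_distrib sum_distrib_left)
      also have "\<dots> \<le> (\<Lambda>2 * norm (x n - y n))\<^sup>2 / E n + E n * \<Lambda>2\<^sup>2"
        using A E(1)[of n] unfolding diffusion_coeff_def
        by (intro add_mono divide_right_mono mult_left_mono power_mono) auto
      finally show ?thesis by (simp add: power_mult_distrib)
    qed
    have E4: "H q' (y n) \<le> H q (y n) + E n"
    proof -
      have xy2: "norm (x n - y n) \<le> 2 * R"
        using norm_triangle_ineq4[of "x n" "y n"] SR[OF xS] SR[OF yS] by (smt (verit))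
      have "norm ((1 / (2 * E n)) *\<^sub>R (x n - y n)) \<le> R / E n"
        using xy2 E(1)[of n] unfolding norm_scaleR by (simp add: field_simps)
      moreover have "norm ((1/2) *\<^sub>R p n) \<le> 1/2" using pE[of n] E(2)[of n] by simp
      ultimately have "norm q \<le> R / E n + 1/2" "norm q' \<le> R / E n + 1/2"
        unfolding q_def q'_def by (smt (verit) norm_triangle_ineq norm_triangle_ineq4)+
      then have "norm q' + norm q + 1 \<le> 2 * R / E n + 2" by simp
      then have "(norm q' + norm q + 1) powr (m - 1) \<le> (2 * R / E n + 2) powr (m - 1)"
        using m by (intro powr_mono2) auto
      then have "\<Lambda>1 * (norm q' + norm q + 1) powr (m - 1) * norm (q' - q) \<le> \<Lambda>1 * (2 * R / E n + 2) powr (m - 1) * norm (q' - q)"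
        using \<Lambda>1 by (intro mult_right_mono mult_left_mono) auto
      also have dq: "q' - q = - p n"
      proof -
        have "(1/2) *\<^sub>R p n + (1/2) *\<^sub>R p n = p n" by (simp add: scaleR_left_distrib[symmetric])
        then show ?thesis unfolding q_def q'_def by (simp add: algebra_simps)
      qed
      also have "\<Lambda>1 * (2 * R / E n + 2) powr (m - 1) * norm (- p n) \<le> E n"
        using r_le[of "norm (p n)" n] pr[of n] by simp
      finally have "\<bar>H q' (y n) - H q (y n)\<bar> \<le> E n" using HR[OF B(2) B(2), of q' q] unfolding dq by linarith
      then show ?thesis by linarith
    qed
    define G where "G = norm Q powr m"
    have G: "G \<ge> 0" by (simp add: G_def)
    \<comment> \<open>The error involves the slope \<open>q\<close>, the gain is measured in
      \<open>Q\<close>. As \<open>q\<close> is a convex combination of \<open>Q\<close> and a vector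
      of norm at most 1, \<open>norm q\<close> is at most \<open>norm Q + 1\<close>.\<close>
    have E5: "H q (y n) \<le> H q (x n) + (\<Lambda>1 * (2 powr m * (G + 1)) + M) * norm (x n - y n)"
    proof -
      have "norm q \<le> lam * norm Q + (1 - lam) * norm b"
        using norm_triangle_ineq[of "lam *\<^sub>R Q" "(1 - lam) *\<^sub>R b"] lam by (simp add: Qb(2))
      also have "\<dots> \<le> 1 * norm Q + 1 * 1"
        using lam Qb(1) by (intro add_mono mult_mono) auto
      finally have "norm q powr m \<le> (norm Q + 1) powr m" using m by (intro powr_mono2) auto
      also have "\<dots> \<le> 2 powr m * (G + 1)" unfolding G_def using m by (intro powr_add_one_le) auto
      finally have "(\<Lambda>1 * norm q powr m + M) * norm (x n - y n) \<le> (\<Lambda>1 * (2 powr m * (G + 1)) + M) * norm (x n - y n)"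
        using \<Lambda>1 by (intro mult_right_mono add_right_mono mult_left_mono) auto
      then show ?thesis using HR[OF B, of q] by (smt (verit))
    qed
    \<comment> \<open>The gap is at least \<open>c * G - C\<close> and, by convexity alone, at least
      0; so it dominates \<open>s\<close> times the former.\<close>
    have E6: "s * (c * G - C) \<le> lam * H Q (x n) + (1 - lam) * H b (x n) - H q (x n)"
    proof -
      have 1: "c * G - C \<le> lam * H Q (x n) + (1 - lam) * H b (x n) - H q (x n)"
        unfolding G_def Qb(2) using HR[OF B(1) B(1)] by (intro gap[OF conv _ _ Qb(1)]) auto
      have 2: "0 \<le> lam * H Q (x n) + (1 - lam) * H b (x n) - H q (x n)"
        unfolding Qb(2) using convex_onD[OF conv[of "x n"], of "1 - lam" Q b] lam by simp
      show ?thesis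
      proof (cases "c * G - C \<le> 0")
        case True
        then have "s * (c * G - C) \<le> 0" using s by (simp add: mult_nonneg_nonpos)
        then show ?thesis using 2 by (rule order_trans)
      next
        case False
        then have "s * (c * G - C) \<le> 1 * (c * G - C)" using s by (intro mult_right_mono) auto
        then show ?thesis using 1 unfolding mult_1 by (rule order_trans)
      qed
    qed
    have arith: "du - dv \<le> e3 / 2 + e + e5 - g"
      if "du - s1 / 2 + A + B \<le> 0" "0 \<le> dv - s2 / 2 + h'" "s1 - s2 \<le> e3" "h' \<le> hq + e" "hq \<le> hx + e5" "g \<le> A + B - hx"
      for du dv e3 e e5 g s1 s2 A B h' hq hx :: real
      using that by linarith
    have "\<delta> * (ub (x n) - vb (y n)) \<le> (\<Lambda>2\<^sup>2 * (norm (x n - y n))\<^sup>2 / E n + E n * \<Lambda>2\<^sup>2) / 2 + E n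
      + (\<Lambda>1 * (2 powr m * (G + 1)) + M) * norm (x n - y n) - s * (c * G - C)"
      unfolding right_diff_distrib[of \<delta>] by (rule arith[OF E1 E2 E3 E4 E5 E6])
    also have "\<dots> = (\<Lambda>2\<^sup>2 * (norm (x n - y n))\<^sup>2 / E n + E n * \<Lambda>2\<^sup>2) / 2 + E n
      + (\<Lambda>1 * 2 powr m + M) * norm (x n - y n) + (\<Lambda>1 * 2 powr m * norm (x n - y n) - s * c) * G + s * C"
      by (simp add: algebra_simps)
    finally show ?thesis using G by blast
  qed
  have E\<rho>: "(\<lambda>n. E (\<rho> n)) \<longlonglongrightarrow> 0" by (rule filterlim_compose[OF E0 filterlim_subseq[OF \<rho>]])
  have xy0: "(\<lambda>n. norm (x (\<rho> n) - y (\<rho> n))) \<longlonglongrightarrow> 0"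
    using tendsto_norm[OF tendsto_diff[OF xz yz]] by (simp add: o_def)
  \<comment> \<open>Collects the terms that vanish in the limit. The factor 4 rewrites |x - y|^2 / E
    through the penalty, which tends to 0 by \<open>doubling_limit\<close>.\<close>
  define t where "t n = \<delta> * (2 * R * E (\<rho> n)) + (4 * \<Lambda>2\<^sup>2 * (1 / (4 * E (\<rho> n)) * (norm (x (\<rho> n) - y (\<rho> n)))\<^sup>2) + E (\<rho> n) * \<Lambda>2\<^sup>2) / 2
     + E (\<rho> n) + (\<Lambda>1 * 2 powr m + M) * norm (x (\<rho> n) - y (\<rho> n))" for n
  have "t \<longlonglongrightarrow> \<delta> * (2 * R * 0) + (4 * \<Lambda>2\<^sup>2 * 0 + 0 * \<Lambda>2\<^sup>2) / 2 + 0 + (\<Lambda>1 * 2 powr m + M) * 0"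
    unfolding t_def by (intro tendsto_intros E\<rho> xy0 pen) auto
  then have ev1: "\<forall>\<^sub>F n in sequentially. t n < \<delta> * \<mu> / 2"
    using order_tendstoD(2)[of t 0 sequentially "\<delta> * \<mu> / 2"] \<delta> \<mu> by simp
  have "(\<lambda>n. \<Lambda>1 * 2 powr m * norm (x (\<rho> n) - y (\<rho> n))) \<longlonglongrightarrow> \<Lambda>1 * 2 powr m * 0"
    by (intro tendsto_intros xy0)
  then have ev2: "\<forall>\<^sub>F n in sequentially. \<Lambda>1 * 2 powr m * norm (x (\<rho> n) - y (\<rho> n)) < s * c"
    using order_tendstoD(2)[of _ 0 sequentially "s * c"] s cC by simp
  have "\<forall>\<^sub>F n in sequentially. False"
    using ev1 ev2 evV
  proof eventually_elim
    case (elim n)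
    obtain G where G: "G \<ge> 0" and le: "\<delta> * (ub (x (\<rho> n)) - vb (y (\<rho> n))) \<le> (\<Lambda>2\<^sup>2 * (norm (x (\<rho> n) - y (\<rho> n)))\<^sup>2 / E (\<rho> n) + E (\<rho> n) * \<Lambda>2\<^sup>2) / 2 + E (\<rho> n)
      + (\<Lambda>1 * 2 powr m + M) * norm (x (\<rho> n) - y (\<rho> n)) + (\<Lambda>1 * 2 powr m * norm (x (\<rho> n) - y (\<rho> n)) - s * c) * G + s * C"
      using key[of "\<rho> n"] elim by blast
    have f1: "(\<Lambda>1 * 2 powr m * norm (x (\<rho> n) - y (\<rho> n)) - s * c) * G \<le> 0"
      using elim G by (intro mult_nonpos_nonneg) auto
    have f2: "\<delta> * (\<mu> - 2 * R * E (\<rho> n)) \<le> \<delta> * (ub (x (\<rho> n)) - vb (y (\<rho> n)))"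
    proof (rule mult_left_mono)
      have "0 \<le> 1 / (4 * E (\<rho> n)) * (norm (x (\<rho> n) - y (\<rho> n)))\<^sup>2" using E(1)[of "\<rho> n"] by simp
      then show "\<mu> - 2 * R * E (\<rho> n) \<le> ub (x (\<rho> n)) - vb (y (\<rho> n))" using val[of "\<rho> n"] by linarith
    qed (use \<delta> in simp)
    have f3: "4 * \<Lambda>2\<^sup>2 * (1 / (4 * E (\<rho> n)) * (norm (x (\<rho> n) - y (\<rho> n)))\<^sup>2) = \<Lambda>2\<^sup>2 * (norm (x (\<rho> n) - y (\<rho> n)))\<^sup>2 / E (\<rho> n)"
      by simp
    \<comment> \<open>With \<open>dm\<close> for \<open>\<delta> * \<mu>\<close> this amounts to
      \<open>dm < dm / 2 + dm / 4\<close>.\<close>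
    have arith: False
      if "Z \<le> 0" "dm - B \<le> L" "W' = W" "0 < dm" "L \<le> (W + e2) / 2 + e + d + Z + sc" "sc \<le> dm / 4"
        "B + (W' + e2) / 2 + e + d < dm / 2"
      for Z dm B L W' W e2 e d sc :: real
      using that by argo
    show False
      by (rule arith[OF f1 f2[unfolded right_diff_distrib[of \<delta>]] f3 mult_pos_pos[OF \<delta> \<mu>]
          le[unfolded right_diff_distrib[of \<delta>]] sC elim(1)[unfolded t_def]])
  qed
  then show False by simp
qed

theorem theorem2p1:
  fixes m \<Lambda>1 \<Lambda>2 \<delta> :: real
    and \<sigma> :: "real^'d \<Rightarrow> real^'d^'n"
    and A :: "real^'d \<Rightarrow> real^'d^'d"
    and H :: "real^'d \<Rightarrow> real^'d \<Rightarrow> real"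
    and U :: "(real^'d) set"
    and u v :: "real^'d \<Rightarrow> real"
  assumes "m > 1" and "\<Lambda>1 \<ge> 1" and "\<Lambda>2 \<ge> 0"
    and "diffusion_coeff \<Lambda>2 \<sigma> A"
    and "hamiltonian m \<Lambda>1 H"
    and "\<delta> > 0" and "open U"
    and "usc_on (closure U) u" and "usc_on (closure U) (\<lambda>x. - v x)"
    and "visc_subsol \<delta> A H U u" and "visc_supersol \<delta> A H U v"
    and "\<forall>x\<in>frontier U. u x \<le> v x"
    and "Limsup (inf at_infinity (principal U)) (\<lambda>x. ereal (u x / (1 + norm x))) \<le> 0"
    and "0 \<le> Liminf (inf at_infinity (principal U)) (\<lambda>x. ereal (v x / (1 + norm x)))"
  shows "\<forall>x\<in>U. u x \<le> v x"
proof
  fix x assume x: "x \<in> U"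
  let ?F = "inf at_infinity (principal U)"
  \<comment> \<open>For bounded \<open>U\<close> the filter \<open>?F\<close> is \<open>bot\<close>
    and the eventual bound holds vacuously, so no case distinction is made.\<close>
  have gu: "\<exists>K\<ge>0. \<forall>x\<in>U. u x \<le> \<eta> * japanese_bracket x + K" if "\<eta> > 0" for \<eta>
  proof -
    have "Limsup ?F (\<lambda>x. ereal (u x / (1 + norm x))) < ereal (\<eta> / 2)"
      using assms(13) that by (intro order.strict_trans1[OF assms(13)]) (simp add: zero_ereal_def)
    then have "\<forall>\<^sub>F x in ?F. ereal (u x / (1 + norm x)) < ereal (\<eta> / 2)"
      by (rule Limsup_lessD)
    then show ?thesis using growth_bound[OF assms(8) that] by (metis (mono_tags, lifting) eventually_mono less_ereal.simps(1))
  qed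
  have gv: "\<exists>K\<ge>0. \<forall>x\<in>U. - v x \<le> \<eta> * japanese_bracket x + K" if "\<eta> > 0" for \<eta>
  proof -
    have "ereal (- (\<eta> / 2)) < Liminf ?F (\<lambda>x. ereal (v x / (1 + norm x)))"
      using that by (intro order.strict_trans2[OF _ assms(14)]) (simp add: zero_ereal_def)
    then have "\<forall>\<^sub>F x in ?F. ereal (- (\<eta> / 2)) < ereal (v x / (1 + norm x))"
      by (rule less_LiminfD)
    then have "\<forall>\<^sub>F x in ?F. - v x / (1 + norm x) < \<eta> / 2"
      by eventually_elim simp
    then show ?thesis using growth_bound[OF assms(9) that] by metis
  qed
  obtain K0 where K0: "\<And>x. x \<in> U \<Longrightarrow> - v x \<le> 1 * japanese_bracket x + K0" using gv[of 1] by auto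
  \<comment> \<open>Both demands on \<open>K\<close> are met before \<open>lam\<close> is chosen:
    the lower bound on \<open>v\<close> with slope 1, and the subsolution property of the
    weight.\<close>
  define K where "K = max K0 ((\<Lambda>2\<^sup>2 / 2 + 2 * \<Lambda>1) / \<delta>)"
  have K: "\<Lambda>2\<^sup>2 / 2 + 2 * \<Lambda>1 \<le> \<delta> * K"
  proof -
    have "(\<Lambda>2\<^sup>2 / 2 + 2 * \<Lambda>1) / \<delta> \<le> K" by (simp add: K_def)
    then show ?thesis using assms(6) by (simp add: pos_divide_le_eq mult.commute)
  qed
  have vK: "- (japanese_bracket x + K) \<le> v x" if "x \<in> U" for x
    using K0[OF that] by (simp add: K_def max_def)
  have le: "lam * u x - (1 - lam) * (japanese_bracket x + K) \<le> v x" if lam: "0 < lam" "lam < 1" for lam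
  proof -
    have \<eta>: "(1 - lam) / 4 > 0" using lam by simp
    obtain Ku where Ku: "Ku \<ge> 0" "\<And>x. x \<in> U \<Longrightarrow> u x \<le> (1 - lam) / 4 * japanese_bracket x + Ku" using gu[OF \<eta>] by blast
    obtain Kv where Kv: "Kv \<ge> 0" "\<And>x. x \<in> U \<Longrightarrow> - v x \<le> (1 - lam) / 4 * japanese_bracket x + Kv" using gv[OF \<eta>] by blast
    show ?thesis
    proof (rule perturbed_comparison[OF assms(1-11) _ lam K vK _ _ _ x])
      show "max Ku Kv \<ge> 0" using Ku by simp
      show "u x \<le> (1 - lam) / 4 * japanese_bracket x + max Ku Kv" if "x \<in> U" for x
        using Ku(2)[OF that] by linarith
      show "- ((1 - lam) / 4 * japanese_bracket x + max Ku Kv) \<le> v x" if "x \<in> U" for x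
        using Kv(2)[OF that] by linarith
    qed (use assms(12) in auto)
  qed
  \<comment> \<open>\<open>x\<close> and \<open>K\<close> stay fixed while \<open>lam\<close>
    increases to 1, so the weight disappears.\<close>
  have "((\<lambda>lam. lam * u x - (1 - lam) * (japanese_bracket x + K)) \<longlongrightarrow> 1 * u x - (1 - 1) * (japanese_bracket x + K)) (at_left 1)"
    by (intro tendsto_intros)
  moreover have "\<forall>\<^sub>F lam in at_left (1::real). lam * u x - (1 - lam) * (japanese_bracket x + K) \<le> v x"
    unfolding eventually_at_left_field by (intro exI[of _ 0]) (auto intro: le)
  ultimately have "1 * u x - (1 - 1) * (japanese_bracket x + K) \<le> v x"
    by (intro tendsto_upperbound[OF _ _ trivial_limit_at_left_real])
  then show "u x \<le> v x" by simp
qed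

end
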